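(* Let $\pi:B\to T$ be a surjective ring homomorphism, where $T$ is an overring of some ring $R$. Assume that $\ker(\pi)$ is a regular ideal of $B$, and set $A:=\pi^{-1}(R)$. Then: (1) $A$ is a Prüfer ring if and only if both $B$ and $R$ are Prüfer rings. (2) $A$ is a Gaussian (respectively, arithmetical) ring if and only if both $B$ and $R$ are Gaussian (respectively, arithmetical) rings. (3) If both $B$ and $R$ are rings of weak global dimension $\leq 1$ (respectively, semihereditary rings), then so is $A$.
   Context: All rings are commutative with identity. $\mathrm{Tot}(R)$ denotes the total ring of fractions of $R$; an overring of $R$ is a subring of $\mathrm{Tot}(R)$ containing $R$. A regular element is an element that is not a zero-divisor, and an ideal is regular if it contains a regular element. A ring $R$ is: semihereditary if every finitely generated ideal of $R$ is projective; of weak global dimension $\leq 1$ if every ideal of $R$ is flat; arithmetical if $\mathfrak a\cap(\mathfrak b+\mathfrak c)=(\mathfrak a\cap\mathfrak b)+(\mathfrak a\cap\mathfrak c)$ for all ideals $\mathfrak a,\mathfrak b,\mathfrak c$ of $R$; Gaussian if $c_R(f)c_R(g)=c_R(fg)$ for all $f,g\in R[X]$, where $c_R(f)$ is the ideal of $R$ generated by the coefficients of $f$; a Prüfer ring if every finitely generated regular ideal of $R$ is invertible (as a submodule of $\mathrm{Tot}(R)$). *)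

theory Defs
  imports
    "HOL-Algebra.UnivPoly"
    "HOL-Algebra.Ideal_Product"
    "HOL-Algebra.Subrings"
    "HOL-Algebra.Free_Abelian_Groups"
begin

text \<open>
  All notions below are meant for commutative rings with identity, i.e. for structures satisfying
  \<^locale>\<open>cring\<close>; the zero ring is not excluded.  A subring \<open>S\<close> of \<open>R\<close>, regarded as a ring in its
  own right, is \<open>R\<lparr>carrier := S\<rparr>\<close>.
\<close>

section \<open>Regular elements and the total ring of fractions\<close>

definition regular_elements :: "('a, 'm) ring_scheme \<Rightarrow> 'a set" where
  "regular_elements R =
     {s \<in> carrier R. \<forall>x \<in> carrier R. s \<otimes>\<^bsub>R\<^esub> x = \<zero>\<^bsub>R\<^esub> \<longrightarrow> x = \<zero>\<^bsub>R\<^esub>}"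

definition regular_ideal :: "'a set \<Rightarrow> ('a, 'm) ring_scheme \<Rightarrow> bool" where
  "regular_ideal I R \<longleftrightarrow> ideal I R \<and> I \<inter> regular_elements R \<noteq> {}"

text \<open>The fraction \<open>a / s\<close>, as the equivalence class of the pair \<open>(a, s)\<close>.\<close>

definition fraction :: "('a, 'm) ring_scheme \<Rightarrow> 'a \<Rightarrow> 'a \<Rightarrow> ('a \<times> 'a) set" where
  "fraction R a s =
     {(b, t). b \<in> carrier R \<and> t \<in> regular_elements R \<and> a \<otimes>\<^bsub>R\<^esub> t = b \<otimes>\<^bsub>R\<^esub> s}"

text \<open>
  The unions in the operations run over all representatives; for classes in the carrier all the
  united sets coincide.
\<close>

definition tot :: "('a, 'm) ring_scheme \<Rightarrow> ('a \<times> 'a) set ring" where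
  "tot R =
     \<lparr> carrier = {fraction R a s | a s. a \<in> carrier R \<and> s \<in> regular_elements R},
       monoid.mult = (\<lambda>X Y. \<Union>(a, s) \<in> X. \<Union>(b, t) \<in> Y. fraction R (a \<otimes>\<^bsub>R\<^esub> b) (s \<otimes>\<^bsub>R\<^esub> t)),
       one = fraction R \<one>\<^bsub>R\<^esub> \<one>\<^bsub>R\<^esub>,
       ring.zero = fraction R \<zero>\<^bsub>R\<^esub> \<one>\<^bsub>R\<^esub>,
       add = (\<lambda>X Y. \<Union>(a, s) \<in> X. \<Union>(b, t) \<in> Y.
                fraction R ((a \<otimes>\<^bsub>R\<^esub> t) \<oplus>\<^bsub>R\<^esub> (b \<otimes>\<^bsub>R\<^esub> s)) (s \<otimes>\<^bsub>R\<^esub> t)) \<rparr>"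

definition tot_embed :: "('a, 'm) ring_scheme \<Rightarrow> 'a \<Rightarrow> ('a \<times> 'a) set" where
  "tot_embed R a = fraction R a \<one>\<^bsub>R\<^esub>"

text \<open>The copy of \<open>R\<close> inside its total ring of fractions.\<close>

abbreviation in_tot :: "('a, 'm) ring_scheme \<Rightarrow> ('a \<times> 'a) set set" where
  "in_tot R \<equiv> tot_embed R ` carrier R"

definition overring :: "('a \<times> 'a) set set \<Rightarrow> ('a, 'm) ring_scheme \<Rightarrow> bool" where
  "overring T R \<longleftrightarrow> subcring T (tot R) \<and> in_tot R \<subseteq> T"

section \<open>Modules\<close>

text \<open>A ring \<open>S\<close> as a module over \<open>R\<close> along \<open>\<phi> : R \<rightarrow> S\<close>.\<close>

definition scalar_module :: "('a \<Rightarrow> 'c) \<Rightarrow> ('c, 'm) ring_scheme \<Rightarrow> ('a, 'c) module" where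
  "scalar_module \<phi> S =
     \<lparr> carrier = carrier S, monoid.mult = monoid.mult S, one = one S, ring.zero = ring.zero S, add = add S,
       smult = (\<lambda>r x. \<phi> r \<otimes>\<^bsub>S\<^esub> x) \<rparr>"

definition ideal_module :: "('a, 'm) ring_scheme \<Rightarrow> 'a set \<Rightarrow> ('a, 'a) module" where
  "ideal_module R I = (scalar_module (\<lambda>r. r) R)\<lparr>carrier := I\<rparr>"

definition module_hom ::
  "('a, 'm) ring_scheme \<Rightarrow> ('a, 'c, 'p) module_scheme \<Rightarrow> ('a, 'd, 'q) module_scheme
     \<Rightarrow> ('c \<Rightarrow> 'd) set" where
  "module_hom R M N =
     {f \<in> carrier M \<rightarrow> carrier N.
        (\<forall>x \<in> carrier M. \<forall>y \<in> carrier M. f (x \<oplus>\<^bsub>M\<^esub> y) = f x \<oplus>\<^bsub>N\<^esub> f y) \<and>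
        (\<forall>r \<in> carrier R. \<forall>x \<in> carrier M. f (r \<odot>\<^bsub>M\<^esub> x) = r \<odot>\<^bsub>N\<^esub> f x)}"

text \<open>
  \<open>M \<otimes>\<^bsub>R\<^esub> N\<close> is the free abelian group on the pairs \<open>(m, n)\<close> modulo the bilinearity relations.  Its
  \<open>R\<close>-module structure is not needed: flatness only speaks about injectivity of maps.
\<close>

definition tensor_free ::
  "('a, 'c, 'p) module_scheme \<Rightarrow> ('a, 'd, 'q) module_scheme \<Rightarrow> ('c \<times> 'd \<Rightarrow>\<^sub>0 int) monoid" where
  "tensor_free M N = free_Abelian_group (carrier M \<times> carrier N)"

definition tensor_relations ::
  "('a, 'm) ring_scheme \<Rightarrow> ('a, 'c, 'p) module_scheme \<Rightarrow> ('a, 'd, 'q) module_scheme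
     \<Rightarrow> ('c \<times> 'd \<Rightarrow>\<^sub>0 int) set" where
  "tensor_relations R M N =
     {frag_of (x \<oplus>\<^bsub>M\<^esub> y, n) - frag_of (x, n) - frag_of (y, n) | x y n.
        x \<in> carrier M \<and> y \<in> carrier M \<and> n \<in> carrier N} \<union>
     {frag_of (x, n \<oplus>\<^bsub>N\<^esub> k) - frag_of (x, n) - frag_of (x, k) | x n k.
        x \<in> carrier M \<and> n \<in> carrier N \<and> k \<in> carrier N} \<union>
     {frag_of (r \<odot>\<^bsub>M\<^esub> x, n) - frag_of (x, r \<odot>\<^bsub>N\<^esub> n) | r x n.
        r \<in> carrier R \<and> x \<in> carrier M \<and> n \<in> carrier N}"

definition tensor_null ::
  "('a, 'm) ring_scheme \<Rightarrow> ('a, 'c, 'p) module_scheme \<Rightarrow> ('a, 'd, 'q) module_scheme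
     \<Rightarrow> ('c \<times> 'd \<Rightarrow>\<^sub>0 int) set" where
  "tensor_null R M N = generate (tensor_free M N) (tensor_relations R M N)"

definition tensor ::
  "('a, 'm) ring_scheme \<Rightarrow> ('a, 'c, 'p) module_scheme \<Rightarrow> ('a, 'd, 'q) module_scheme
     \<Rightarrow> ('c \<times> 'd \<Rightarrow>\<^sub>0 int) set monoid" where
  "tensor R M N = tensor_free M N Mod tensor_null R M N"

text \<open>
  The map \<open>id \<otimes> f : M \<otimes> N \<rightarrow> M \<otimes> N'\<close>.  All members \<open>c\<close> of a coset \<open>X\<close> yield the same coset if \<open>f\<close>
  is linear.
\<close>

definition tensor_map ::
  "('a, 'm) ring_scheme \<Rightarrow> ('a, 'c, 'p) module_scheme \<Rightarrow> ('a, 'e, 'q) module_scheme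
     \<Rightarrow> ('d \<Rightarrow> 'e) \<Rightarrow> ('c \<times> 'd \<Rightarrow>\<^sub>0 int) set \<Rightarrow> ('c \<times> 'e \<Rightarrow>\<^sub>0 int) set" where
  "tensor_map R M N' f X =
     the_elem ((\<lambda>c. tensor_null R M N' #>\<^bsub>tensor_free M N'\<^esub>
                      frag_extend (\<lambda>(m, n). frag_of (m, f n)) c) ` X)"

text \<open>
  Flatness and projectivity quantify over all \<open>R\<close>-modules, which HOL can only do one carrier type
  at a time; the type of the test modules is therefore an explicit argument, and the unrestricted
  notion is the one holding for every such type.

  For an ideal of a ring with elements of type \<open>'a\<close>, \<open>TYPE('a list)\<close> already gives the
  unrestricted notions.  Flatness can be tested on the inclusions of ideals \<open>J\<close> into \<open>R\<close>, which are
  available on singleton lists.  Projectivity of a module with \<open>n\<close> generators can be tested on a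
  surjection from \<open>R\<^sup>n\<close>, the lists of length \<open>n\<close>.
\<close>

definition flat_module ::
  "'n itself \<Rightarrow> ('a, 'm) ring_scheme \<Rightarrow> ('a, 'c, 'p) module_scheme \<Rightarrow> bool" where
  "flat_module _ R M \<longleftrightarrow> module R M \<and>
     (\<forall>(N :: ('a, 'n) module) (N' :: ('a, 'n) module) f.
        module R N \<and> module R N' \<and> f \<in> module_hom R N N' \<and> inj_on f (carrier N)
        \<longrightarrow> inj_on (tensor_map R M N' f) (carrier (tensor R M N)))"

definition projective_module ::
  "'n itself \<Rightarrow> ('a, 'm) ring_scheme \<Rightarrow> ('a, 'c, 'p) module_scheme \<Rightarrow> bool" where
  "projective_module _ R M \<longleftrightarrow> module R M \<and>
     (\<forall>(N :: ('a, 'n) module) (N' :: ('a, 'n) module) g h.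
        module R N \<and> module R N' \<and> g \<in> module_hom R N N' \<and> g ` carrier N = carrier N' \<and>
        h \<in> module_hom R M N'
        \<longrightarrow> (\<exists>k \<in> module_hom R M N. \<forall>x \<in> carrier M. g (k x) = h x))"

section \<open>The five classes of rings\<close>

definition fg_ideal :: "'a set \<Rightarrow> ('a, 'm) ring_scheme \<Rightarrow> bool" where
  "fg_ideal I R \<longleftrightarrow> (\<exists>S. finite S \<and> S \<subseteq> carrier R \<and> I = Idl\<^bsub>R\<^esub> S)"

definition semihereditary_ring :: "'n itself \<Rightarrow> ('a, 'm) ring_scheme \<Rightarrow> bool" where
  "semihereditary_ring n R \<longleftrightarrow>
     (\<forall>I. fg_ideal I R \<longrightarrow> projective_module n R (ideal_module R I))"

definition weak_gldim_le_1 :: "'n itself \<Rightarrow> ('a, 'm) ring_scheme \<Rightarrow> bool" where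
  "weak_gldim_le_1 n R \<longleftrightarrow>
     (\<forall>I. ideal I R \<longrightarrow> flat_module n R (ideal_module R I))"

definition arithmetical_ring :: "('a, 'm) ring_scheme \<Rightarrow> bool" where
  "arithmetical_ring R \<longleftrightarrow>
     (\<forall>I J K. ideal I R \<and> ideal J R \<and> ideal K R
        \<longrightarrow> I \<inter> (J <+>\<^bsub>R\<^esub> K) = (I \<inter> J) <+>\<^bsub>R\<^esub> (I \<inter> K))"

definition content :: "('a, 'm) ring_scheme \<Rightarrow> (nat \<Rightarrow> 'a) \<Rightarrow> 'a set" where
  "content R f = Idl\<^bsub>R\<^esub> (range (coeff (UP R) f))"

definition Gaussian_ring :: "('a, 'm) ring_scheme \<Rightarrow> bool" where
  "Gaussian_ring R \<longleftrightarrow>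
     (\<forall>f \<in> carrier (UP R). \<forall>g \<in> carrier (UP R).
        content R f \<cdot>\<^bsub>R\<^esub> content R g = content R (f \<otimes>\<^bsub>UP R\<^esub> g))"

text \<open>
  \<^const>\<open>ideal_prod\<close> forms all finite sums of products and is used here for submodules of \<open>tot R\<close>.
\<close>

definition invertible_ideal :: "'a set \<Rightarrow> ('a, 'm) ring_scheme \<Rightarrow> bool" where
  "invertible_ideal I R \<longleftrightarrow>
     (\<exists>J. submodule J R (scalar_module (tot_embed R) (tot R)) \<and>
          (tot_embed R ` I) \<cdot>\<^bsub>tot R\<^esub> J = in_tot R)"

definition Prufer_ring :: "('a, 'm) ring_scheme \<Rightarrow> bool" where
  "Prufer_ring R \<longleftrightarrow>
     (\<forall>I. fg_ideal I R \<and> regular_ideal I R \<longrightarrow> invertible_ideal I R)"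

end

theory Submission
  imports Defs
begin

text \<open>
  Write \<open>C\<close> for the kernel of \<open>\<pi>\<close>, an ideal of both \<open>A\<close> and \<open>B\<close> with \<open>A / C = R\<close>, \<open>B / C = T\<close>, and let
  \<open>s \<in> C\<close> be regular in \<open>B\<close>.  Since \<open>s B \<subseteq> A\<close>, the rings \<open>A\<close> and \<open>B\<close> have the same fractions.

  The key point is that \<open>A \<subseteq> B\<close> is a Pruefer extension as soon as \<open>R\<close> is a Pruefer ring: every finitely
  generated \<open>A\<close>-submodule of \<open>B\<close> that contains \<open>1\<close> is invertible
  (\<open>regular_pullback.Prufer_extension_pullback\<close>).  Its image in \<open>T\<close> becomes a regular finitely generated
  ideal of \<open>R\<close> after multiplication with a common denominator and so has an inverse; lifting the inverse
  to \<open>A\<close> gives an inverse modulo \<open>C\<close>, and \<open>C\<close> causes no loss because \<open>C B \<subseteq> A\<close>.  At a prime ideal \<open>m\<close>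
  of \<open>A\<close> this means that of finitely many elements of \<open>B\<close>, one being \<open>1\<close>, one divides the others with
  quotients in the localization of \<open>A\<close>.  In particular the localization of \<open>B\<close> at \<open>A - m\<close> is
  again local, and its maximal ideal comes from the prime ideal \<open>Prufer_extension.over_prime\<close> of \<open>B\<close>.

  Each class of rings is then described by elements, in a form which is local and descends along
  Pruefer extensions.

    \<^item> Pruefer rings: the products of a regular finitely generated ideal with its inverse generate the
      unit ideal (\<open>cring.Prufer_ring_iff\<close>).
    \<^item> Arithmetical rings: \<open>((b) : a) + ((a) : b)\<close> is the unit ideal
      (\<open>cring.arithmetical_iff_comaximal_quotients\<close>).
    \<^item> Weak global dimension at most one: arithmetical, and \<open>ann a + ann b\<close> is the unit ideal if
      \<open>a b = 0\<close>.
    \<^item> Semihereditary rings: arithmetical, and annihilators of elements are generated by idempotents.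
    \<^item> Gaussian rings: locally every nonempty finite set is of the form \<open>s = y\<^sub>s i + r\<^sub>s\<close> with one of its members
      \<open>i\<close> and with \<open>i r\<^sub>s = 0 = r\<^sub>s r\<^sub>t\<close>, whence \<open>s t = y\<^sub>s y\<^sub>t i\<^sup>2\<close>
      (\<open>cring.Gaussian_imp_square_dominated\<close>).  Over \<open>A\<close> one can normalize \<open>y\<close> so that one of its values
      is a unit, and then the content formula for the polynomials with coefficients \<open>s\<close> follows from the
      one for polynomials with unit content, which holds in every ring.

  The last condition also shows that arithmetical and Gaussian rings are Pruefer rings, so the key point
  is available for all five classes.

  Conversely, the properties pass from \<open>A\<close> to \<open>B\<close> because multiplication by \<open>s\<close> embeds \<open>B\<close> into \<open>A\<close> and can be
  cancelled, and to \<open>R\<close> because \<open>R\<close> is a quotient of \<open>A\<close>.  For the Pruefer property a regular ideal of \<open>R\<close>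
  is lifted to an ideal of \<open>A\<close> that is made regular by adjoining \<open>s\<close>.
\<close>

section \<open>Ideals\<close>

context cring
begin

lemma idealI_closed:
  assumes "I \<subseteq> carrier R" "\<zero> \<in> I"
    and "\<And>x y. x \<in> I \<Longrightarrow> y \<in> I \<Longrightarrow> x \<oplus> y \<in> I"
    and "\<And>x r. x \<in> I \<Longrightarrow> r \<in> carrier R \<Longrightarrow> r \<otimes> x \<in> I"
  shows "ideal I R"
proof (rule idealI)
  show "ring R" by (rule ring_axioms)
  have "\<ominus> x \<in> I" if "x \<in> I" for x
  proof -
    have "x \<in> carrier R" using that assms(1) by blast
    then have "\<ominus> x = \<ominus> \<one> \<otimes> x" by algebra
    then show ?thesis using assms(4)[OF that, of "\<ominus> \<one>"] by simp
  qed
  then show "subgroup I (add_monoid R)"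
    using assms by (auto intro!: add.subgroupI)
  show "a \<otimes> x \<in> I" if "a \<in> I" "x \<in> carrier R" for a x
    using assms(4)[OF that] m_comm[of a x] that assms(1) by auto
  show "x \<otimes> a \<in> I" if "a \<in> I" "x \<in> carrier R" for a x
    using assms(4)[OF that] .
qed

lemma idealD:
  assumes "ideal I R"
  shows "I \<subseteq> carrier R" "\<zero> \<in> I"
    and "\<And>x y. x \<in> I \<Longrightarrow> y \<in> I \<Longrightarrow> x \<oplus> y \<in> I"
    and "\<And>x y. x \<in> I \<Longrightarrow> y \<in> I \<Longrightarrow> x \<ominus> y \<in> I"
    and "\<And>x r. x \<in> I \<Longrightarrow> r \<in> carrier R \<Longrightarrow> r \<otimes> x \<in> I"
    and "\<And>x r. x \<in> I \<Longrightarrow> r \<in> carrier R \<Longrightarrow> x \<otimes> r \<in> I"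
proof -
  interpret ideal I R by fact
  show "I \<subseteq> carrier R" "\<zero> \<in> I" using a_subset by auto
  show "\<And>x y. x \<in> I \<Longrightarrow> y \<in> I \<Longrightarrow> x \<oplus> y \<in> I" by auto
  show "\<And>x y. x \<in> I \<Longrightarrow> y \<in> I \<Longrightarrow> x \<ominus> y \<in> I" by (simp add: a_minus_def)
  show "\<And>x r. x \<in> I \<Longrightarrow> r \<in> carrier R \<Longrightarrow> r \<otimes> x \<in> I" by (rule I_l_closed)
  show "\<And>x r. x \<in> I \<Longrightarrow> r \<in> carrier R \<Longrightarrow> x \<otimes> r \<in> I" by (rule I_r_closed)
qed

lemma genideal_induct [consumes 2, case_names zero gen add mult]:
  assumes "x \<in> Idl S" "S \<subseteq> carrier R"
    and "P \<zero>" "\<And>s. s \<in> S \<Longrightarrow> P s"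
    and "\<And>x y. x \<in> carrier R \<Longrightarrow> y \<in> carrier R \<Longrightarrow> P x \<Longrightarrow> P y \<Longrightarrow> P (x \<oplus> y)"
    and "\<And>x r. x \<in> carrier R \<Longrightarrow> r \<in> carrier R \<Longrightarrow> P x \<Longrightarrow> P (r \<otimes> x)"
  shows "P x"
proof -
  have "ideal {x \<in> carrier R. P x} R"
    by (rule idealI_closed) (use assms in auto)
  then have "Idl S \<subseteq> {x \<in> carrier R. P x}"
    by (rule genideal_minimal) (use assms in auto)
  then show ?thesis using assms(1) by blast
qed

lemma genideal_triple:
  assumes "x \<in> Idl {p, q, r}" "p \<in> carrier R" "q \<in> carrier R" "r \<in> carrier R"
  obtains \<alpha> \<beta> \<gamma> where "\<alpha> \<in> carrier R" "\<beta> \<in> carrier R" "\<gamma> \<in> carrier R"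
    "x = \<alpha> \<otimes> p \<oplus> \<beta> \<otimes> q \<oplus> \<gamma> \<otimes> r"
proof -
  have "{p, q, r} \<subseteq> carrier R" using assms by auto
  with assms(1)
  have "\<exists>\<alpha> \<in> carrier R. \<exists>\<beta> \<in> carrier R. \<exists>\<gamma> \<in> carrier R. x = \<alpha> \<otimes> p \<oplus> \<beta> \<otimes> q \<oplus> \<gamma> \<otimes> r"
  proof (induction rule: genideal_induct)
    case zero
    have "\<zero> = \<zero> \<otimes> p \<oplus> \<zero> \<otimes> q \<oplus> \<zero> \<otimes> r" using assms by algebra
    then show ?case by blast
  next
    case (gen s)
    have "p = \<one> \<otimes> p \<oplus> \<zero> \<otimes> q \<oplus> \<zero> \<otimes> r" "q = \<zero> \<otimes> p \<oplus> \<one> \<otimes> q \<oplus> \<zero> \<otimes> r" "r = \<zero> \<otimes> p \<oplus> \<zero> \<otimes> q \<oplus> \<one> \<otimes> r"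
      using assms by algebra+
    then show ?case using gen by blast
  next
    case (add x y)
    from add(3) obtain a b c where x: "a \<in> carrier R" "b \<in> carrier R" "c \<in> carrier R"
      "x = a \<otimes> p \<oplus> b \<otimes> q \<oplus> c \<otimes> r" by blast
    from add(4) obtain a' b' c' where y: "a' \<in> carrier R" "b' \<in> carrier R" "c' \<in> carrier R"
      "y = a' \<otimes> p \<oplus> b' \<otimes> q \<oplus> c' \<otimes> r" by blast
    have "x \<oplus> y = (a \<oplus> a') \<otimes> p \<oplus> (b \<oplus> b') \<otimes> q \<oplus> (c \<oplus> c') \<otimes> r"
      unfolding x(4) y(4) using x(1-3) y(1-3) assms(2-4) by algebra
    then show ?case using x(1-3) y(1-3) by blast
  next
    case (mult x t)
    from mult(3) obtain a b c where x: "a \<in> carrier R" "b \<in> carrier R" "c \<in> carrier R"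
      "x = a \<otimes> p \<oplus> b \<otimes> q \<oplus> c \<otimes> r" by blast
    have "t \<otimes> x = (t \<otimes> a) \<otimes> p \<oplus> (t \<otimes> b) \<otimes> q \<oplus> (t \<otimes> c) \<otimes> r"
      unfolding x(4) using x(1-3) mult(2) assms(2-4) by algebra
    then show ?case using x(1-3) mult(2) by blast
  qed
  then show ?thesis using that by blast
qed

lemma ideal_Union_chain:
  assumes "\<C> \<noteq> {}" and "\<And>J. J \<in> \<C> \<Longrightarrow> ideal J R"
    and "\<And>J K. J \<in> \<C> \<Longrightarrow> K \<in> \<C> \<Longrightarrow> J \<subseteq> K \<or> K \<subseteq> J"
  shows "ideal (\<Union>\<C>) R"
proof (rule idealI_closed)
  show "\<Union>\<C> \<subseteq> carrier R" using assms(2) idealD(1) by blast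
  show "\<zero> \<in> \<Union>\<C>" using assms(1,2) idealD(2) by blast
  show "x \<oplus> y \<in> \<Union>\<C>" if xy: "x \<in> \<Union>\<C>" "y \<in> \<Union>\<C>" for x y
  proof -
    obtain J K where "x \<in> J" "J \<in> \<C>" "y \<in> K" "K \<in> \<C>" using xy by blast
    then obtain L where L: "L \<in> \<C>" "x \<in> L" "y \<in> L" using assms(3)[of J K] by blast
    have "x \<oplus> y \<in> L" using idealD(3)[OF assms(2)[OF L(1)] L(2,3)] .
    then show ?thesis using L(1) by blast
  qed
  show "r \<otimes> x \<in> \<Union>\<C>" if "x \<in> \<Union>\<C>" "r \<in> carrier R" for x r
    using that idealD(5)[OF assms(2)] by blast
qed

text \<open>
  Zorn's lemma.  All local arguments below take place at a prime ideal obtained in this way: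
  an ideal is the whole ring as soon as no prime ideal contains it.
\<close>

lemma primeideal_above:
  assumes "ideal I R" "\<one> \<notin> I"
  obtains P where "primeideal P R" "I \<subseteq> P"
proof -
  let ?\<A> = "{J. ideal J R \<and> I \<subseteq> J \<and> \<one> \<notin> J}"
  have "\<exists>M\<in>?\<A>. \<forall>X\<in>?\<A>. M \<subseteq> X \<longrightarrow> X = M"
  proof (rule subset_Zorn_nonempty)
    show "?\<A> \<noteq> {}" using assms by blast
    fix \<C> assume ne: "\<C> \<noteq> {}" and ch: "subset.chain ?\<A> \<C>"
    have sub: "\<C> \<subseteq> ?\<A>" using ch by (auto simp: subset_chain_def)
    have "ideal (\<Union>\<C>) R"
    proof (rule ideal_Union_chain[OF ne])
      show "\<And>J. J \<in> \<C> \<Longrightarrow> ideal J R" using sub by blast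
      show "\<And>J K. J \<in> \<C> \<Longrightarrow> K \<in> \<C> \<Longrightarrow> J \<subseteq> K \<or> K \<subseteq> J"
        using ch by (auto simp: subset_chain_def)
    qed
    then show "\<Union>\<C> \<in> ?\<A>" using ne sub by blast
  qed
  then obtain M where "M \<in> ?\<A>" and mx: "\<forall>X\<in>?\<A>. M \<subseteq> X \<longrightarrow> X = M" by (rule bexE)
  then have M: "ideal M R" "I \<subseteq> M" "\<one> \<notin> M" by simp_all
  have max: "X = M" if "ideal X R" "\<one> \<notin> X" "M \<subseteq> X" for X
    using mx that M(2) by simp
  have "maximalideal M R"
  proof (rule maximalidealI[OF M(1)])
    show "carrier R \<noteq> M" using M(3) by blast
    show "J = M \<or> J = carrier R" if "ideal J R" "M \<subseteq> J" "J \<subseteq> carrier R" for J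
      using max[of J] that ideal.one_imp_carrier[of J R] by blast
  qed
  then show ?thesis using that M(2) maximalideal_prime by blast
qed

lemma one_in_idealI:
  assumes "ideal I R" "\<And>P. primeideal P R \<Longrightarrow> I \<subseteq> P \<Longrightarrow> False"
  shows "\<one> \<in> I"
  using primeideal_above[OF assms(1)] assms(2) by blast

lemma primeidealD:
  assumes "primeideal P R"
  shows "ideal P R" "\<one> \<notin> P"
    and "\<And>x y. x \<in> carrier R \<Longrightarrow> y \<in> carrier R \<Longrightarrow> x \<notin> P \<Longrightarrow> y \<notin> P \<Longrightarrow> x \<otimes> y \<notin> P"
proof -
  interpret primeideal P R by fact
  show "ideal P R" by (rule is_ideal)
  show "\<one> \<notin> P" using one_imp_carrier I_notcarr by blast
  show "\<And>x y. x \<in> carrier R \<Longrightarrow> y \<in> carrier R \<Longrightarrow> x \<notin> P \<Longrightarrow> y \<notin> P \<Longrightarrow> x \<otimes> y \<notin> P"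
    using I_prime by blast
qed

lemma primeideal_pow:
  assumes "primeideal P R" "x \<in> carrier R" "x \<notin> P"
  shows "x [^] (n::nat) \<notin> P"
proof (induction n)
  case 0 then show ?case using primeidealD(2)[OF assms(1)] by simp
next
  case (Suc n) then show ?case using primeidealD(3)[OF assms(1)] assms(2,3) by simp
qed

text \<open>
  The product of the finitely many denominators serves all conditions, as these are stable under
  multiples, and it avoids the prime ideal.
\<close>

lemma common_denominator:
  assumes P: "primeideal P R" and "finite S"
    and ex: "\<And>s. s \<in> S \<Longrightarrow> \<exists>u \<in> carrier R - P. Q s u"
    and scale: "\<And>s u k. s \<in> S \<Longrightarrow> u \<in> carrier R \<Longrightarrow> k \<in> carrier R \<Longrightarrow> Q s u \<Longrightarrow> Q s (k \<otimes> u)"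
  shows "\<exists>u \<in> carrier R - P. \<forall>s \<in> S. Q s u"
  using assms(2) ex scale
proof (induction S)
  case empty
  then show ?case using primeidealD(2)[OF P] by blast
next
  case (insert x S)
  then obtain u where u: "u \<in> carrier R - P" "\<forall>s \<in> S. Q s u" by auto
  obtain v where v: "v \<in> carrier R - P" "Q x v" using insert by blast
  have "\<forall>s \<in> insert x S. Q s (v \<otimes> u)"
    using u v insert.prems(2)[of _ u v] insert.prems(2)[of x v u] m_comm[of u v] by auto
  moreover have "v \<otimes> u \<in> carrier R - P" using primeidealD(3)[OF P] u v by auto
  ultimately show ?case by blast
qed

end

lemma (in cring) subring_cring:
  assumes "subring S R" shows "cring (R\<lparr>carrier := S\<rparr>)"
proof -
  have "subcring S R" by (rule subcringI'[OF assms])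
  then show ?thesis using subcring_iff subringE(1)[OF assms] by blast
qed

lemma (in cring) subring_minus:
  assumes "subring S R" "x \<in> S" "y \<in> S"
  shows "x \<ominus>\<^bsub>R\<lparr>carrier := S\<rparr>\<^esub> y = x \<ominus> y"
proof -
  interpret A: cring "R\<lparr>carrier := S\<rparr>" by (rule subring_cring[OF assms(1)])
  have "y \<in> carrier R" and "\<ominus>\<^bsub>R\<lparr>carrier := S\<rparr>\<^esub> y \<in> carrier R"
    using A.a_inv_closed[of y] assms subringE(1)[OF assms(1)] by auto
  moreover have "\<ominus>\<^bsub>R\<lparr>carrier := S\<rparr>\<^esub> y \<oplus> y = \<zero>"
    using A.l_neg[of y] assms(3) by simp
  ultimately have "\<ominus> y = \<ominus>\<^bsub>R\<lparr>carrier := S\<rparr>\<^esub> y"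
    using minus_equality by blast
  then show ?thesis by (simp add: a_minus_def)
qed

lemma (in cring) subring_finsum:
  assumes "subring S R" "f \<in> I \<rightarrow> S"
  shows "finsum (R\<lparr>carrier := S\<rparr>) f I = finsum R f I"
proof -
  interpret A: cring "R\<lparr>carrier := S\<rparr>" by (rule subring_cring[OF assms(1)])
  have sub: "S \<subseteq> carrier R" by (rule subringE(1)[OF assms(1)])
  show ?thesis
    using assms(2)
  proof (induction I rule: infinite_finite_induct)
    case (infinite I)
    then show ?case by (simp add: finsum_def finprod_def)
  next
    case empty
    then show ?case using A.finsum_empty by simp
  next
    case (insert x F)
    then have "f \<in> F \<rightarrow> carrier R" "f x \<in> carrier R" using sub by auto
    then show ?case using insert A.finsum_insert[of F x f] by auto
  qed
qed

section \<open>Arithmetical rings and Pruefer rings in terms of elements\<close>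

text \<open>The equation \<open>((b) : a) + ((a) : b) = R\<close> for all \<open>a\<close> and \<open>b\<close>.\<close>

definition comaximal_quotients :: "('a, 'm) ring_scheme \<Rightarrow> bool" where
  "comaximal_quotients R \<longleftrightarrow>
     (\<forall>a \<in> carrier R. \<forall>b \<in> carrier R. \<exists>u \<in> carrier R. \<exists>v \<in> carrier R. \<exists>w \<in> carrier R.
        u \<otimes>\<^bsub>R\<^esub> a = v \<otimes>\<^bsub>R\<^esub> b \<and> (\<one>\<^bsub>R\<^esub> \<ominus>\<^bsub>R\<^esub> u) \<otimes>\<^bsub>R\<^esub> b = w \<otimes>\<^bsub>R\<^esub> a)"

text \<open>
  For a prime ideal \<open>P\<close> this says of the localization at \<open>P\<close> that every nonempty finite set \<open>S\<close> has a
  member \<open>i\<close> whose square controls all products from \<open>S\<close>, in a rank-one fashion: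
  \<open>s t = (y\<^sub>s / u) (y\<^sub>t / u) i\<^sup>2\<close>, where \<open>i\<close> itself has coordinate \<open>1\<close>.
\<close>

definition square_dominated :: "('a, 'm) ring_scheme \<Rightarrow> 'a set \<Rightarrow> bool" where
  "square_dominated R P \<longleftrightarrow>
     (\<forall>S. finite S \<and> S \<noteq> {} \<and> S \<subseteq> carrier R \<longrightarrow>
        (\<exists>i \<in> S. \<exists>u \<in> carrier R - P. \<exists>y \<in> S \<rightarrow> carrier R. y i = u \<and>
           (\<forall>s \<in> S. \<forall>t \<in> S.
              (u \<otimes>\<^bsub>R\<^esub> u) \<otimes>\<^bsub>R\<^esub> (s \<otimes>\<^bsub>R\<^esub> t) = (y s \<otimes>\<^bsub>R\<^esub> y t) \<otimes>\<^bsub>R\<^esub> (i \<otimes>\<^bsub>R\<^esub> i))))"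

text \<open>
  The elements \<open>e = z a\<close> of \<open>R\<close> with \<open>a \<in> S\<close> and \<open>z = c / r\<close> in the inverse of the ideal generated
  by \<open>S\<close>, written without fractions.  For a regular element \<open>r\<close> of that ideal they generate the
  product of the ideal with its inverse.
\<close>

definition inverse_products :: "('a, 'm) ring_scheme \<Rightarrow> 'a set \<Rightarrow> 'a \<Rightarrow> 'a set" where
  "inverse_products R S r =
     {e \<in> carrier R. \<exists>a \<in> S. \<exists>c \<in> carrier R. c \<otimes>\<^bsub>R\<^esub> a = r \<otimes>\<^bsub>R\<^esub> e \<and>
        (\<forall>b \<in> S. \<exists>d \<in> carrier R. c \<otimes>\<^bsub>R\<^esub> b = r \<otimes>\<^bsub>R\<^esub> d)}"

definition regular_fg_invertible :: "('a, 'm) ring_scheme \<Rightarrow> bool" where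
  "regular_fg_invertible R \<longleftrightarrow>
     (\<forall>S r. finite S \<and> S \<subseteq> carrier R \<and> r \<in> Idl\<^bsub>R\<^esub> S \<and> r \<in> regular_elements R \<longrightarrow>
        \<one>\<^bsub>R\<^esub> \<in> Idl\<^bsub>R\<^esub> (inverse_products R S r))"

context cring
begin

lemma comaximal_quotientsD:
  assumes "comaximal_quotients R" "a \<in> carrier R" "b \<in> carrier R"
  obtains u v w where "u \<in> carrier R" "v \<in> carrier R" "w \<in> carrier R"
    "u \<otimes> a = v \<otimes> b" "(\<one> \<ominus> u) \<otimes> b = w \<otimes> a"
  using assms unfolding comaximal_quotients_def by metis

lemma comaximal_quotientsI:
  assumes "\<And>a b. a \<in> carrier R \<Longrightarrow> b \<in> carrier R \<Longrightarrow>
      \<exists>u \<in> carrier R. \<exists>v \<in> carrier R. \<exists>w \<in> carrier R. u \<otimes> a = v \<otimes> b \<and> (\<one> \<ominus> u) \<otimes> b = w \<otimes> a"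
  shows "comaximal_quotients R"
  using assms unfolding comaximal_quotients_def by blast

text \<open>
  In a distributive ideal lattice, \<open>a \<in> (b) + (a - b)\<close> splits \<open>a\<close> into a part in \<open>(a) \<inter> (b)\<close> and a
  part in \<open>(a) \<inter> (a - b)\<close>; the coefficient of \<open>a - b\<close> in the latter is the complement of the
  required \<open>u\<close>.  Conversely, for \<open>a = b + c\<close> the elements \<open>u a\<close> and \<open>(1 - u) a\<close> lie in
  \<open>(c)\<close> and \<open>(b)\<close>.
\<close>

lemma arithmetical_iff_comaximal_quotients:
  "arithmetical_ring R \<longleftrightarrow> comaximal_quotients R"
proof
  assume ar: "arithmetical_ring R"
  show "comaximal_quotients R"
  proof (rule comaximal_quotientsI)
    fix a b assume ab: "a \<in> carrier R" "b \<in> carrier R"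
    have "a = \<one> \<otimes> b \<oplus> \<one> \<otimes> (a \<ominus> b)" using ab by algebra
    then have "a \<in> PIdl b <+> PIdl (a \<ominus> b)"
      unfolding set_add_def' cgenideal_def using ab by blast
    moreover have "a \<in> PIdl a" using cgenideal_self[OF ab(1)] .
    ultimately have "a \<in> PIdl a \<inter> (PIdl b <+> PIdl (a \<ominus> b))" by blast
    also have "\<dots> = (PIdl a \<inter> PIdl b) <+> (PIdl a \<inter> PIdl (a \<ominus> b))"
      using ar ab unfolding arithmetical_ring_def by (simp add: cgenideal_ideal)
    finally obtain p q where pq: "p \<in> PIdl b" "q \<in> PIdl a" "q \<in> PIdl (a \<ominus> b)" "a = p \<oplus> q"
      unfolding set_add_def' by blast
    obtain \<beta> where \<beta>: "\<beta> \<in> carrier R" "p = \<beta> \<otimes> b" using pq(1) by (auto simp: cgenideal_def)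
    obtain \<delta> where \<delta>: "\<delta> \<in> carrier R" "q = \<delta> \<otimes> a" using pq(2) by (auto simp: cgenideal_def)
    obtain \<gamma> where \<gamma>: "\<gamma> \<in> carrier R" "q = \<gamma> \<otimes> (a \<ominus> b)" using pq(3) by (auto simp: cgenideal_def)
    have eq1: "a = \<beta> \<otimes> b \<oplus> \<gamma> \<otimes> (a \<ominus> b)" using pq(4) \<beta>(2) \<gamma>(2) by simp
    have eq2: "\<gamma> \<otimes> (a \<ominus> b) = \<delta> \<otimes> a" using \<gamma>(2) \<delta>(2) by simp
    have "(\<one> \<ominus> \<gamma>) \<otimes> a = a \<ominus> \<gamma> \<otimes> a" using ab \<gamma>(1) by algebra
    also have "\<dots> = \<beta> \<otimes> b \<oplus> \<gamma> \<otimes> (a \<ominus> b) \<ominus> \<gamma> \<otimes> a" using eq1 by simp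
    also have "\<dots> = (\<beta> \<ominus> \<gamma>) \<otimes> b" using ab \<gamma>(1) \<beta>(1) by algebra
    finally have 1: "(\<one> \<ominus> \<gamma>) \<otimes> a = (\<beta> \<ominus> \<gamma>) \<otimes> b" .
    have "(\<one> \<ominus> (\<one> \<ominus> \<gamma>)) \<otimes> b = \<gamma> \<otimes> a \<ominus> \<gamma> \<otimes> (a \<ominus> b)" using ab \<gamma>(1) by algebra
    also have "\<dots> = \<gamma> \<otimes> a \<ominus> \<delta> \<otimes> a" using eq2 by simp
    also have "\<dots> = (\<gamma> \<ominus> \<delta>) \<otimes> a" using ab \<gamma>(1) \<delta>(1) by algebra
    finally have 2: "(\<one> \<ominus> (\<one> \<ominus> \<gamma>)) \<otimes> b = (\<gamma> \<ominus> \<delta>) \<otimes> a" .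
    show "\<exists>u \<in> carrier R. \<exists>v \<in> carrier R. \<exists>w \<in> carrier R. u \<otimes> a = v \<otimes> b \<and> (\<one> \<ominus> u) \<otimes> b = w \<otimes> a"
      using 1 2 \<beta>(1) \<gamma>(1) \<delta>(1)
      by (intro bexI[of _ "\<one> \<ominus> \<gamma>"] bexI[of _ "\<beta> \<ominus> \<gamma>"] bexI[of _ "\<gamma> \<ominus> \<delta>"]) auto
  qed
next
  assume cq: "comaximal_quotients R"
  show "arithmetical_ring R"
    unfolding arithmetical_ring_def
  proof (intro allI impI)
    fix I J K assume IJK: "ideal I R \<and> ideal J R \<and> ideal K R"
    then have I: "ideal I R" and J: "ideal J R" and K: "ideal K R" by auto
    show "I \<inter> (J <+> K) = (I \<inter> J) <+> (I \<inter> K)"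
    proof
      show "(I \<inter> J) <+> (I \<inter> K) \<subseteq> I \<inter> (J <+> K)"
        unfolding set_add_def' using idealD(3)[OF I] by blast
      show "I \<inter> (J <+> K) \<subseteq> (I \<inter> J) <+> (I \<inter> K)"
      proof
        fix a assume a: "a \<in> I \<inter> (J <+> K)"
        then obtain b c where bc: "b \<in> J" "c \<in> K" "a = b \<oplus> c" unfolding set_add_def' by blast
        have cr: "b \<in> carrier R" "c \<in> carrier R" "a \<in> carrier R"
          using bc a idealD(1)[OF I] idealD(1)[OF J] idealD(1)[OF K] by auto
        obtain u v w where u: "u \<in> carrier R" "v \<in> carrier R" "w \<in> carrier R"
          "u \<otimes> b = v \<otimes> c" "(\<one> \<ominus> u) \<otimes> c = w \<otimes> b"
          using comaximal_quotientsD[OF cq cr(1,2)] .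
        have "u \<otimes> a = u \<otimes> b \<oplus> u \<otimes> c" using u(1) cr bc(3) by algebra
        then have "u \<otimes> a = v \<otimes> c \<oplus> u \<otimes> c" using u(4) by simp
        then have 1: "u \<otimes> a \<in> I \<inter> K"
          using idealD(3)[OF K idealD(5)[OF K bc(2) u(2)] idealD(5)[OF K bc(2) u(1)]]
            idealD(5)[OF I _ u(1), of a] a by auto
        have "(\<one> \<ominus> u) \<otimes> a = (\<one> \<ominus> u) \<otimes> b \<oplus> (\<one> \<ominus> u) \<otimes> c" using u(1) cr bc(3) by algebra
        then have "(\<one> \<ominus> u) \<otimes> a = (\<one> \<ominus> u) \<otimes> b \<oplus> w \<otimes> b" using u(5) by simp
        then have 2: "(\<one> \<ominus> u) \<otimes> a \<in> I \<inter> J"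
          using idealD(3)[OF J idealD(5)[OF J bc(1), of "\<one> \<ominus> u"] idealD(5)[OF J bc(1) u(3)]]
            idealD(5)[OF I _, of a "\<one> \<ominus> u"] a u(1) by auto
        have "a = (\<one> \<ominus> u) \<otimes> a \<oplus> u \<otimes> a" using cr u(1) by algebra
        then show "a \<in> (I \<inter> J) <+> (I \<inter> K)" unfolding set_add_def' using 1 2 by blast
      qed
    qed
  qed
qed

text \<open>
  At a prime ideal one of \<open>u\<close> and \<open>1 - u\<close> is a unit, so divisibility is a total preorder, and a
  finite set has a member that divides all others.
\<close>

lemma comaximal_quotients_local:
  assumes cq: "comaximal_quotients R" and P: "primeideal P R"
    and "finite S" "S \<noteq> {}" "S \<subseteq> carrier R"
  shows "\<exists>i \<in> S. \<exists>u \<in> carrier R - P. \<exists>y \<in> S \<rightarrow> carrier R. y i = u \<and> (\<forall>s \<in> S. u \<otimes> s = y s \<otimes> i)"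
proof -
  have "\<exists>i \<in> S. \<exists>u \<in> carrier R - P. \<forall>s \<in> S. \<exists>y \<in> carrier R. u \<otimes> s = y \<otimes> i"
    using assms(3-)
  proof (induction S rule: finite_ne_induct)
    case (singleton x)
    have "\<one> \<in> carrier R - P" using primeidealD(2)[OF P] by simp
    then show ?case by blast
  next
    case (insert x S)
    then obtain i u where i: "i \<in> S" "u \<in> carrier R" "u \<notin> P"
      and y: "\<And>s. s \<in> S \<Longrightarrow> \<exists>y \<in> carrier R. u \<otimes> s = y \<otimes> i" by blast
    have S: "S \<subseteq> carrier R" and cr: "i \<in> carrier R" "x \<in> carrier R" using insert i by auto
    obtain e v w where e: "e \<in> carrier R" "v \<in> carrier R" "w \<in> carrier R"
      "e \<otimes> x = v \<otimes> i" "(\<one> \<ominus> e) \<otimes> i = w \<otimes> x"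
      using comaximal_quotientsD[OF cq cr(2,1)] .
    have "\<one> = e \<oplus> (\<one> \<ominus> e)" using e(1) by algebra
    then consider "e \<notin> P" | "\<one> \<ominus> e \<notin> P"
      using idealD(3)[OF primeidealD(1)[OF P]] primeidealD(2)[OF P] by metis
    then show ?case
    proof cases
      case 1
      have "\<exists>y \<in> carrier R. (e \<otimes> u) \<otimes> s = y \<otimes> i" if s: "s \<in> insert x S" for s
      proof (cases "s = x")
        case True
        have "(e \<otimes> u) \<otimes> x = u \<otimes> (e \<otimes> x)" using e(1-3) i(2) cr by algebra
        also have "\<dots> = (u \<otimes> v) \<otimes> i" unfolding e(4) using e(1-3) i(2) cr by algebra
        finally show ?thesis using True e i by blast
      next
        case False
        then obtain y where y: "y \<in> carrier R" "u \<otimes> s = y \<otimes> i" using y s by blast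
        have "s \<in> carrier R" using s cr S by auto
        then have "(e \<otimes> u) \<otimes> s = e \<otimes> (u \<otimes> s)" using e(1-3) i(2) by algebra
        also have "\<dots> = (e \<otimes> y) \<otimes> i" unfolding y(2) using e(1-3) y(1) i(2) cr by algebra
        finally show ?thesis using e y by blast
      qed
      moreover have "e \<otimes> u \<in> carrier R - P" using primeidealD(3)[OF P] 1 e i by auto
      ultimately show ?thesis using i(1) by blast
    next
      case 2
      have "\<exists>y \<in> carrier R. ((\<one> \<ominus> e) \<otimes> u) \<otimes> s = y \<otimes> x" if s: "s \<in> insert x S" for s
      proof (cases "s = x")
        case True
        then show ?thesis using e i by blast
      next
        case False
        then obtain y where y: "y \<in> carrier R" "u \<otimes> s = y \<otimes> i" using y s by blast
        have "s \<in> carrier R" using s cr S by auto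
        then have "((\<one> \<ominus> e) \<otimes> u) \<otimes> s = (\<one> \<ominus> e) \<otimes> (u \<otimes> s)" using e(1-3) i(2) by algebra
        also have "\<dots> = y \<otimes> ((\<one> \<ominus> e) \<otimes> i)" unfolding y(2) using e(1-3) y(1) i(2) cr by algebra
        also have "\<dots> = (y \<otimes> w) \<otimes> x" unfolding e(5) using e(1-3) y(1) i(2) cr by algebra
        finally show ?thesis using e y by blast
      qed
      moreover have "(\<one> \<ominus> e) \<otimes> u \<in> carrier R - P" using primeidealD(3)[OF P] 2 e i by auto
      ultimately show ?thesis by blast
    qed
  qed
  then obtain i u where i: "i \<in> S" "u \<in> carrier R - P"
    and "\<forall>s \<in> S. \<exists>y. y \<in> carrier R \<and> u \<otimes> s = y \<otimes> i" by blast
  then obtain y where y: "\<And>s. s \<in> S \<Longrightarrow> y s \<in> carrier R \<and> u \<otimes> s = y s \<otimes> i" by metis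
  define y' where "y' = y(i := u)"
  have "y' \<in> S \<rightarrow> carrier R" "y' i = u" "\<forall>s \<in> S. u \<otimes> s = y' s \<otimes> i"
    using y i by (auto simp: y'_def)
  then show ?thesis using i by blast
qed

lemma comaximal_quotients_imp_square_dominated:
  assumes "comaximal_quotients R" "primeideal P R"
  shows "square_dominated R P"
  unfolding square_dominated_def
proof (intro allI impI)
  fix S assume S: "finite S \<and> S \<noteq> {} \<and> S \<subseteq> carrier R"
  then obtain i u y where i: "i \<in> S" "u \<in> carrier R - P" "y \<in> S \<rightarrow> carrier R" "y i = u"
    and eq: "\<And>s. s \<in> S \<Longrightarrow> u \<otimes> s = y s \<otimes> i"
    using comaximal_quotients_local[OF assms, of S] by blast
  have "(u \<otimes> u) \<otimes> (s \<otimes> t) = (y s \<otimes> y t) \<otimes> (i \<otimes> i)" if st: "s \<in> S" "t \<in> S" for s t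
  proof -
    have c: "s \<in> carrier R" "t \<in> carrier R" "u \<in> carrier R" "i \<in> carrier R"
      "y s \<in> carrier R" "y t \<in> carrier R" using st S i by auto
    then have "(u \<otimes> u) \<otimes> (s \<otimes> t) = (u \<otimes> s) \<otimes> (u \<otimes> t)" by algebra
    also have "\<dots> = (y s \<otimes> y t) \<otimes> (i \<otimes> i)" unfolding eq[OF st(1)] eq[OF st(2)] using c by algebra
    finally show ?thesis .
  qed
  then show "\<exists>i \<in> S. \<exists>u \<in> carrier R - P. \<exists>y \<in> S \<rightarrow> carrier R. y i = u \<and>
      (\<forall>s \<in> S. \<forall>t \<in> S. (u \<otimes> u) \<otimes> (s \<otimes> t) = (y s \<otimes> y t) \<otimes> (i \<otimes> i))"
    using i by blast
qed

lemma regular_elementsD: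
  assumes "r \<in> regular_elements R"
  shows "r \<in> carrier R"
    and "\<And>x. x \<in> carrier R \<Longrightarrow> r \<otimes> x = \<zero> \<Longrightarrow> x = \<zero>"
    and "\<And>x y. x \<in> carrier R \<Longrightarrow> y \<in> carrier R \<Longrightarrow> r \<otimes> x = r \<otimes> y \<Longrightarrow> x = y"
proof -
  show r: "r \<in> carrier R" and z: "\<And>x. x \<in> carrier R \<Longrightarrow> r \<otimes> x = \<zero> \<Longrightarrow> x = \<zero>"
    using assms by (auto simp: regular_elements_def)
  show "x = y" if xy: "x \<in> carrier R" "y \<in> carrier R" "r \<otimes> x = r \<otimes> y" for x y
  proof -
    have "r \<otimes> (x \<ominus> y) = r \<otimes> x \<ominus> r \<otimes> y" using r xy(1,2) by algebra
    then have "r \<otimes> (x \<ominus> y) = \<zero>" using xy r by simp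
    then have "x \<ominus> y = \<zero>" using z xy by simp
    then show ?thesis using xy by simp
  qed
qed

lemma regular_elementsI:
  assumes "r \<in> carrier R" "\<And>x. x \<in> carrier R \<Longrightarrow> r \<otimes> x = \<zero> \<Longrightarrow> x = \<zero>"
  shows "r \<in> regular_elements R"
  using assms by (auto simp: regular_elements_def)

lemma square_dominatedD:
  assumes "square_dominated R P" "finite S" "S \<noteq> {}" "S \<subseteq> carrier R"
  obtains i u y where "i \<in> S" "u \<in> carrier R" "u \<notin> P" "y \<in> S \<rightarrow> carrier R" "y i = u"
    "\<And>s t. s \<in> S \<Longrightarrow> t \<in> S \<Longrightarrow> (u \<otimes> u) \<otimes> (s \<otimes> t) = (y s \<otimes> y t) \<otimes> (i \<otimes> i)"
proof -
  have "\<exists>i \<in> S. \<exists>u \<in> carrier R - P. \<exists>y \<in> S \<rightarrow> carrier R. y i = u \<and>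
      (\<forall>s \<in> S. \<forall>t \<in> S. (u \<otimes> u) \<otimes> (s \<otimes> t) = (y s \<otimes> y t) \<otimes> (i \<otimes> i))"
    using assms(1)[unfolded square_dominated_def, rule_format, of S] assms(2-4) by simp
  then show thesis
  proof (elim bexE conjE)
    fix i u y
    assume "i \<in> S" "u \<in> carrier R - P" "y \<in> S \<rightarrow> carrier R" "y i = u"
      and "\<forall>s \<in> S. \<forall>t \<in> S. (u \<otimes> u) \<otimes> (s \<otimes> t) = (y s \<otimes> y t) \<otimes> (i \<otimes> i)"
    then show thesis using that[of i u y] by simp
  qed
qed

text \<open>
  Multiplication by \<open>c / r\<close> takes \<open>r\<close> to \<open>c\<close>, and it takes all members of an ideal into \<open>G\<close> once it
  takes the generators there.
\<close>

lemma multiplier_mem: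
  assumes "S \<subseteq> carrier R" "r \<in> Idl S" "r \<in> regular_elements R" "c \<in> carrier R" "ideal G R"
    and "\<And>a. a \<in> S \<Longrightarrow> \<exists>d \<in> G. c \<otimes> a = r \<otimes> d"
  shows "c \<in> G"
proof -
  have r: "r \<in> carrier R" by (rule regular_elementsD(1)[OF assms(3)])
  have G: "\<And>x. x \<in> G \<Longrightarrow> x \<in> carrier R" using idealD(1)[OF assms(5)] by blast
  have "\<exists>d \<in> G. c \<otimes> x = r \<otimes> d" if "x \<in> Idl S" for x
    using that assms(1)
  proof (induction rule: genideal_induct)
    case zero
    have "c \<otimes> \<zero> = r \<otimes> \<zero>" using assms(4) r by simp
    then show ?case using idealD(2)[OF assms(5)] by blast
  next
    case (gen s) then show ?case by (rule assms(6))
  next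
    case (add x y)
    from add(3) obtain d where d: "d \<in> G" "c \<otimes> x = r \<otimes> d" by blast
    from add(4) obtain d' where d': "d' \<in> G" "c \<otimes> y = r \<otimes> d'" by blast
    have "c \<otimes> (x \<oplus> y) = r \<otimes> (d \<oplus> d')"
      using r_distr[OF add(1,2) assms(4)] r_distr[OF G[OF d(1)] G[OF d'(1)] r] d d'
      by (simp add: r_distr add assms(4))
    then show ?case using idealD(3)[OF assms(5)] d d' by blast
  next
    case (mult x t)
    from mult(3) obtain d where d: "d \<in> G" "c \<otimes> x = r \<otimes> d" by blast
    have "c \<otimes> (t \<otimes> x) = t \<otimes> (c \<otimes> x)" using mult assms(4) by algebra
    also have "\<dots> = r \<otimes> (t \<otimes> d)" unfolding d(2) using mult r G[OF d(1)] by algebra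
    finally show ?case using idealD(5)[OF assms(5)] d mult by blast
  qed
  then obtain d where d: "d \<in> G" "c \<otimes> r = r \<otimes> d" using assms(2) by blast
  then have "r \<otimes> c = r \<otimes> d" using r assms(4) by (simp add: m_comm)
  then show ?thesis using regular_elementsD(3)[OF assms(3) assms(4) G[OF d(1)]] d by simp
qed

lemma inverse_products_carrier: "inverse_products R S r \<subseteq> carrier R"
  by (auto simp: inverse_products_def)

text \<open>
  With \<open>r\<close> added to \<open>S\<close>, domination of squares gives
  \<open>u\<^sup>2 (y\<^sub>r s - y\<^sub>s r) r = y\<^sub>r (y\<^sub>r y\<^sub>s - y\<^sub>s y\<^sub>r) i\<^sup>2 = 0\<close>.  As \<open>r\<close> is regular, the multiplier
  \<open>u\<^sup>2 y\<^sub>r / r\<close> takes every \<open>s\<close> to \<open>u\<^sup>2 y\<^sub>s\<close>, and it takes \<open>i\<close> to the local unit \<open>u\<^sup>3\<close>.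
\<close>

lemma square_dominated_imp_regular_fg_invertible:
  assumes sd: "\<And>P. primeideal P R \<Longrightarrow> square_dominated R P"
  shows "regular_fg_invertible R"
  unfolding regular_fg_invertible_def
proof (intro allI impI)
  fix S r
  assume "finite S \<and> S \<subseteq> carrier R \<and> r \<in> Idl S \<and> r \<in> regular_elements R"
  then have S: "finite S" "S \<subseteq> carrier R" and rS: "r \<in> Idl S" and reg: "r \<in> regular_elements R"
    by auto
  have r: "r \<in> carrier R" by (rule regular_elementsD(1)[OF reg])
  let ?E = "inverse_products R S r"
  have idE: "ideal (Idl ?E) R" by (rule genideal_ideal[OF inverse_products_carrier])
  have Esub: "?E \<subseteq> Idl ?E" by (rule genideal_self[OF inverse_products_carrier])
  show "\<one> \<in> Idl ?E"
  proof (rule one_in_idealI[OF idE])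
    fix P assume P: "primeideal P R" and EP: "Idl ?E \<subseteq> P"
    have "finite (insert r S)" "insert r S \<noteq> {}" "insert r S \<subseteq> carrier R" using S r by auto
    then obtain i u y where i: "i \<in> insert r S" and u: "u \<in> carrier R" "u \<notin> P"
      and y0: "y \<in> insert r S \<rightarrow> carrier R" and yi: "y i = u"
      and eq: "\<And>s t. s \<in> insert r S \<Longrightarrow> t \<in> insert r S \<Longrightarrow>
        (u \<otimes> u) \<otimes> (s \<otimes> t) = (y s \<otimes> y t) \<otimes> (i \<otimes> i)"
      by (rule square_dominatedD[OF sd[OF P]]) blast
    have ic: "i \<in> carrier R" using i S r by auto
    have y: "\<And>s. s \<in> insert r S \<Longrightarrow> y s \<in> carrier R" using y0 by auto
    have key: "(u \<otimes> u \<otimes> y r) \<otimes> s = r \<otimes> (u \<otimes> u \<otimes> y s)" if s: "s \<in> insert r S" for s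
    proof -
      have c: "s \<in> carrier R" "y s \<in> carrier R" "y r \<in> carrier R" using s S r y by auto
      have "r \<otimes> ((u \<otimes> u \<otimes> y r) \<otimes> s) = y r \<otimes> ((u \<otimes> u) \<otimes> (r \<otimes> s))"
        using c r u by algebra
      also have "\<dots> = y r \<otimes> ((y r \<otimes> y s) \<otimes> (i \<otimes> i))" by (simp only: eq[OF insertI1 s])
      also have "\<dots> = y s \<otimes> ((y r \<otimes> y r) \<otimes> (i \<otimes> i))" using c ic by algebra
      also have "\<dots> = y s \<otimes> ((u \<otimes> u) \<otimes> (r \<otimes> r))" by (simp only: eq[OF insertI1 insertI1])
      also have "\<dots> = r \<otimes> (r \<otimes> (u \<otimes> u \<otimes> y s))" using c r u by algebra
      finally show ?thesis using regular_elementsD(3)[OF reg] c r u by simp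
    qed
    have E: "u \<otimes> u \<otimes> y s \<in> ?E" if s: "s \<in> S" for s
    proof -
      have "u \<otimes> u \<otimes> y s \<in> carrier R" "u \<otimes> u \<otimes> y r \<in> carrier R" using u y s by auto
      moreover have "\<forall>b \<in> S. \<exists>d \<in> carrier R. (u \<otimes> u \<otimes> y r) \<otimes> b = r \<otimes> d" using key u y by blast
      ultimately show ?thesis unfolding inverse_products_def using key[of s] s by blast
    qed
    have "u \<otimes> u \<otimes> y i \<in> P"
    proof (cases "i \<in> S")
      case True then show ?thesis using E Esub EP by blast
    next
      case False
      then have "i = r" using i by simp
      moreover have "u \<otimes> u \<otimes> y r \<in> Idl ?E"
      proof (rule multiplier_mem[OF S(2) rS reg _ idE])
        show "u \<otimes> u \<otimes> y r \<in> carrier R" using u y by auto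
        show "\<exists>d \<in> Idl ?E. (u \<otimes> u \<otimes> y r) \<otimes> a = r \<otimes> d" if "a \<in> S" for a
          using E[OF that] Esub key[of a] that by blast
      qed
      ultimately show ?thesis using EP by blast
    qed
    then show False using yi u primeidealD(3)[OF P] by auto
  qed
qed

end

section \<open>Coefficients of products of polynomials\<close>

definition convolution :: "('a, 'm) ring_scheme \<Rightarrow> (nat \<Rightarrow> 'a) \<Rightarrow> (nat \<Rightarrow> 'a) \<Rightarrow> nat \<Rightarrow> 'a" where
  "convolution R f g n = (\<Oplus>\<^bsub>R\<^esub>i \<in> {..n}. f i \<otimes>\<^bsub>R\<^esub> g (n - i))"

context cring
begin

lemma convolution_closed:
  assumes "f \<in> UNIV \<rightarrow> carrier R" "g \<in> UNIV \<rightarrow> carrier R"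
  shows "convolution R f g n \<in> carrier R"
  unfolding convolution_def by (rule finsum_closed) (use assms in auto)

lemma range_convolution_subset:
  assumes "f \<in> UNIV \<rightarrow> carrier R" "g \<in> UNIV \<rightarrow> carrier R"
  shows "range (convolution R f g) \<subseteq> carrier R"
  using convolution_closed[OF assms] by auto

lemma UP_mult_eq_convolution:
  assumes "f \<in> up R" "g \<in> up R"
  shows "f \<otimes>\<^bsub>UP R\<^esub> g = convolution R f g"
  using assms by (auto simp: UP_def convolution_def)

lemma convolution_comm:
  assumes "f \<in> up R" "g \<in> up R"
  shows "convolution R f g = convolution R g f"
proof -
  interpret U: UP_cring R "UP R" by (simp_all add: UP_cring_def is_cring)
  have "f \<in> carrier (UP R)" "g \<in> carrier (UP R)" using assms by (auto simp: UP_def)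
  then show ?thesis using U.P.m_comm assms by (metis UP_mult_eq_convolution)
qed

lemma ideal_finsum:
  assumes "ideal C R" "f \<in> A \<rightarrow> C"
  shows "finsum R f A \<in> C"
  using assms(2)
proof (induction A rule: infinite_finite_induct)
  case (infinite A)
  then show ?case using idealD(2)[OF assms(1)] by (simp add: finsum_infinite)
next
  case empty
  then show ?case using idealD(2)[OF assms(1)] by simp
next
  case (insert x A)
  have "f \<in> insert x A \<rightarrow> carrier R" using insert(4) idealD(1)[OF assms(1)] by auto
  then have "finsum R f (insert x A) = f x \<oplus> finsum R f A" using insert by (intro finsum_insert) auto
  then show ?case using insert idealD(3)[OF assms(1)] by auto
qed

lemma convolution_split:
  assumes "f \<in> UNIV \<rightarrow> carrier R" "g \<in> UNIV \<rightarrow> carrier R" "m \<le> n"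
  shows "convolution R f g n =
    f m \<otimes> g (n - m) \<oplus> (\<Oplus>i \<in> {..n} - {m}. f i \<otimes> g (n - i))"
proof -
  have "{..n} = insert m ({..n} - {m})" using assms(3) by auto
  then have "convolution R f g n = (\<Oplus>i \<in> insert m ({..n} - {m}). f i \<otimes> g (n - i))"
    unfolding convolution_def by simp
  also have "\<dots> = f m \<otimes> g (n - m) \<oplus> (\<Oplus>i \<in> {..n} - {m}. f i \<otimes> g (n - i))"
    by (rule finsum_insert) (use assms in auto)
  finally show ?thesis .
qed

lemma add_minus_cancel:
  assumes "x \<in> carrier R" "y \<in> carrier R"
  shows "(x \<oplus> y) \<ominus> y = x" "(x \<oplus> y) \<ominus> x = y"
  using assms by algebra+

lemma convolution_smult:
  assumes "f \<in> UNIV \<rightarrow> carrier R" "g \<in> UNIV \<rightarrow> carrier R" "c \<in> carrier R"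
  shows "convolution R f (\<lambda>l. c \<otimes> g l) n = c \<otimes> convolution R f g n"
proof -
  have "c \<otimes> convolution R f g n = (\<Oplus>i \<in> {..n}. c \<otimes> (f i \<otimes> g (n - i)))"
    unfolding convolution_def by (rule finsum_rdistr) (use assms in auto)
  also have "\<dots> = convolution R f (\<lambda>l. c \<otimes> g l) n"
    unfolding convolution_def
  proof (rule finsum_cong')
    show "c \<otimes> (f i \<otimes> g (n - i)) = f i \<otimes> (c \<otimes> g (n - i))" for i
      using assms by (simp add: Pi_iff m_lcomm)
    show "(\<lambda>i. f i \<otimes> (c \<otimes> g (n - i))) \<in> {..n} \<rightarrow> carrier R"
      using assms by (simp add: Pi_iff)
  qed simp
  finally show ?thesis by simp
qed

text \<open>
  A weak form of the Dedekind-Mertens lemma.  Modulo \<open>C\<close> the product of \<open>f\<close> and \<open>g\<close> vanishes, so the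
  leading coefficient \<open>f\<^sub>M\<close> kills the leading coefficient of \<open>g\<close>; multiplying \<open>g\<close> by \<open>f\<^sub>M\<close>
  lowers its degree, and once a power \<open>f\<^sub>j\<^sup>K f\<^sub>M\<close> kills \<open>g\<close> the leading term of \<open>f\<close> can be dropped.
\<close>

lemma coefficient_power_mult_mem:
  assumes C: "ideal C R"
    and "f \<in> UNIV \<rightarrow> carrier R" "g \<in> UNIV \<rightarrow> carrier R"
    and "\<And>n. convolution R f g n \<in> C"
    and "\<And>k. k \<ge> M \<Longrightarrow> f k \<in> C" "\<And>l. l \<ge> N \<Longrightarrow> g l \<in> C"
  shows "\<exists>K::nat. \<forall>l. f j [^] K \<otimes> g l \<in> C"
  using assms(2-)
proof (induction M arbitrary: f g N)
  case 0
  have "f j [^] (1::nat) \<otimes> g l \<in> C" for l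
    using idealD(6)[OF C 0(4)[of j]] 0(1,2) by (auto simp: Pi_iff)
  then show ?case by blast
next
  case (Suc M f g N)
  note outer = Suc.IH and f = Suc.prems(1) and ftail = Suc.prems(4)
  have fc: "f k \<in> carrier R" for k using f by auto
  have powc: "f j [^] (K::nat) \<in> carrier R" for K using fc by simp
  have "\<exists>K::nat. \<forall>l. f j [^] K \<otimes> g l \<in> C"
    if g: "g \<in> UNIV \<rightarrow> carrier R" "\<And>n. convolution R f g n \<in> C" "\<And>l. l \<ge> N \<Longrightarrow> g l \<in> C" for g N
    using g
  proof (induction N arbitrary: g)
    case 0
    have "f j [^] (0::nat) \<otimes> g l \<in> C" for l
      using 0 by (auto simp: Pi_iff)
    then show ?case by blast
  next
    case (Suc N g)
    note g = Suc.prems(1) and conv = Suc.prems(2) and gtail = Suc.prems(3)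
    have gc: "g k \<in> carrier R" for k using g by auto
    have "f M \<otimes> g N \<in> C"
    proof -
      have split: "convolution R f g (M + N) =
          f M \<otimes> g N \<oplus> (\<Oplus>i \<in> {..M + N} - {M}. f i \<otimes> g (M + N - i))"
        using convolution_split[OF f g, of M "M + N"] by simp
      have rest: "(\<Oplus>i \<in> {..M + N} - {M}. f i \<otimes> g (M + N - i)) \<in> C" (is "?r \<in> C")
      proof (rule ideal_finsum[OF C], rule Pi_I)
        fix i assume i: "i \<in> {..M + N} - {M}"
        show "f i \<otimes> g (M + N - i) \<in> C"
        proof (cases "i \<ge> Suc M")
          case True
          then show ?thesis using idealD(6)[OF C ftail] gc by blast
        next
          case False
          then have "M + N - i \<ge> Suc N" using i by auto
          then show ?thesis using idealD(5)[OF C gtail] fc by blast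
        qed
      qed
      have "?r \<in> carrier R" using rest idealD(1)[OF C] by blast
      then have "f M \<otimes> g N = convolution R f g (M + N) \<ominus> ?r"
        unfolding split using fc[of M] gc[of N] by (simp add: add_minus_cancel(1))
      then show ?thesis using idealD(4)[OF C conv rest] by simp
    qed
    let ?g = "\<lambda>l. f M \<otimes> g l"
    have "\<exists>K::nat. \<forall>l. f j [^] K \<otimes> ?g l \<in> C"
    proof (rule Suc.IH)
      show "?g \<in> UNIV \<rightarrow> carrier R" using fc gc by auto
      show "convolution R f ?g n \<in> C" for n
        using convolution_smult[OF f g fc[of M]] idealD(5)[OF C conv fc] by simp
      show "?g l \<in> C" if l: "l \<ge> N" for l
        using \<open>f M \<otimes> g N \<in> C\<close> gtail[of l] idealD(5)[OF C _ fc] l by (cases "l = N") auto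
    qed
    then obtain K :: nat where K: "\<And>l. f j [^] K \<otimes> (f M \<otimes> g l) \<in> C" by blast
    show ?case
    proof (cases "j = M")
      case True
      have "f j [^] Suc K \<otimes> g l \<in> C" for l
        using K[of l] True fc gc powc[of K] by (simp add: m_assoc)
      then show ?thesis by blast
    next
      case False
      let ?f = "f(M := \<zero>)" and ?h = "\<lambda>l. f j [^] K \<otimes> g l"
      have hc: "?h \<in> UNIV \<rightarrow> carrier R" using powc gc by auto
      have f': "?f \<in> UNIV \<rightarrow> carrier R" using fc by auto
      have conv': "convolution R ?f ?h n \<in> C" for n
      proof -
        have h: "convolution R f ?h n \<in> C"
          using convolution_smult[OF f g powc[of K]] idealD(5)[OF C conv powc] by simp
        show ?thesis
        proof (cases "M \<le> n")
          case True
          let ?r = "\<Oplus>i \<in> {..n} - {M}. f i \<otimes> ?h (n - i)"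
          have eq: "(\<Oplus>i \<in> {..n} - {M}. ?f i \<otimes> ?h (n - i)) = ?r"
            by (rule finsum_cong') (use fc gc powc in auto)
          have rc: "?r \<in> carrier R" by (rule finsum_closed) (use fc gc powc in auto)
          have "f M \<otimes> ?h (n - M) = f j [^] K \<otimes> (f M \<otimes> g (n - M))"
            using fc gc powc by (simp add: m_lcomm)
          then have lead: "f M \<otimes> ?h (n - M) \<in> C" using K by simp
          have cc: "f M \<otimes> ?h (n - M) \<in> carrier R" "?h (n - M) \<in> carrier R"
            using fc gc powc by auto
          have "convolution R ?f ?h n = \<zero> \<oplus> ?r"
            using convolution_split[OF f' hc True] eq cc by simp
          also have "\<dots> = convolution R f ?h n \<ominus> f M \<otimes> ?h (n - M)"
            unfolding convolution_split[OF f hc True]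
              using fc gc powc rc by (simp add: add_minus_cancel(2))
          finally show ?thesis using idealD(4)[OF C h lead] by simp
        next
          case False
          have "convolution R ?f ?h n = convolution R f ?h n"
            unfolding convolution_def
            by (rule finsum_cong') (use fc gc powc False in auto)
          then show ?thesis using h by simp
        qed
      qed
      have "\<exists>L::nat. \<forall>l. ?f j [^] L \<otimes> ?h l \<in> C"
      proof (rule outer[OF f' hc conv'])
        show "?f k \<in> C" if "k \<ge> M" for k
          using that ftail[of k] idealD(2)[OF C] by (cases "k = M") auto
        show "?h l \<in> C" if "l \<ge> Suc N" for l
          using idealD(5)[OF C gtail[OF that] powc] .
      qed
      then obtain L :: nat where L: "\<And>l. ?f j [^] L \<otimes> ?h l \<in> C" by blast
      have "f j [^] (L + K) \<otimes> g l \<in> C" for l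
      proof -
        have "f j [^] (L + K) \<otimes> g l = f j [^] L \<otimes> (f j [^] K \<otimes> g l)"
          using fc gc powc by (simp add: nat_pow_mult[symmetric] m_assoc)
        then show ?thesis using L[of l] False by simp
      qed
      then show ?thesis by blast
    qed
  qed
  then show ?case using Suc.prems by blast
qed

section \<open>Gaussian rings in terms of elements\<close>

lemma mem_up_iff: "f \<in> up R \<longleftrightarrow> f \<in> UNIV \<rightarrow> carrier R \<and> (\<exists>n. \<forall>m>n. f m = \<zero>)"
  by (auto simp: up_def bound_def)

lemma content_up:
  assumes "f \<in> up R" shows "content R f = Idl (range f)"
  using assms by (simp add: content_def UP_def)

lemma Gaussian_ring_iff:
  "Gaussian_ring R \<longleftrightarrow>
     (\<forall>f \<in> up R. \<forall>g \<in> up R. \<forall>i j. f i \<otimes> g j \<in> Idl (range (convolution R f g)))"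
proof -
  have eq: "content R f \<cdot> content R g = content R (f \<otimes>\<^bsub>UP R\<^esub> g) \<longleftrightarrow>
      (\<forall>i j. f i \<otimes> g j \<in> Idl (range (convolution R f g)))" if fg: "f \<in> up R" "g \<in> up R" for f g
  proof -
    have f: "f \<in> UNIV \<rightarrow> carrier R" and g: "g \<in> UNIV \<rightarrow> carrier R" using fg by (auto simp: mem_up_iff)
    have rf: "range f \<subseteq> carrier R" and rg: "range g \<subseteq> carrier R" using f g by auto
    interpret U: UP_cring R "UP R" by (simp_all add: UP_cring_def is_cring)
    have "f \<otimes>\<^bsub>UP R\<^esub> g \<in> up R"
      using U.P.m_closed[of f g] fg by (simp add: UP_def)
    then have c: "content R (f \<otimes>\<^bsub>UP R\<^esub> g) = Idl (range (convolution R f g))"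
      using content_up UP_mult_eq_convolution[OF fg] by simp
    let ?I = "Idl (range f)" and ?J = "Idl (range g)" and ?C = "Idl (range (convolution R f g))"
    note rc = range_convolution_subset[OF f g]
    have I: "ideal ?I R" and J: "ideal ?J R" and C: "ideal ?C R"
      using genideal_ideal rf rg rc by auto
    have IJ: "ideal (?I \<cdot> ?J) R" by (rule ideal_prod_is_ideal[OF I J])
    have prod: "f i \<otimes> g j \<in> ?I \<cdot> ?J" for i j
      by (rule ideal_prod.prod) (use genideal_self[OF rf] genideal_self[OF rg] in auto)
    have "convolution R f g n \<in> ?I \<cdot> ?J" for n
      unfolding convolution_def by (rule ideal_finsum[OF IJ]) (use prod in auto)
    then have sub: "?C \<subseteq> ?I \<cdot> ?J" by (intro genideal_minimal[OF IJ]) auto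
    have "?I \<cdot> ?J \<subseteq> ?C" if el: "\<And>i j. f i \<otimes> g j \<in> ?C"
    proof
      have 1: "f i \<otimes> y \<in> ?C" if "y \<in> ?J" for i y
        using that rg
      proof (induction rule: genideal_induct)
        case zero
        have "f i \<in> carrier R" using f by auto
        then show ?case using idealD(2)[OF C] by simp
      next
        case (gen s) then show ?case using el by auto
      next
        case (add x y)
        have "f i \<in> carrier R" using f by auto
        then show ?case using idealD(3)[OF C add(3,4)] add by (simp add: r_distr)
      next
        case (mult x r)
        have "f i \<in> carrier R" using f by auto
        then show ?case using idealD(5)[OF C mult(3,2)] mult by (simp add: m_lcomm)
      qed
      have 2: "x \<otimes> y \<in> ?C" if "x \<in> ?I" "y \<in> ?J" for x y
      proof -
        have y: "y \<in> carrier R" using that(2) idealD(1)[OF J] by blast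
        show ?thesis
          using that(1) rf
        proof (induction rule: genideal_induct)
          case zero then show ?case using y idealD(2)[OF C] by auto
        next
          case (gen s) then show ?case using 1 that(2) by auto
        next
          case (add x z)
          then show ?case using idealD(3)[OF C add(3,4)] add y by (simp add: l_distr)
        next
          case (mult x r)
          then show ?case using idealD(5)[OF C mult(3,2)] mult y by (simp add: m_assoc)
        qed
      qed
      fix x assume "x \<in> ?I \<cdot> ?J"
      then show "x \<in> ?C"
        by (induction rule: ideal_prod.induct) (use 2 idealD(3)[OF C] in auto)
    qed
    then show ?thesis
      unfolding c content_up[OF fg(1)] content_up[OF fg(2)] using sub prod by blast
  qed
  have "carrier (UP R) = up R" by (simp add: UP_def)
  then show ?thesis unfolding Gaussian_ring_def using eq by simp
qed

lemma Gaussian_ring_linear: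
  assumes G: "Gaussian_ring R"
    and c: "a0 \<in> carrier R" "a1 \<in> carrier R" "b0 \<in> carrier R" "b1 \<in> carrier R"
    and x: "x \<in> {a0 \<otimes> b0, a0 \<otimes> b1, a1 \<otimes> b0, a1 \<otimes> b1}"
  obtains \<alpha> \<beta> \<gamma> where "\<alpha> \<in> carrier R" "\<beta> \<in> carrier R" "\<gamma> \<in> carrier R"
    "x = \<alpha> \<otimes> (a0 \<otimes> b0) \<oplus> \<beta> \<otimes> (a0 \<otimes> b1 \<oplus> a1 \<otimes> b0) \<oplus> \<gamma> \<otimes> (a1 \<otimes> b1)"
proof -
  define f where "f = (\<lambda>n::nat. if n = 0 then a0 else if n = 1 then a1 else \<zero>)"
  define g where "g = (\<lambda>n::nat. if n = 0 then b0 else if n = 1 then b1 else \<zero>)"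
  have fg: "f \<in> up R" "g \<in> up R"
    unfolding mem_up_iff using c by (auto simp: f_def g_def intro!: exI[of _ 1])
  let ?T = "{a0 \<otimes> b0, a0 \<otimes> b1 \<oplus> a1 \<otimes> b0, a1 \<otimes> b1}"
  have T: "?T \<subseteq> carrier R" using c by auto
  have C: "ideal (Idl ?T) R" by (rule genideal_ideal[OF T])
  have "convolution R f g n \<in> Idl ?T" for n
  proof -
    consider "n = 0" | "n = 1" | "n = 2" | "n \<ge> 3" by linarith
    then show ?thesis
    proof cases
      case 1
      then have "convolution R f g n = a0 \<otimes> b0"
        using c by (simp add: convolution_def f_def g_def)
      then show ?thesis using genideal_self[OF T] by auto
    next
      case 2
      then have "{..n} = {0, 1}" by auto
      then have "convolution R f g n = a0 \<otimes> b1 \<oplus> a1 \<otimes> b0"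
        using c 2 by (simp add: convolution_def f_def g_def)
      then show ?thesis using genideal_self[OF T] by auto
    next
      case 3
      then have "{..n} = {0, 1, 2}" by auto
      then have "convolution R f g n = a1 \<otimes> b1"
        using c 3 by (simp add: convolution_def f_def g_def)
      then show ?thesis using genideal_self[OF T] by auto
    next
      case 4
      have "f i \<otimes> g (n - i) = \<zero>" if "i \<in> {..n}" for i
        using 4 that c by (cases "i \<le> 1") (auto simp: f_def g_def)
      then have "convolution R f g n = (\<Oplus>i \<in> {..n}. \<zero>)"
        unfolding convolution_def by (intro finsum_cong') auto
      then show ?thesis using idealD(2)[OF C] by simp
    qed
  qed
  then have sub: "Idl (range (convolution R f g)) \<subseteq> Idl ?T"
    by (intro genideal_minimal[OF C]) auto
  have "f i \<otimes> g j \<in> Idl ?T" for i j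
    using G fg sub unfolding Gaussian_ring_iff by blast
  from this[of 0 0] this[of 0 1] this[of 1 0] this[of 1 1] have "x \<in> Idl ?T"
    using x by (auto simp: f_def g_def)
  then show thesis
    by (rule genideal_triple) (use c that in auto)
qed

end

section \<open>The local structure of Gaussian rings\<close>

context cring
begin

lemma primeideal_complement:
  assumes "primeideal P R" "s \<in> carrier R"
  shows "s \<notin> P \<or> \<one> \<ominus> s \<notin> P"
proof -
  have "\<one> = s \<oplus> (\<one> \<ominus> s)" using assms(2) by algebra
  then show ?thesis
    using idealD(3)[OF primeidealD(1)[OF assms(1)]] primeidealD(2)[OF assms(1)] by metis
qed

lemma primeideal_minus:
  assumes "primeideal P R" "c \<in> carrier R" "c \<notin> P" "p \<in> P"
  shows "c \<ominus> p \<notin> P"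
proof
  have p: "p \<in> carrier R" using assms(4) idealD(1)[OF primeidealD(1)[OF assms(1)]] by blast
  assume "c \<ominus> p \<in> P"
  moreover have "c = (c \<ominus> p) \<oplus> p" using assms(2) p by algebra
  ultimately show False using idealD(3)[OF primeidealD(1)[OF assms(1)] _ assms(4)] assms(3) by metis
qed

lemma Gaussian_mixed_product_unit:
  assumes G: "Gaussian_ring R" and P: "primeideal P R"
    and c: "a \<in> carrier R" "b \<in> carrier R" "x \<in> carrier R" "y \<in> carrier R"
    and h: "a \<otimes> b = x \<otimes> (a \<otimes> a) \<oplus> y \<otimes> (b \<otimes> b)" and "y \<notin> P"
  shows "\<exists>u \<in> carrier R - P. \<exists>z \<in> carrier R. u \<otimes> (a \<otimes> b) = z \<otimes> (a \<otimes> a) \<or> u \<otimes> (a \<otimes> b) = z \<otimes> (b \<otimes> b)"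
proof -
  \<comment> \<open>The polynomials are \<open>b + a X\<close> and \<open>x a + y b X\<close>: all three coefficients of their product are
    multiples of \<open>a b\<close>, hence so is \<open>y b\<^sup>2\<close>.\<close>
  obtain \<alpha> \<beta> \<gamma> where g: "\<alpha> \<in> carrier R" "\<beta> \<in> carrier R" "\<gamma> \<in> carrier R"
    and eq: "b \<otimes> (y \<otimes> b) = \<alpha> \<otimes> (b \<otimes> (x \<otimes> a)) \<oplus> \<beta> \<otimes> (b \<otimes> (y \<otimes> b) \<oplus> a \<otimes> (x \<otimes> a)) \<oplus> \<gamma> \<otimes> (a \<otimes> (y \<otimes> b))"
    by (rule Gaussian_ring_linear[OF G, of b a "x \<otimes> a" "y \<otimes> b" "b \<otimes> (y \<otimes> b)"]) (use c in auto)
  define s where "s = \<alpha> \<otimes> x \<oplus> \<beta> \<oplus> \<gamma> \<otimes> y"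
  have s: "s \<in> carrier R" using g c by (simp add: s_def)
  have "y \<otimes> (b \<otimes> b) = b \<otimes> (y \<otimes> b)" using c by algebra
  also note eq
  also have "\<alpha> \<otimes> (b \<otimes> (x \<otimes> a)) \<oplus> \<beta> \<otimes> (b \<otimes> (y \<otimes> b) \<oplus> a \<otimes> (x \<otimes> a)) \<oplus> \<gamma> \<otimes> (a \<otimes> (y \<otimes> b))
      = \<alpha> \<otimes> (b \<otimes> (x \<otimes> a)) \<oplus> \<beta> \<otimes> (x \<otimes> (a \<otimes> a) \<oplus> y \<otimes> (b \<otimes> b)) \<oplus> \<gamma> \<otimes> (a \<otimes> (y \<otimes> b))"
    using c g by algebra
  also have "\<dots> = \<alpha> \<otimes> (b \<otimes> (x \<otimes> a)) \<oplus> \<beta> \<otimes> (a \<otimes> b) \<oplus> \<gamma> \<otimes> (a \<otimes> (y \<otimes> b))"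
    by (subst h[symmetric]) (rule refl)
  also have "\<dots> = s \<otimes> (a \<otimes> b)" unfolding s_def using c g by algebra
  finally have sb: "y \<otimes> (b \<otimes> b) = s \<otimes> (a \<otimes> b)" .
  show ?thesis
  proof (cases "s \<in> P")
    case False
    then show ?thesis using sb s c(4) by (intro bexI[of _ s] bexI[of _ y]) auto
  next
    case True
    then have "\<one> \<ominus> s \<notin> P" using primeideal_complement[OF P s] by simp
    then have u: "y \<otimes> (\<one> \<ominus> s) \<in> carrier R - P" using primeidealD(3)[OF P] assms(8) c s by auto
    have "(y \<otimes> (\<one> \<ominus> s)) \<otimes> (a \<otimes> b) = y \<otimes> (a \<otimes> b) \<ominus> y \<otimes> (s \<otimes> (a \<otimes> b))" using c s by algebra
    also have "\<dots> = y \<otimes> (x \<otimes> (a \<otimes> a) \<oplus> y \<otimes> (b \<otimes> b)) \<ominus> y \<otimes> (y \<otimes> (b \<otimes> b))"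
      by (subst h[symmetric], subst sb, rule refl)
    also have "\<dots> = (x \<otimes> y) \<otimes> (a \<otimes> a)" using c by algebra
    finally show ?thesis using u c by blast
  qed
qed

text \<open>
  The relation \<open>k\<close> eliminates \<open>a\<^sup>2\<close> from \<open>h\<close>; the coefficient \<open>p - x t\<close> of \<open>a b\<close> that results is a unit at
  \<open>P\<close> because \<open>x\<close> is not.
\<close>

lemma mixed_product_of_relation:
  assumes P: "primeideal P R"
    and c: "a \<in> carrier R" "b \<in> carrier R" "x \<in> P" "y \<in> carrier R"
      "p \<in> carrier R" "q \<in> carrier R" "t \<in> carrier R" "p \<notin> P"
    and h: "a \<otimes> b = x \<otimes> (a \<otimes> a) \<oplus> y \<otimes> (b \<otimes> b)"
    and k: "p \<otimes> (a \<otimes> a) = t \<otimes> (a \<otimes> b) \<oplus> q \<otimes> (b \<otimes> b)"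
  shows "\<exists>u \<in> carrier R - P. \<exists>z \<in> carrier R. u \<otimes> (a \<otimes> b) = z \<otimes> (b \<otimes> b)"
proof -
  have x: "x \<in> carrier R" using c(3) idealD(1)[OF primeidealD(1)[OF P]] by blast
  have "x \<otimes> t \<in> P" using idealD(6)[OF primeidealD(1)[OF P] c(3,7)] .
  then have u: "p \<ominus> x \<otimes> t \<in> carrier R - P" using primeideal_minus[OF P c(5,8)] c x by simp
  have "(p \<ominus> x \<otimes> t) \<otimes> (a \<otimes> b) = p \<otimes> (a \<otimes> b) \<ominus> x \<otimes> (t \<otimes> (a \<otimes> b))" using c(1-2,4-7) x by algebra
  also have "\<dots> = p \<otimes> (x \<otimes> (a \<otimes> a) \<oplus> y \<otimes> (b \<otimes> b)) \<ominus> x \<otimes> (t \<otimes> (a \<otimes> b))"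
    by (subst h[symmetric]) (rule refl)
  also have "\<dots> = x \<otimes> (p \<otimes> (a \<otimes> a)) \<oplus> (y \<otimes> p) \<otimes> (b \<otimes> b) \<ominus> x \<otimes> (t \<otimes> (a \<otimes> b))"
    using c(1-2,4-7) x by algebra
  also have "\<dots> = x \<otimes> (t \<otimes> (a \<otimes> b) \<oplus> q \<otimes> (b \<otimes> b)) \<oplus> (y \<otimes> p) \<otimes> (b \<otimes> b) \<ominus> x \<otimes> (t \<otimes> (a \<otimes> b))"
    by (simp only: k)
  also have "\<dots> = (x \<otimes> q \<oplus> y \<otimes> p) \<otimes> (b \<otimes> b)" using c(1-2,4-7) x by algebra
  finally have "(p \<ominus> x \<otimes> t) \<otimes> (a \<otimes> b) = (x \<otimes> q \<oplus> y \<otimes> p) \<otimes> (b \<otimes> b)" .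
  then show ?thesis using u c x by (intro bexI[of _ "p \<ominus> x \<otimes> t"] bexI[of _ "x \<otimes> q \<oplus> y \<otimes> p"]) auto
qed

text \<open>
  Locally, \<open>a b\<close> is a multiple of \<open>a\<^sup>2\<close> or of \<open>b\<^sup>2\<close>.  The polynomials \<open>b + a X\<close> and \<open>- b + a X\<close> give
  \<open>a b = x a\<^sup>2 + y b\<^sup>2\<close>.  If both coefficients are nonunits, \<open>b + a X\<close> and \<open>a + b X\<close> provide a relation
  that has a unit as coefficient of \<open>a\<^sup>2\<close> or of \<open>b\<^sup>2\<close> and so eliminates this square.
\<close>

lemma Gaussian_mixed_product:
  assumes G: "Gaussian_ring R" and P: "primeideal P R"
    and c: "a \<in> carrier R" "b \<in> carrier R"
  shows "\<exists>u \<in> carrier R - P. \<exists>z \<in> carrier R. u \<otimes> (a \<otimes> b) = z \<otimes> (a \<otimes> a) \<or> u \<otimes> (a \<otimes> b) = z \<otimes> (b \<otimes> b)"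
proof -
  obtain \<alpha> \<beta> \<gamma> where g: "\<alpha> \<in> carrier R" "\<beta> \<in> carrier R" "\<gamma> \<in> carrier R"
    and eq: "b \<otimes> a = \<alpha> \<otimes> (b \<otimes> \<ominus> b) \<oplus> \<beta> \<otimes> (b \<otimes> a \<oplus> a \<otimes> \<ominus> b) \<oplus> \<gamma> \<otimes> (a \<otimes> a)"
    by (rule Gaussian_ring_linear[OF G, of b a "\<ominus> b" a "b \<otimes> a"]) (use c in auto)
  define x where "x = \<gamma>"
  define y where "y = \<ominus> \<alpha>"
  have xy: "x \<in> carrier R" "y \<in> carrier R" using g by (auto simp: x_def y_def)
  have "a \<otimes> b = b \<otimes> a" using c by algebra
  also note eq
  also have "\<alpha> \<otimes> (b \<otimes> \<ominus> b) \<oplus> \<beta> \<otimes> (b \<otimes> a \<oplus> a \<otimes> \<ominus> b) \<oplus> \<gamma> \<otimes> (a \<otimes> a) = x \<otimes> (a \<otimes> a) \<oplus> y \<otimes> (b \<otimes> b)"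
    unfolding x_def y_def using c g by algebra
  finally have h: "a \<otimes> b = x \<otimes> (a \<otimes> a) \<oplus> y \<otimes> (b \<otimes> b)" .
  have h': "b \<otimes> a = y \<otimes> (b \<otimes> b) \<oplus> x \<otimes> (a \<otimes> a)"
    using h c xy by (simp add: m_comm[of b a] a_comm)
  consider "y \<notin> P" | "x \<notin> P" | "x \<in> P" "y \<in> P" by blast
  then show ?thesis
  proof cases
    case 1
    then show ?thesis using Gaussian_mixed_product_unit[OF G P c xy h] by blast
  next
    case 2
    then show ?thesis
      using Gaussian_mixed_product_unit[OF G P c(2,1) xy(2,1) h'] c by (auto simp: m_comm[of b a])
  next
    case 3
    obtain \<alpha> \<beta> \<gamma> where g: "\<alpha> \<in> carrier R" "\<beta> \<in> carrier R" "\<gamma> \<in> carrier R"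
      and eq: "a \<otimes> a = \<alpha> \<otimes> (b \<otimes> a) \<oplus> \<beta> \<otimes> (b \<otimes> b \<oplus> a \<otimes> a) \<oplus> \<gamma> \<otimes> (a \<otimes> b)"
      by (rule Gaussian_ring_linear[OF G, of b a a b "a \<otimes> a"]) (use c in auto)
    have "(\<one> \<ominus> \<beta>) \<otimes> (a \<otimes> a) = a \<otimes> a \<ominus> \<beta> \<otimes> (a \<otimes> a)" using c g by algebra
    also have "\<dots> = \<alpha> \<otimes> (b \<otimes> a) \<oplus> \<beta> \<otimes> (b \<otimes> b \<oplus> a \<otimes> a) \<oplus> \<gamma> \<otimes> (a \<otimes> b) \<ominus> \<beta> \<otimes> (a \<otimes> a)"
      by (subst eq[symmetric]) (rule refl)
    also have "\<dots> = (\<alpha> \<oplus> \<gamma>) \<otimes> (a \<otimes> b) \<oplus> \<beta> \<otimes> (b \<otimes> b)" using c g by algebra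
    finally have k: "(\<one> \<ominus> \<beta>) \<otimes> (a \<otimes> a) = (\<alpha> \<oplus> \<gamma>) \<otimes> (a \<otimes> b) \<oplus> \<beta> \<otimes> (b \<otimes> b)" .
    have "\<beta> \<otimes> (b \<otimes> b) = (\<alpha> \<oplus> \<gamma>) \<otimes> (a \<otimes> b) \<oplus> \<beta> \<otimes> (b \<otimes> b) \<ominus> (\<alpha> \<oplus> \<gamma>) \<otimes> (a \<otimes> b)"
      using c g by algebra
    also have "\<dots> = (\<one> \<ominus> \<beta>) \<otimes> (a \<otimes> a) \<ominus> (\<alpha> \<oplus> \<gamma>) \<otimes> (a \<otimes> b)" by (simp only: k)
    also have "\<dots> = (\<ominus> (\<alpha> \<oplus> \<gamma>)) \<otimes> (b \<otimes> a) \<oplus> (\<one> \<ominus> \<beta>) \<otimes> (a \<otimes> a)" using c g by algebra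
    finally have k': "\<beta> \<otimes> (b \<otimes> b) = (\<ominus> (\<alpha> \<oplus> \<gamma>)) \<otimes> (b \<otimes> a) \<oplus> (\<one> \<ominus> \<beta>) \<otimes> (a \<otimes> a)" .
    show ?thesis
    proof (cases "\<beta> \<in> P")
      case True
      then have "\<one> \<ominus> \<beta> \<notin> P" using primeideal_complement[OF P g(2)] by simp
      then show ?thesis
        using mixed_product_of_relation[OF P c 3(1) xy(2) _ g(2) _ _ h k] g by auto
    next
      case False
      then have "\<exists>u \<in> carrier R - P. \<exists>z \<in> carrier R. u \<otimes> (b \<otimes> a) = z \<otimes> (a \<otimes> a)"
        by (intro mixed_product_of_relation[OF P c(2,1) 3(2) xy(1) g(2) _ _ _ h' k']) (use g in auto)
      then show ?thesis using c by (auto simp: m_comm[of b a])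
    qed
  qed
qed

text \<open>
  If \<open>a b = z a\<^sup>2\<close> locally, then \<open>r = b - z a\<close> satisfies \<open>a r = 0\<close>.  The Gaussian property of
  \<open>r + a X\<close> and \<open>a + r X\<close> makes one of \<open>a\<^sup>2\<close>, \<open>r\<^sup>2\<close> a multiple of the other, and two linear polynomials
  with product zero then show that \<open>r\<^sup>2\<close> or \<open>a\<^sup>2\<close> vanishes.
\<close>

lemma Gaussian_pair_aux:
  assumes G: "Gaussian_ring R" and P: "primeideal P R"
    and c: "a \<in> carrier R" "b \<in> carrier R" "u \<in> carrier R" "u \<notin> P" "z \<in> carrier R"
    and h: "u \<otimes> (a \<otimes> b) = z \<otimes> (a \<otimes> a)"
  shows "\<exists>u \<in> carrier R - P. \<exists>z \<in> carrier R.
      u \<otimes> (a \<otimes> b) = z \<otimes> (a \<otimes> a) \<and> (u \<otimes> u) \<otimes> (b \<otimes> b) = (z \<otimes> z) \<otimes> (a \<otimes> a) \<or>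
      u \<otimes> (a \<otimes> b) = z \<otimes> (b \<otimes> b) \<and> (u \<otimes> u) \<otimes> (a \<otimes> a) = (z \<otimes> z) \<otimes> (b \<otimes> b)"
proof -
  define r where "r = u \<otimes> b \<ominus> z \<otimes> a"
  have r: "r \<in> carrier R" using c by (simp add: r_def)
  have "a \<otimes> r = u \<otimes> (a \<otimes> b) \<ominus> z \<otimes> (a \<otimes> a)" unfolding r_def using c by algebra
  then have ar: "a \<otimes> r = \<zero>" using h c by simp
  then have ra: "r \<otimes> a = \<zero>" using c r by (simp add: m_comm)
  obtain \<alpha> \<beta> \<gamma> where g: "\<alpha> \<in> carrier R" "\<beta> \<in> carrier R" "\<gamma> \<in> carrier R"
    and eq: "a \<otimes> a = \<alpha> \<otimes> (r \<otimes> a) \<oplus> \<beta> \<otimes> (r \<otimes> r \<oplus> a \<otimes> a) \<oplus> \<gamma> \<otimes> (a \<otimes> r)"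
    by (rule Gaussian_ring_linear[OF G, of r a a r "a \<otimes> a"]) (use c r in auto)
  have eq': "a \<otimes> a = \<beta> \<otimes> (r \<otimes> r \<oplus> a \<otimes> a)"
    using eq unfolding ar ra using c r g by simp
  let ?\<gamma> = "\<one> \<ominus> \<beta>"
  have "?\<gamma> \<otimes> (a \<otimes> a) = a \<otimes> a \<ominus> \<beta> \<otimes> (a \<otimes> a)" using c g by algebra
  also have "\<dots> = \<beta> \<otimes> (r \<otimes> r \<oplus> a \<otimes> a) \<ominus> \<beta> \<otimes> (a \<otimes> a)" by (subst eq'[symmetric]) (rule refl)
  also have "\<dots> = \<beta> \<otimes> (r \<otimes> r)" using c r g by algebra
  finally have k: "?\<gamma> \<otimes> (a \<otimes> a) = \<beta> \<otimes> (r \<otimes> r)" .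
  \<comment> \<open>The product of \<open>r + a X\<close> and \<open>- (1 - \<beta>) a + \<beta> r X\<close> is zero, and so are all products of their
    coefficients.\<close>
  have z1: "r \<otimes> \<ominus> (?\<gamma> \<otimes> a) = \<zero>"
  proof -
    have "r \<otimes> \<ominus> (?\<gamma> \<otimes> a) = \<ominus> (?\<gamma> \<otimes> (r \<otimes> a))" using c r g by algebra
    then show ?thesis using ra g by simp
  qed
  have z2: "r \<otimes> (\<beta> \<otimes> r) \<oplus> a \<otimes> \<ominus> (?\<gamma> \<otimes> a) = \<zero>"
  proof -
    have "r \<otimes> (\<beta> \<otimes> r) \<oplus> a \<otimes> \<ominus> (?\<gamma> \<otimes> a) = \<beta> \<otimes> (r \<otimes> r) \<ominus> ?\<gamma> \<otimes> (a \<otimes> a)" using c r g by algebra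
    then show ?thesis using k c r g by simp
  qed
  have z3: "a \<otimes> (\<beta> \<otimes> r) = \<zero>"
  proof -
    have "a \<otimes> (\<beta> \<otimes> r) = \<beta> \<otimes> (a \<otimes> r)" using c r g by algebra
    then show ?thesis using ar g by simp
  qed
  have zero: "x = \<zero>" if x: "x \<in> {r \<otimes> (\<beta> \<otimes> r), a \<otimes> \<ominus> (?\<gamma> \<otimes> a)}" for x
  proof -
    obtain p q t where "p \<in> carrier R" "q \<in> carrier R" "t \<in> carrier R"
      "x = p \<otimes> (r \<otimes> \<ominus> (?\<gamma> \<otimes> a)) \<oplus> q \<otimes> (r \<otimes> (\<beta> \<otimes> r) \<oplus> a \<otimes> \<ominus> (?\<gamma> \<otimes> a)) \<oplus> t \<otimes> (a \<otimes> (\<beta> \<otimes> r))"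
      by (rule Gaussian_ring_linear[OF G, of r a "\<ominus> (?\<gamma> \<otimes> a)" "\<beta> \<otimes> r" x]) (use c r g x in auto)
    then show ?thesis unfolding z1 z2 z3 by simp
  qed
  have "\<beta> \<otimes> (r \<otimes> r) = r \<otimes> (\<beta> \<otimes> r)" using r g by algebra
  also have "\<dots> = \<zero>" by (rule zero) simp
  finally have b0: "\<beta> \<otimes> (r \<otimes> r) = \<zero>" .
  show ?thesis
  proof (cases "\<beta> \<in> P")
    case False
    have "(\<beta> \<otimes> u) \<otimes> (a \<otimes> b) = \<beta> \<otimes> (u \<otimes> (a \<otimes> b))" using c g by algebra
    also have "\<dots> = (\<beta> \<otimes> z) \<otimes> (a \<otimes> a)" unfolding h using c g by algebra
    finally have 1: "(\<beta> \<otimes> u) \<otimes> (a \<otimes> b) = (\<beta> \<otimes> z) \<otimes> (a \<otimes> a)" .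
    have "((\<beta> \<otimes> u) \<otimes> (\<beta> \<otimes> u)) \<otimes> (b \<otimes> b) =
        \<beta> \<otimes> (\<beta> \<otimes> (r \<otimes> r)) \<oplus> (\<beta> \<otimes> \<beta> \<otimes> z) \<otimes> (u \<otimes> (a \<otimes> b) \<oplus> u \<otimes> (a \<otimes> b)) \<ominus> (\<beta> \<otimes> z) \<otimes> (\<beta> \<otimes> z) \<otimes> (a \<otimes> a)"
      unfolding r_def using c g by algebra
    also have "\<dots> = \<beta> \<otimes> \<zero> \<oplus> (\<beta> \<otimes> \<beta> \<otimes> z) \<otimes> (z \<otimes> (a \<otimes> a) \<oplus> z \<otimes> (a \<otimes> a)) \<ominus> (\<beta> \<otimes> z) \<otimes> (\<beta> \<otimes> z) \<otimes> (a \<otimes> a)"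
      by (simp only: b0 h)
    also have "\<dots> = ((\<beta> \<otimes> z) \<otimes> (\<beta> \<otimes> z)) \<otimes> (a \<otimes> a)" using c g by algebra
    finally have 2: "((\<beta> \<otimes> u) \<otimes> (\<beta> \<otimes> u)) \<otimes> (b \<otimes> b) = ((\<beta> \<otimes> z) \<otimes> (\<beta> \<otimes> z)) \<otimes> (a \<otimes> a)" .
    have "\<beta> \<otimes> u \<in> carrier R - P" using primeidealD(3)[OF P] False c g by auto
    then show ?thesis using 1 2 c g by (intro bexI[of _ "\<beta> \<otimes> u"] bexI[of _ "\<beta> \<otimes> z"]) auto
  next
    case True
    then have nP: "?\<gamma> \<notin> P" using primeideal_complement[OF P g(2)] by simp
    have a0: "?\<gamma> \<otimes> (a \<otimes> a) = \<zero>" using k b0 by simp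
    have "(?\<gamma> \<otimes> u) \<otimes> (a \<otimes> b) = ?\<gamma> \<otimes> (u \<otimes> (a \<otimes> b))" using c g by algebra
    also have "\<dots> = z \<otimes> (?\<gamma> \<otimes> (a \<otimes> a))" unfolding h using c g by algebra
    also have "\<dots> = \<zero> \<otimes> (b \<otimes> b)" using a0 c by simp
    finally have 1: "(?\<gamma> \<otimes> u) \<otimes> (a \<otimes> b) = \<zero> \<otimes> (b \<otimes> b)" .
    have "((?\<gamma> \<otimes> u) \<otimes> (?\<gamma> \<otimes> u)) \<otimes> (a \<otimes> a) = (u \<otimes> u \<otimes> ?\<gamma>) \<otimes> (?\<gamma> \<otimes> (a \<otimes> a))" using c g by algebra
    also have "\<dots> = (\<zero> \<otimes> \<zero>) \<otimes> (b \<otimes> b)" using a0 c g by simp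
    finally have 2: "((?\<gamma> \<otimes> u) \<otimes> (?\<gamma> \<otimes> u)) \<otimes> (a \<otimes> a) = (\<zero> \<otimes> \<zero>) \<otimes> (b \<otimes> b)" .
    have "?\<gamma> \<otimes> u \<in> carrier R - P" using primeidealD(3)[OF P] nP c g by auto
    then show ?thesis using 1 2 by (intro bexI[of _ "?\<gamma> \<otimes> u"] bexI[of _ \<zero>]) auto
  qed
qed

lemma Gaussian_pair:
  assumes G: "Gaussian_ring R" and P: "primeideal P R"
    and c: "a \<in> carrier R" "b \<in> carrier R"
  obtains (left) u z where "u \<in> carrier R" "u \<notin> P" "z \<in> carrier R"
      "u \<otimes> (a \<otimes> b) = z \<otimes> (a \<otimes> a)" "(u \<otimes> u) \<otimes> (b \<otimes> b) = (z \<otimes> z) \<otimes> (a \<otimes> a)"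
    | (right) u z where "u \<in> carrier R" "u \<notin> P" "z \<in> carrier R"
      "u \<otimes> (a \<otimes> b) = z \<otimes> (b \<otimes> b)" "(u \<otimes> u) \<otimes> (a \<otimes> a) = (z \<otimes> z) \<otimes> (b \<otimes> b)"
proof -
  obtain u z where uz: "u \<in> carrier R" "u \<notin> P" "z \<in> carrier R"
    and alt: "u \<otimes> (a \<otimes> b) = z \<otimes> (a \<otimes> a) \<or> u \<otimes> (a \<otimes> b) = z \<otimes> (b \<otimes> b)"
    using Gaussian_mixed_product[OF G P c] by blast
  have "\<exists>u \<in> carrier R - P. \<exists>z \<in> carrier R.
      u \<otimes> (a \<otimes> b) = z \<otimes> (a \<otimes> a) \<and> (u \<otimes> u) \<otimes> (b \<otimes> b) = (z \<otimes> z) \<otimes> (a \<otimes> a) \<or>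
      u \<otimes> (a \<otimes> b) = z \<otimes> (b \<otimes> b) \<and> (u \<otimes> u) \<otimes> (a \<otimes> a) = (z \<otimes> z) \<otimes> (b \<otimes> b)"
    using alt
  proof
    assume "u \<otimes> (a \<otimes> b) = z \<otimes> (a \<otimes> a)"
    then show ?thesis by (rule Gaussian_pair_aux[OF G P c uz])
  next
    assume "u \<otimes> (a \<otimes> b) = z \<otimes> (b \<otimes> b)"
    then have "u \<otimes> (b \<otimes> a) = z \<otimes> (b \<otimes> b)" using m_comm[OF c] by simp
    from Gaussian_pair_aux[OF G P c(2,1) uz this] show ?thesis
      unfolding m_comm[OF c(2,1)] by blast
  qed
  then show thesis using left right by blast
qed

end

context cring
begin

lemma Gaussian_largest_square:
  assumes G: "Gaussian_ring R" and P: "primeideal P R"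
    and "finite S" "S \<noteq> {}" "S \<subseteq> carrier R"
  shows "\<exists>i \<in> S. \<forall>s \<in> S. \<exists>v \<in> carrier R - P. \<exists>z \<in> carrier R. v \<otimes> (s \<otimes> s) = z \<otimes> (i \<otimes> i)"
  using assms(3-)
proof (induction S rule: finite_ne_induct)
  case (singleton x)
  have "\<one> \<in> carrier R - P" using primeidealD(2)[OF P] by simp
  then show ?case by blast
next
  case (insert x S)
  then obtain i where i: "i \<in> S"
    and y: "\<And>s. s \<in> S \<Longrightarrow> \<exists>v \<in> carrier R - P. \<exists>z \<in> carrier R. v \<otimes> (s \<otimes> s) = z \<otimes> (i \<otimes> i)" by blast
  have S: "S \<subseteq> carrier R" and cr: "i \<in> carrier R" "x \<in> carrier R" using insert i by auto
  have one: "\<one> \<in> carrier R - P" using primeidealD(2)[OF P] by simp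
  show ?case
  proof (cases rule: Gaussian_pair[OF G P cr])
    case (1 u z)
    have "u \<otimes> u \<in> carrier R - P" "z \<otimes> z \<in> carrier R" using 1(1-3) primeidealD(3)[OF P] by auto
    then have "\<exists>v \<in> carrier R - P. \<exists>z \<in> carrier R. v \<otimes> (x \<otimes> x) = z \<otimes> (i \<otimes> i)"
      using 1(5) by blast
    then show ?thesis using i y by blast
  next
    case (2 u z)
    have uu: "u \<otimes> u \<in> carrier R" "u \<otimes> u \<notin> P" "z \<otimes> z \<in> carrier R"
      using 2(1-3) primeidealD(3)[OF P] by auto
    have "\<exists>v \<in> carrier R - P. \<exists>z \<in> carrier R. v \<otimes> (s \<otimes> s) = z \<otimes> (x \<otimes> x)" if s: "s \<in> S" for s
    proof -
      obtain v w where v: "v \<in> carrier R" "v \<notin> P" "w \<in> carrier R" "v \<otimes> (s \<otimes> s) = w \<otimes> (i \<otimes> i)"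
        using y[OF s] by blast
      have sc: "s \<in> carrier R" using s S by blast
      have "((u \<otimes> u) \<otimes> v) \<otimes> (s \<otimes> s) = (u \<otimes> u) \<otimes> (v \<otimes> (s \<otimes> s))" using uu(1) v(1) sc by algebra
      also have "\<dots> = w \<otimes> ((u \<otimes> u) \<otimes> (i \<otimes> i))" unfolding v(4) using 2(1) v(3) cr by algebra
      also have "\<dots> = (w \<otimes> (z \<otimes> z)) \<otimes> (x \<otimes> x)" unfolding 2(5) using 2(3) v(3) cr by algebra
      finally show ?thesis
        using uu v primeidealD(3)[OF P uu(1) v(1) uu(2) v(2)]
        by (intro bexI[of _ "(u \<otimes> u) \<otimes> v"] bexI[of _ "w \<otimes> (z \<otimes> z)"]) auto
    qed
    then show ?thesis using one cr by blast
  qed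
qed

text \<open>
  If the two-element case expresses \<open>i\<close> by \<open>s\<close> instead of \<open>s\<close> by \<open>i\<close>, the hypothesis that \<open>i\<^sup>2\<close> divides
  \<open>s\<^sup>2\<close> reverses the roles: either the coordinate \<open>y\<close> is a unit, or \<open>s\<^sup>2 = 0\<close>.
\<close>

lemma Gaussian_coordinate:
  assumes G: "Gaussian_ring R" and P: "primeideal P R"
    and c: "i \<in> carrier R" "s \<in> carrier R"
    and sq: "v \<in> carrier R" "v \<notin> P" "z \<in> carrier R" "v \<otimes> (s \<otimes> s) = z \<otimes> (i \<otimes> i)"
  shows "\<exists>u \<in> carrier R - P. \<exists>y \<in> carrier R.
    u \<otimes> (i \<otimes> s) = y \<otimes> (i \<otimes> i) \<and> (u \<otimes> u) \<otimes> (s \<otimes> s) = (y \<otimes> y) \<otimes> (i \<otimes> i)"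
proof (cases rule: Gaussian_pair[OF G P c])
  case (1 u y)
  then show ?thesis by blast
next
  case (2 u y)
  note u = 2(1-3) and e1 = 2(4) and e2 = 2(5)
  show ?thesis
  proof (cases "y \<in> P")
    case False
    have "(y \<otimes> u) \<otimes> (i \<otimes> s) = y \<otimes> (u \<otimes> (i \<otimes> s))" using u c by algebra
    also have "\<dots> = (y \<otimes> y) \<otimes> (s \<otimes> s)" unfolding e1 using u c by algebra
    also have "\<dots> = (u \<otimes> u) \<otimes> (i \<otimes> i)" by (rule e2[symmetric])
    finally have 3: "(y \<otimes> u) \<otimes> (i \<otimes> s) = (u \<otimes> u) \<otimes> (i \<otimes> i)" .
    have "((y \<otimes> u) \<otimes> (y \<otimes> u)) \<otimes> (s \<otimes> s) = (u \<otimes> u) \<otimes> ((y \<otimes> y) \<otimes> (s \<otimes> s))" using u c by algebra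
    also have "\<dots> = ((u \<otimes> u) \<otimes> (u \<otimes> u)) \<otimes> (i \<otimes> i)" unfolding e2[symmetric] using u c by algebra
    finally have 4: "((y \<otimes> u) \<otimes> (y \<otimes> u)) \<otimes> (s \<otimes> s) = ((u \<otimes> u) \<otimes> (u \<otimes> u)) \<otimes> (i \<otimes> i)" .
    have "y \<otimes> u \<in> carrier R - P" using primeidealD(3)[OF P] u False by auto
    then show ?thesis using 3 4 u by (intro bexI[of _ "y \<otimes> u"] bexI[of _ "u \<otimes> u"]) auto
  next
    case True
    \<comment> \<open>Substituting the two relations between \<open>s\<^sup>2\<close> and \<open>i\<^sup>2\<close> into each other gives a local unit that
      kills \<open>s\<^sup>2\<close>.\<close>
    define k where "k = (u \<otimes> u) \<otimes> v \<ominus> z \<otimes> (y \<otimes> y)"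
    have "z \<otimes> (y \<otimes> y) \<in> P" using idealD(5)[OF primeidealD(1)[OF P]] True u sq by simp
    moreover have "(u \<otimes> u) \<otimes> v \<notin> P" using primeidealD(3)[OF P] u sq by auto
    ultimately have k: "k \<in> carrier R" "k \<notin> P"
      unfolding k_def using primeideal_minus[OF P] u sq by auto
    have "k \<otimes> (s \<otimes> s) = (u \<otimes> u) \<otimes> (v \<otimes> (s \<otimes> s)) \<ominus> z \<otimes> ((y \<otimes> y) \<otimes> (s \<otimes> s))"
      unfolding k_def using u c sq(1,3) by algebra
    also have "\<dots> = (u \<otimes> u) \<otimes> (z \<otimes> (i \<otimes> i)) \<ominus> z \<otimes> ((u \<otimes> u) \<otimes> (i \<otimes> i))" by (simp only: sq(4) e2)
    also have "\<dots> = \<zero>" using u c sq(1,3) by algebra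
    finally have ks: "k \<otimes> (s \<otimes> s) = \<zero>" .
    have "(u \<otimes> k) \<otimes> (i \<otimes> s) = k \<otimes> (u \<otimes> (i \<otimes> s))" using u c k(1) by algebra
    also have "\<dots> = y \<otimes> (k \<otimes> (s \<otimes> s))" unfolding e1 using u c k(1) by algebra
    also have "\<dots> = \<zero> \<otimes> (i \<otimes> i)" unfolding ks using u c by simp
    finally have 3: "(u \<otimes> k) \<otimes> (i \<otimes> s) = \<zero> \<otimes> (i \<otimes> i)" .
    have "((u \<otimes> k) \<otimes> (u \<otimes> k)) \<otimes> (s \<otimes> s) = (u \<otimes> u \<otimes> k) \<otimes> (k \<otimes> (s \<otimes> s))"
      using u c k(1) by algebra
    also have "\<dots> = (\<zero> \<otimes> \<zero>) \<otimes> (i \<otimes> i)" unfolding ks using u c k by simp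
    finally have 4: "((u \<otimes> k) \<otimes> (u \<otimes> k)) \<otimes> (s \<otimes> s) = (\<zero> \<otimes> \<zero>) \<otimes> (i \<otimes> i)" .
    have "u \<otimes> k \<in> carrier R - P" using primeidealD(3)[OF P] u k by auto
    then show ?thesis using 3 4 by (intro bexI[of _ "u \<otimes> k"] bexI[of _ \<zero>]) auto
  qed
qed

text \<open>
  Let \<open>i\<close> have the largest square.  By the two-element case every \<open>s\<close> is locally \<open>y\<^sub>s i + r\<^sub>s\<close> with
  \<open>i r\<^sub>s = 0\<close> and \<open>r\<^sub>s\<^sup>2 = 0\<close>, and the two-element case for \<open>r\<^sub>s\<close> and \<open>r\<^sub>t\<close> gives \<open>r\<^sub>s r\<^sub>t = 0\<close>.
\<close>

lemma Gaussian_imp_square_dominated: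
  assumes G: "Gaussian_ring R" and P: "primeideal P R"
  shows "square_dominated R P"
  unfolding square_dominated_def
proof (intro allI impI)
  fix S assume "finite S \<and> S \<noteq> {} \<and> S \<subseteq> carrier R"
  then have S: "finite S" "S \<noteq> {}" "S \<subseteq> carrier R" by auto
  obtain i where i: "i \<in> S"
    and largest: "\<And>s. s \<in> S \<Longrightarrow> \<exists>v \<in> carrier R - P. \<exists>z \<in> carrier R. v \<otimes> (s \<otimes> s) = z \<otimes> (i \<otimes> i)"
    using Gaussian_largest_square[OF G P S] by blast
  have ic: "i \<in> carrier R" and sc: "\<And>s. s \<in> S \<Longrightarrow> s \<in> carrier R" using i S by auto
  define Q where "Q = (\<lambda>s u. \<exists>y \<in> carrier R.
    u \<otimes> (i \<otimes> s) = y \<otimes> (i \<otimes> i) \<and> (u \<otimes> u) \<otimes> (s \<otimes> s) = (y \<otimes> y) \<otimes> (i \<otimes> i))"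
  have "\<exists>u \<in> carrier R - P. \<forall>s \<in> S. Q s u"
  proof (rule common_denominator[OF P S(1)])
    show "\<exists>u \<in> carrier R - P. Q s u" if s: "s \<in> S" for s
    proof -
      obtain v z where "v \<in> carrier R" "v \<notin> P" "z \<in> carrier R" "v \<otimes> (s \<otimes> s) = z \<otimes> (i \<otimes> i)"
        using largest[OF s] by blast
      then show ?thesis unfolding Q_def by (rule Gaussian_coordinate[OF G P ic sc[OF s]])
    qed
    show "Q s (k \<otimes> u)" if s: "s \<in> S" and u: "u \<in> carrier R" and k: "k \<in> carrier R" and Q: "Q s u"
      for s u k
    proof -
      obtain y where y: "y \<in> carrier R" and e: "u \<otimes> (i \<otimes> s) = y \<otimes> (i \<otimes> i)"
        "(u \<otimes> u) \<otimes> (s \<otimes> s) = (y \<otimes> y) \<otimes> (i \<otimes> i)"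
        using Q unfolding Q_def by blast
      note c = sc[OF s] ic u k y
      have "(k \<otimes> u) \<otimes> (i \<otimes> s) = k \<otimes> (u \<otimes> (i \<otimes> s))" using c by algebra
      also have "\<dots> = (k \<otimes> y) \<otimes> (i \<otimes> i)" unfolding e(1) using c by algebra
      finally have 1: "(k \<otimes> u) \<otimes> (i \<otimes> s) = (k \<otimes> y) \<otimes> (i \<otimes> i)" .
      have "((k \<otimes> u) \<otimes> (k \<otimes> u)) \<otimes> (s \<otimes> s) = (k \<otimes> k) \<otimes> ((u \<otimes> u) \<otimes> (s \<otimes> s))" using c by algebra
      also have "\<dots> = ((k \<otimes> y) \<otimes> (k \<otimes> y)) \<otimes> (i \<otimes> i)" unfolding e(2) using c by algebra
      finally have 2: "((k \<otimes> u) \<otimes> (k \<otimes> u)) \<otimes> (s \<otimes> s) = ((k \<otimes> y) \<otimes> (k \<otimes> y)) \<otimes> (i \<otimes> i)" .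
      show ?thesis unfolding Q_def using 1 2 k y by (intro bexI[of _ "k \<otimes> y"]) auto
    qed
  qed
  then obtain u where u: "u \<in> carrier R" "u \<notin> P" and "\<forall>s \<in> S. Q s u" by blast
  then have "\<forall>s \<in> S. \<exists>y. y \<in> carrier R \<and> u \<otimes> (i \<otimes> s) = y \<otimes> (i \<otimes> i) \<and>
      (u \<otimes> u) \<otimes> (s \<otimes> s) = (y \<otimes> y) \<otimes> (i \<otimes> i)" unfolding Q_def by blast
  from bchoice[OF this] obtain y0 where y0: "\<forall>s \<in> S. y0 s \<in> carrier R \<and>
      u \<otimes> (i \<otimes> s) = y0 s \<otimes> (i \<otimes> i) \<and> (u \<otimes> u) \<otimes> (s \<otimes> s) = (y0 s \<otimes> y0 s) \<otimes> (i \<otimes> i)" ..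
  define y where "y = y0(i := u)"
  have yi: "y i = u" by (simp add: y_def)
  have yc: "y s \<in> carrier R" if "s \<in> S" for s using that y0 u by (simp add: y_def)
  have e1: "u \<otimes> (i \<otimes> s) = y s \<otimes> (i \<otimes> i)" if "s \<in> S" for s
    using that y0 by (cases "s = i") (auto simp: y_def)
  have e2: "(u \<otimes> u) \<otimes> (s \<otimes> s) = (y s \<otimes> y s) \<otimes> (i \<otimes> i)" if "s \<in> S" for s
    using that y0 by (cases "s = i") (auto simp: y_def)
  define r where "r = (\<lambda>s. u \<otimes> s \<ominus> y s \<otimes> i)"
  have rc: "r s \<in> carrier R" if "s \<in> S" for s using that yc sc u ic by (simp add: r_def)
  have rr: "r s \<otimes> r t = (u \<otimes> u) \<otimes> (s \<otimes> t) \<ominus> (y s \<otimes> y t) \<otimes> (i \<otimes> i)" if st: "s \<in> S" "t \<in> S" for s t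
  proof -
    note c = sc[OF st(1)] sc[OF st(2)] yc[OF st(1)] yc[OF st(2)] ic u(1)
    have "r s \<otimes> r t = (u \<otimes> u) \<otimes> (s \<otimes> t) \<ominus> y t \<otimes> (u \<otimes> (i \<otimes> s)) \<ominus> y s \<otimes> (u \<otimes> (i \<otimes> t))
        \<oplus> (y s \<otimes> y t) \<otimes> (i \<otimes> i)"
      unfolding r_def using c by algebra
    also have "\<dots> = (u \<otimes> u) \<otimes> (s \<otimes> t) \<ominus> (y s \<otimes> y t) \<otimes> (i \<otimes> i)"
      unfolding e1[OF st(1)] e1[OF st(2)] using c by algebra
    finally show ?thesis .
  qed
  define K where "K = (\<lambda>p k. k \<otimes> (r (fst p) \<otimes> r (snd p)) = \<zero>)"
  have "\<exists>k \<in> carrier R - P. \<forall>p \<in> S \<times> S. K p k"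
  proof (rule common_denominator[OF P])
    show "finite (S \<times> S)" using S by simp
    show "\<exists>k \<in> carrier R - P. K p k" if p: "p \<in> S \<times> S" for p
    proof -
      obtain s t where st: "p = (s, t)" "s \<in> S" "t \<in> S" using p by blast
      have sq: "r s \<otimes> r s = \<zero>" if "s \<in> S" for s
        unfolding rr[OF that that] e2[OF that] using yc[OF that] ic by (simp add: r_right_minus_eq)
      show ?thesis
      proof (cases rule: Gaussian_pair[OF G P rc[OF st(2)] rc[OF st(3)]])
        case (1 k z)
        then show ?thesis unfolding K_def st(1) by (intro bexI[of _ k]) (auto simp: sq[OF st(2)])
      next
        case (2 k z)
        then show ?thesis unfolding K_def st(1) by (intro bexI[of _ k]) (auto simp: sq[OF st(3)])
      qed
    qed
    show "K p (l \<otimes> k)" if "p \<in> S \<times> S" "k \<in> carrier R" "l \<in> carrier R" "K p k" for p k l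
      using that rc unfolding K_def by (auto simp: m_assoc)
  qed
  then obtain k where k: "k \<in> carrier R" "k \<notin> P" and K: "\<forall>p \<in> S \<times> S. K p k" by blast
  have eq: "((k \<otimes> u) \<otimes> (k \<otimes> u)) \<otimes> (s \<otimes> t) = ((k \<otimes> y s) \<otimes> (k \<otimes> y t)) \<otimes> (i \<otimes> i)"
    if st: "s \<in> S" "t \<in> S" for s t
  proof -
    note c = sc[OF st(1)] sc[OF st(2)] yc[OF st(1)] yc[OF st(2)] ic u(1) k(1)
    have "k \<otimes> (r s \<otimes> r t) = \<zero>" using K st unfolding K_def by auto
    then have z: "k \<otimes> ((u \<otimes> u) \<otimes> (s \<otimes> t) \<ominus> (y s \<otimes> y t) \<otimes> (i \<otimes> i)) = \<zero>" by (simp only: rr[OF st])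
    have "((k \<otimes> u) \<otimes> (k \<otimes> u)) \<otimes> (s \<otimes> t) =
        k \<otimes> (k \<otimes> ((u \<otimes> u) \<otimes> (s \<otimes> t) \<ominus> (y s \<otimes> y t) \<otimes> (i \<otimes> i))) \<oplus> ((k \<otimes> y s) \<otimes> (k \<otimes> y t)) \<otimes> (i \<otimes> i)"
      using c by algebra
    also have "\<dots> = ((k \<otimes> y s) \<otimes> (k \<otimes> y t)) \<otimes> (i \<otimes> i)" unfolding z using c by simp
    finally show ?thesis .
  qed
  have ku: "k \<otimes> u \<in> carrier R - P" using primeidealD(3)[OF P] k u by auto
  show "\<exists>i \<in> S. \<exists>u \<in> carrier R - P. \<exists>y \<in> S \<rightarrow> carrier R. y i = u \<and>
      (\<forall>s \<in> S. \<forall>t \<in> S. (u \<otimes> u) \<otimes> (s \<otimes> t) = (y s \<otimes> y t) \<otimes> (i \<otimes> i))"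
  proof (intro bexI[OF _ i] bexI[OF _ ku] bexI[of _ "\<lambda>s. k \<otimes> y s"] conjI ballI)
    show "k \<otimes> y i = k \<otimes> u" using yi by simp
    show "(\<lambda>s. k \<otimes> y s) \<in> S \<rightarrow> carrier R" using yc k by auto
  qed (rule eq)
qed

end

section \<open>Annihilators\<close>

text \<open>
  If \<open>a b = 0\<close> then \<open>ann a + ann b = R\<close>; equivalently, all principal ideals are flat.
\<close>

definition pure_annihilators :: "('a, 'm) ring_scheme \<Rightarrow> bool" where
  "pure_annihilators R \<longleftrightarrow>
     (\<forall>a \<in> carrier R. \<forall>b \<in> carrier R. a \<otimes>\<^bsub>R\<^esub> b = \<zero>\<^bsub>R\<^esub> \<longrightarrow>
        (\<exists>e \<in> carrier R. e \<otimes>\<^bsub>R\<^esub> a = \<zero>\<^bsub>R\<^esub> \<and> (\<one>\<^bsub>R\<^esub> \<ominus>\<^bsub>R\<^esub> e) \<otimes>\<^bsub>R\<^esub> b = \<zero>\<^bsub>R\<^esub>))"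

text \<open>
  Annihilators of elements are generated by idempotents; equivalently, all principal ideals are
  projective.
\<close>

definition idempotent_annihilators :: "('a, 'm) ring_scheme \<Rightarrow> bool" where
  "idempotent_annihilators R \<longleftrightarrow>
     (\<forall>a \<in> carrier R. \<exists>e \<in> carrier R. e \<otimes>\<^bsub>R\<^esub> e = e \<and> e \<otimes>\<^bsub>R\<^esub> a = \<zero>\<^bsub>R\<^esub> \<and>
        (\<forall>x \<in> carrier R. x \<otimes>\<^bsub>R\<^esub> a = \<zero>\<^bsub>R\<^esub> \<longrightarrow> x \<otimes>\<^bsub>R\<^esub> e = x))"

context cring
begin

lemma quotient_ideal:
  assumes "a \<in> carrier R" "b \<in> carrier R"
  shows "ideal {u \<in> carrier R. \<exists>v \<in> carrier R. u \<otimes> a = v \<otimes> b} R" (is "ideal ?I R")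
proof (rule idealI_closed)
  have "\<zero> \<otimes> a = \<zero> \<otimes> b" using assms by simp
  then show "\<zero> \<in> ?I" by blast
  show "x \<oplus> y \<in> ?I" if "x \<in> ?I" "y \<in> ?I" for x y
  proof -
    from that(1) obtain v where v: "x \<in> carrier R" "v \<in> carrier R" "x \<otimes> a = v \<otimes> b" by blast
    from that(2) obtain w where w: "y \<in> carrier R" "w \<in> carrier R" "y \<otimes> a = w \<otimes> b" by blast
    have "(x \<oplus> y) \<otimes> a = (v \<oplus> w) \<otimes> b" using v w assms by (simp add: l_distr)
    then show ?thesis using v w by blast
  qed
  show "r \<otimes> x \<in> ?I" if "x \<in> ?I" "r \<in> carrier R" for x r
  proof -
    from that(1) obtain v where v: "x \<in> carrier R" "v \<in> carrier R" "x \<otimes> a = v \<otimes> b" by blast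
    have "(r \<otimes> x) \<otimes> a = (r \<otimes> v) \<otimes> b" using v that(2) assms by (simp add: m_assoc)
    then show ?thesis using v that(2) by blast
  qed
qed auto

lemma one_in_sum_if_local:
  assumes "ideal I R" "ideal J R" and "\<And>P. primeideal P R \<Longrightarrow> \<exists>u \<in> carrier R - P. u \<in> I \<or> u \<in> J"
  obtains u where "u \<in> I" "\<one> \<ominus> u \<in> J"
proof -
  have IJ: "ideal (I <+> J) R" by (rule add_ideals[OF assms(1,2)])
  have I: "I \<subseteq> I <+> J"
  proof
    fix x assume "x \<in> I"
    moreover have "x = x \<oplus> \<zero>" using idealD(1)[OF assms(1)] \<open>x \<in> I\<close> by auto
    ultimately show "x \<in> I <+> J" unfolding set_add_def' using idealD(2)[OF assms(2)] by blast
  qed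
  have J: "J \<subseteq> I <+> J"
  proof
    fix x assume "x \<in> J"
    moreover have "x = \<zero> \<oplus> x" using idealD(1)[OF assms(2)] \<open>x \<in> J\<close> by auto
    ultimately show "x \<in> I <+> J" unfolding set_add_def' using idealD(2)[OF assms(1)] by blast
  qed
  have "\<one> \<in> I <+> J"
    by (rule one_in_idealI[OF IJ]) (use assms(3) I J in blast)
  then obtain u v where uv: "u \<in> I" "v \<in> J" "\<one> = u \<oplus> v" unfolding set_add_def' by blast
  then have "\<one> \<ominus> u = v"
    using add_minus_cancel(2)[of u v] idealD(1)[OF assms(1)] idealD(1)[OF assms(2)] by auto
  then show thesis using that uv by simp
qed

lemma comaximal_quotients_if_local:
  assumes "\<And>a b P. a \<in> carrier R \<Longrightarrow> b \<in> carrier R \<Longrightarrow> primeideal P R \<Longrightarrow>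
    \<exists>u \<in> carrier R - P. \<exists>v \<in> carrier R. u \<otimes> a = v \<otimes> b \<or> u \<otimes> b = v \<otimes> a"
  shows "comaximal_quotients R"
proof (rule comaximal_quotientsI)
  fix a b assume ab: "a \<in> carrier R" "b \<in> carrier R"
  show "\<exists>u \<in> carrier R. \<exists>v \<in> carrier R. \<exists>w \<in> carrier R. u \<otimes> a = v \<otimes> b \<and> (\<one> \<ominus> u) \<otimes> b = w \<otimes> a"
  proof (rule one_in_sum_if_local[OF quotient_ideal[OF ab] quotient_ideal[OF ab(2,1)]])
    fix P assume P: "primeideal P R"
    obtain u v where "u \<in> carrier R - P" "v \<in> carrier R" "u \<otimes> a = v \<otimes> b \<or> u \<otimes> b = v \<otimes> a"
      using assms[OF ab P] by blast
    then show "\<exists>u \<in> carrier R - P. u \<in> {u \<in> carrier R. \<exists>v \<in> carrier R. u \<otimes> a = v \<otimes> b} \<or>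
        u \<in> {u \<in> carrier R. \<exists>v \<in> carrier R. u \<otimes> b = v \<otimes> a}"
      by (intro bexI[of _ u]) auto
  next
    fix u assume "u \<in> {u \<in> carrier R. \<exists>v \<in> carrier R. u \<otimes> a = v \<otimes> b}"
      and "\<one> \<ominus> u \<in> {u \<in> carrier R. \<exists>v \<in> carrier R. u \<otimes> b = v \<otimes> a}"
    then show ?thesis by simp blast
  qed
qed

lemma annihilator_ideal:
  assumes "a \<in> carrier R" shows "ideal {u \<in> carrier R. u \<otimes> a = \<zero>} R"
proof -
  have "{u \<in> carrier R. u \<otimes> a = \<zero>} = {u \<in> carrier R. \<exists>v \<in> carrier R. u \<otimes> a = v \<otimes> \<zero>}" by auto
  then show ?thesis using quotient_ideal[OF assms, of \<zero>] by simp
qed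

lemma pure_annihilators_if_local:
  assumes "\<And>a b P. a \<in> carrier R \<Longrightarrow> b \<in> carrier R \<Longrightarrow> a \<otimes> b = \<zero> \<Longrightarrow> primeideal P R \<Longrightarrow>
    \<exists>u \<in> carrier R - P. u \<otimes> a = \<zero> \<or> u \<otimes> b = \<zero>"
  shows "pure_annihilators R"
  unfolding pure_annihilators_def
proof (intro ballI impI)
  fix a b assume ab: "a \<in> carrier R" "b \<in> carrier R" "a \<otimes> b = \<zero>"
  show "\<exists>e \<in> carrier R. e \<otimes> a = \<zero> \<and> (\<one> \<ominus> e) \<otimes> b = \<zero>"
  proof (rule one_in_sum_if_local[OF annihilator_ideal[OF ab(1)] annihilator_ideal[OF ab(2)]])
    fix P assume "primeideal P R"
    then show "\<exists>u \<in> carrier R - P. u \<in> {u \<in> carrier R. u \<otimes> a = \<zero>} \<or> u \<in> {u \<in> carrier R. u \<otimes> b = \<zero>}"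
      using assms[OF ab] by blast
  qed blast
qed

lemma pure_annihilators_local:
  assumes "pure_annihilators R" "primeideal P R"
    and "a \<in> carrier R" "b \<in> carrier R" "a \<otimes> b = \<zero>"
  shows "\<exists>u \<in> carrier R - P. u \<otimes> a = \<zero> \<or> u \<otimes> b = \<zero>"
proof -
  obtain e where e: "e \<in> carrier R" "e \<otimes> a = \<zero>" "(\<one> \<ominus> e) \<otimes> b = \<zero>"
    using assms unfolding pure_annihilators_def by blast
  then show ?thesis using primeideal_complement[OF assms(2) e(1)] by (metis DiffI minus_closed one_closed)
qed

end

section \<open>Pruefer extensions\<close>

text \<open>
  The condition says that the \<open>A\<close>-submodule of \<open>R\<close> generated by a finite set \<open>F\<close> containing \<open>1\<close> is
  invertible: locally at \<open>m\<close>, some \<open>l \<in> F\<close> divides all members of \<open>F\<close> with quotients in \<open>A\<close>, and \<open>w\<close>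
  is a local inverse of this \<open>l\<close>.
\<close>

locale Prufer_extension = cring +
  fixes A
  assumes subring: "subring A R"
    and denominator: "\<And>m F. ideal m (R\<lparr>carrier := A\<rparr>) \<Longrightarrow> \<one> \<notin> m \<Longrightarrow> finite F \<Longrightarrow> F \<subseteq> carrier R \<Longrightarrow> \<one> \<in> F \<Longrightarrow>
      \<exists>w \<in> A. \<exists>l \<in> F. (\<forall>x \<in> F. w \<otimes> x \<in> A) \<and> w \<otimes> l \<notin> m"

sublocale Prufer_extension \<subseteq> A: cring "R\<lparr>carrier := A\<rparr>"
  by (rule subring_cring[OF subring])

context Prufer_extension
begin

lemma A_carrier: "x \<in> A \<Longrightarrow> x \<in> carrier R"
  using subringE(1)[OF subring] by blast

lemma A_closed [simp]:
  "\<zero> \<in> A" "\<one> \<in> A" "x \<in> A \<Longrightarrow> y \<in> A \<Longrightarrow> x \<otimes> y \<in> A" "x \<in> A \<Longrightarrow> y \<in> A \<Longrightarrow> x \<oplus> y \<in> A"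
  using subringE[OF subring] by auto

lemma A_primeD:
  assumes "primeideal m (R\<lparr>carrier := A\<rparr>)"
  shows "ideal m (R\<lparr>carrier := A\<rparr>)" "\<one> \<notin> m"
    and "x \<in> A \<Longrightarrow> y \<in> A \<Longrightarrow> x \<notin> m \<Longrightarrow> y \<notin> m \<Longrightarrow> x \<otimes> y \<notin> m"
    and "x \<in> m \<Longrightarrow> y \<in> m \<Longrightarrow> x \<oplus> y \<in> m" "x \<in> m \<Longrightarrow> y \<in> A \<Longrightarrow> y \<otimes> x \<in> m" "\<zero> \<in> m" "m \<subseteq> A"
  using A.primeidealD[OF assms] A.idealD[OF A.primeidealD(1)[OF assms]] by auto

text \<open>
  The prime ideal \<open>q\<close> of \<open>R\<close> with \<open>R\<^sub>q = R\<^sub>m\<close>: its complement consists of the elements that divide a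
  member of \<open>A - m\<close>.  The sum of two elements of \<open>q\<close> is in \<open>q\<close> because one of \<open>1\<close> and the two
  summands dominates the others in the sense of a Pruefer extension.
\<close>

definition over_prime :: "'a set \<Rightarrow> 'a set" where
  "over_prime m = {b \<in> carrier R. \<forall>v \<in> carrier R. v \<otimes> b \<in> A \<longrightarrow> v \<otimes> b \<in> m}"

lemma not_over_prime:
  assumes "u \<in> carrier R" "u \<notin> over_prime m"
  obtains v where "v \<in> carrier R" "v \<otimes> u \<in> A" "v \<otimes> u \<notin> m"
  using assms unfolding over_prime_def by blast

lemma primeideal_over_prime:
  assumes m: "primeideal m (R\<lparr>carrier := A\<rparr>)"
  shows "primeideal (over_prime m) R"
proof (rule primeidealI)
  show "cring R" by (rule is_cring)
  show "ideal (over_prime m) R"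
  proof (rule idealI_closed)
    show "over_prime m \<subseteq> carrier R" by (auto simp: over_prime_def)
    show "\<zero> \<in> over_prime m" using A_primeD(6)[OF m] by (auto simp: over_prime_def)
    show "r \<otimes> x \<in> over_prime m" if "x \<in> over_prime m" "r \<in> carrier R" for x r
      using that unfolding over_prime_def by (auto simp: m_assoc[symmetric])
    show "b \<oplus> c \<in> over_prime m" if bq: "b \<in> over_prime m" and cq: "c \<in> over_prime m" for b c
    proof (rule ccontr)
      have bc: "b \<in> carrier R" "c \<in> carrier R" using bq cq by (auto simp: over_prime_def)
      assume "b \<oplus> c \<notin> over_prime m"
      then obtain v where v: "v \<in> carrier R" "v \<otimes> (b \<oplus> c) \<in> A" "v \<otimes> (b \<oplus> c) \<notin> m"
        using not_over_prime[of "b \<oplus> c" m] bc by auto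
      obtain w l where w: "w \<in> A" "l \<in> {\<one>, v \<otimes> b, v \<otimes> c}" "w \<otimes> l \<notin> m"
        and wF: "\<forall>x \<in> {\<one>, v \<otimes> b, v \<otimes> c}. w \<otimes> x \<in> A"
        using denominator[OF A_primeD(1,2)[OF m], of "{\<one>, v \<otimes> b, v \<otimes> c}"] v bc by auto
      have wc: "w \<in> carrier R" using w A_carrier by blast
      have in_m: "w \<otimes> (v \<otimes> x) \<in> m" if "x \<in> over_prime m" "w \<otimes> (v \<otimes> x) \<in> A" for x
      proof -
        have "x \<in> carrier R" using that by (auto simp: over_prime_def)
        then have "w \<otimes> (v \<otimes> x) = (w \<otimes> v) \<otimes> x" using wc v by (simp add: m_assoc)
        then show ?thesis using that wc v unfolding over_prime_def by auto
      qed
      have b: "w \<otimes> (v \<otimes> b) \<in> m" and c: "w \<otimes> (v \<otimes> c) \<in> m" using in_m bq cq wF by auto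
      then have "w \<notin> m" using w wc by auto
      then have "w \<otimes> (v \<otimes> (b \<oplus> c)) \<notin> m" using A_primeD(3)[OF m w(1) v(2)] v by blast
      moreover have "w \<otimes> (v \<otimes> (b \<oplus> c)) = w \<otimes> (v \<otimes> b) \<oplus> w \<otimes> (v \<otimes> c)"
        using wc v bc by algebra
      ultimately show False using A_primeD(4)[OF m b c] by simp
    qed
  qed
  have "\<one> \<notin> over_prime m" using A_primeD(2)[OF m] by (force simp: over_prime_def)
  then show "carrier R \<noteq> over_prime m" by blast
  show "a \<in> over_prime m \<or> b \<in> over_prime m"
    if ab: "a \<in> carrier R" "b \<in> carrier R" "a \<otimes> b \<in> over_prime m" for a b
  proof (rule ccontr)
    assume neg: "\<not> ?thesis"
    obtain v where v: "v \<in> carrier R" "v \<otimes> a \<in> A" "v \<otimes> a \<notin> m"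
      using not_over_prime[OF ab(1), of m] neg by blast
    obtain w where w: "w \<in> carrier R" "w \<otimes> b \<in> A" "w \<otimes> b \<notin> m"
      using not_over_prime[OF ab(2), of m] neg by blast
    have "(v \<otimes> a) \<otimes> (w \<otimes> b) \<in> A - m" using A_primeD(3)[OF m v(2) w(2) v(3) w(3)] v w by simp
    moreover have "(v \<otimes> a) \<otimes> (w \<otimes> b) = (v \<otimes> w) \<otimes> (a \<otimes> b)" using v(1) w(1) ab(1,2) by algebra
    ultimately show False using ab(3) v w unfolding over_prime_def by auto
  qed
qed

text \<open>This is how global identities over \<open>R\<close> yield local units of \<open>A\<close>.\<close>

lemma unit_ideal_local:
  assumes m: "primeideal m (R\<lparr>carrier := A\<rparr>)" and E: "E \<subseteq> carrier R" "\<one> \<in> Idl E"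
  obtains e v where "e \<in> E" "v \<in> carrier R" "v \<otimes> e \<in> A" "v \<otimes> e \<notin> m"
proof -
  note q = primeideal_over_prime[OF m]
  have "\<not> E \<subseteq> over_prime m"
    using genideal_minimal[OF primeidealD(1)[OF q], of E] primeidealD(2)[OF q] E by blast
  then obtain e where e: "e \<in> E" "e \<in> carrier R" "e \<notin> over_prime m" using E(1) by blast
  obtain v where "v \<in> carrier R" "v \<otimes> e \<in> A" "v \<otimes> e \<notin> m" by (rule not_over_prime[OF e(2,3)])
  then show thesis by (rule that[OF e(1)])
qed

text \<open>
  Given \<open>e a = z b\<close> with a local unit \<open>e\<close> of \<open>A\<close> and \<open>z \<in> R\<close>, let \<open>w\<close> be a denominator for \<open>1\<close> and \<open>z\<close>.
  If \<open>w\<close> is a local unit, then so is the coefficient \<open>w e\<close> of \<open>a\<close> in \<open>w e a = w z b\<close>; otherwise the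
  coefficient \<open>w z\<close> of \<open>b\<close> is one.
\<close>

theorem comaximal_quotients_restrict:
  assumes cq: "comaximal_quotients R"
  shows "comaximal_quotients (R\<lparr>carrier := A\<rparr>)"
proof (rule A.comaximal_quotients_if_local, simp_all)
  fix a b m assume ab: "a \<in> A" "b \<in> A" and m: "primeideal m (R\<lparr>carrier := A\<rparr>)"
  have *: "\<exists>u \<in> A - m. \<exists>v \<in> A. u \<otimes> a = v \<otimes> b \<or> u \<otimes> b = v \<otimes> a"
    if ab: "a \<in> A" "b \<in> A" and e: "e \<in> A" "e \<notin> m" and z: "z \<in> carrier R" "e \<otimes> a = z \<otimes> b" for a b e z
  proof -
    obtain w l where w: "w \<in> A" "l \<in> {\<one>, z}" "w \<otimes> l \<notin> m" and wz: "w \<otimes> z \<in> A"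
      using denominator[OF A_primeD(1,2)[OF m], of "{\<one>, z}"] z by auto
    note c = A_carrier[OF w(1)] z(1) A_carrier[OF ab(1)] A_carrier[OF ab(2)] A_carrier[OF e(1)]
    have "(w \<otimes> e) \<otimes> a = w \<otimes> (e \<otimes> a)" using c by algebra
    also have "\<dots> = (w \<otimes> z) \<otimes> b" unfolding z(2) using c by algebra
    finally have eq: "(w \<otimes> e) \<otimes> a = (w \<otimes> z) \<otimes> b" .
    show ?thesis
    proof (cases "w \<in> m")
      case False
      then have "w \<otimes> e \<in> A - m" using A_primeD(3)[OF m w(1) e(1)] e w by simp
      then show ?thesis using eq wz by blast
    next
      case True
      then have "w \<otimes> z \<in> A - m" using w wz c by auto
      moreover have "w \<otimes> e \<in> A" using w e by simp
      ultimately show ?thesis using eq by metis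
    qed
  qed
  note q = primeideal_over_prime[OF m]
  have abc: "a \<in> carrier R" "b \<in> carrier R" using ab A_carrier by auto
  obtain u v w where u: "u \<in> carrier R" "v \<in> carrier R" "w \<in> carrier R"
    "u \<otimes> a = v \<otimes> b" "(\<one> \<ominus> u) \<otimes> b = w \<otimes> a"
    by (rule comaximal_quotientsD[OF cq abc])
  have "\<exists>x \<in> carrier R - over_prime m. \<exists>z \<in> carrier R. x \<otimes> a = z \<otimes> b \<or> x \<otimes> b = z \<otimes> a"
    using primeideal_complement[OF q u(1)]
  proof
    assume "u \<notin> over_prime m" then show ?thesis using u by blast
  next
    assume "\<one> \<ominus> u \<notin> over_prime m" then show ?thesis using u by (metis DiffI minus_closed one_closed)
  qed
  then obtain x z where x: "x \<in> carrier R" "x \<notin> over_prime m" "z \<in> carrier R"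
    and alt: "x \<otimes> a = z \<otimes> b \<or> x \<otimes> b = z \<otimes> a" by blast
  obtain v where v: "v \<in> carrier R" "v \<otimes> x \<in> A" "v \<otimes> x \<notin> m" using not_over_prime[OF x(1,2)] .
  have vz: "v \<otimes> z \<in> carrier R" using v x by simp
  show "\<exists>u \<in> A - m. \<exists>v \<in> A. u \<otimes> a = v \<otimes> b \<or> u \<otimes> b = v \<otimes> a"
    using alt
  proof
    assume "x \<otimes> a = z \<otimes> b"
    then have "(v \<otimes> x) \<otimes> a = (v \<otimes> z) \<otimes> b" using v x abc by (simp add: m_assoc)
    then show ?thesis using *[OF ab v(2,3) vz] by simp
  next
    assume "x \<otimes> b = z \<otimes> a"
    then have "(v \<otimes> x) \<otimes> b = (v \<otimes> z) \<otimes> a" using v x abc by (simp add: m_assoc)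
    then show ?thesis using *[OF ab(2,1) v(2,3) vz] by blast
  qed
qed

theorem pure_annihilators_restrict:
  assumes pa: "pure_annihilators R"
  shows "pure_annihilators (R\<lparr>carrier := A\<rparr>)"
proof (rule A.pure_annihilators_if_local, simp_all)
  fix a b m assume ab: "a \<in> A" "b \<in> A" "a \<otimes> b = \<zero>" and m: "primeideal m (R\<lparr>carrier := A\<rparr>)"
  have c: "a \<in> carrier R" "b \<in> carrier R" using ab A_carrier by auto
  obtain u where u: "u \<in> carrier R" "u \<notin> over_prime m" and alt: "u \<otimes> a = \<zero> \<or> u \<otimes> b = \<zero>"
    using pure_annihilators_local[OF pa primeideal_over_prime[OF m] c ab(3)] by blast
  obtain v where v: "v \<in> carrier R" "v \<otimes> u \<in> A" "v \<otimes> u \<notin> m" using not_over_prime[OF u] .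
  have "(v \<otimes> u) \<otimes> a = \<zero> \<or> (v \<otimes> u) \<otimes> b = \<zero>" using alt u v c by (auto simp: m_assoc)
  then show "\<exists>u \<in> A - m. u \<otimes> a = \<zero> \<or> u \<otimes> b = \<zero>" using v by blast
qed

text \<open>Annihilators descend because \<open>A\<close> is integrally closed in \<open>R\<close> and so contains all idempotents.\<close>

lemma idempotent_mem:
  assumes e: "e \<in> carrier R" "e \<otimes> e = e" shows "e \<in> A"
proof -
  let ?D = "{d \<in> A. d \<otimes> e \<in> A}"
  have "ideal ?D (R\<lparr>carrier := A\<rparr>)"
  proof (rule A.idealI_closed)
    show "?D \<subseteq> carrier (R\<lparr>carrier := A\<rparr>)" by auto
    show "\<zero>\<^bsub>R\<lparr>carrier := A\<rparr>\<^esub> \<in> ?D" using e by simp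
    show "x \<oplus>\<^bsub>R\<lparr>carrier := A\<rparr>\<^esub> y \<in> ?D" if "x \<in> ?D" "y \<in> ?D" for x y
      using that e A_carrier by (simp add: l_distr)
    show "r \<otimes>\<^bsub>R\<lparr>carrier := A\<rparr>\<^esub> x \<in> ?D" if "x \<in> ?D" "r \<in> carrier (R\<lparr>carrier := A\<rparr>)" for x r
      using that e A_carrier by (simp add: m_assoc)
  qed
  then have "\<one>\<^bsub>R\<lparr>carrier := A\<rparr>\<^esub> \<in> ?D"
  proof (rule A.one_in_idealI)
    fix m assume m: "primeideal m (R\<lparr>carrier := A\<rparr>)" and Dm: "?D \<subseteq> m"
    obtain w l where w: "w \<in> A" "l \<in> {\<one>, e}" "w \<otimes> l \<notin> m" and we: "w \<otimes> e \<in> A"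
      using denominator[OF A_primeD(1,2)[OF m], of "{\<one>, e}"] e by auto
    have wc: "w \<in> carrier R" using A_carrier w by blast
    have "(w \<otimes> e) \<otimes> e = w \<otimes> e" using wc e by (simp add: m_assoc)
    then have "w \<in> m" "w \<otimes> e \<in> m" using Dm w we by auto
    then show False using w wc by auto
  qed
  then show ?thesis using e by simp
qed

theorem idempotent_annihilators_restrict:
  assumes ia: "idempotent_annihilators R"
  shows "idempotent_annihilators (R\<lparr>carrier := A\<rparr>)"
  unfolding idempotent_annihilators_def
proof
  fix a assume "a \<in> carrier (R\<lparr>carrier := A\<rparr>)"
  then have a: "a \<in> A" by simp
  obtain e where e: "e \<in> carrier R" "e \<otimes> e = e" "e \<otimes> a = \<zero>"
    "\<forall>x \<in> carrier R. x \<otimes> a = \<zero> \<longrightarrow> x \<otimes> e = x"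
    using ia A_carrier[OF a] unfolding idempotent_annihilators_def by blast
  then have "\<exists>e \<in> A. e \<otimes> e = e \<and> e \<otimes> a = \<zero> \<and> (\<forall>x \<in> A. x \<otimes> a = \<zero> \<longrightarrow> x \<otimes> e = x)"
    using idempotent_mem A_carrier by blast
  then show "\<exists>e \<in> carrier (R\<lparr>carrier := A\<rparr>). e \<otimes>\<^bsub>R\<lparr>carrier := A\<rparr>\<^esub> e = e \<and>
      e \<otimes>\<^bsub>R\<lparr>carrier := A\<rparr>\<^esub> a = \<zero>\<^bsub>R\<lparr>carrier := A\<rparr>\<^esub> \<and>
      (\<forall>x \<in> carrier (R\<lparr>carrier := A\<rparr>). x \<otimes>\<^bsub>R\<lparr>carrier := A\<rparr>\<^esub> a = \<zero>\<^bsub>R\<lparr>carrier := A\<rparr>\<^esub> \<longrightarrow>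
        x \<otimes>\<^bsub>R\<lparr>carrier := A\<rparr>\<^esub> e = x)"
    by simp
qed

end

context Prufer_extension
begin

lemma genideal_restrict_subset:
  assumes "S \<subseteq> A"
  shows "Idl\<^bsub>R\<lparr>carrier := A\<rparr>\<^esub> S \<subseteq> Idl S"
proof
  fix x assume x: "x \<in> Idl\<^bsub>R\<lparr>carrier := A\<rparr>\<^esub> S"
  have S: "S \<subseteq> carrier R" using assms A_carrier by blast
  note I = genideal_ideal[OF S]
  have "S \<subseteq> carrier (R\<lparr>carrier := A\<rparr>)" using assms by simp
  with x show "x \<in> Idl S"
  proof (induction rule: A.genideal_induct)
    case zero then show ?case using idealD(2)[OF I] by simp
  next
    case (gen s) then show ?case using genideal_self[OF S] by blast
  next
    case (add x y) then show ?case using idealD(3)[OF I] by simp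
  next
    case (mult x t) then show ?case using idealD(5)[OF I] A_carrier by simp
  qed
qed

text \<open>
  At a prime ideal \<open>m\<close> of \<open>A\<close>, invertibility over \<open>R\<close> yields a multiplier \<open>c / r\<close> that takes the
  generators to elements \<open>d\<^sub>b\<close> of \<open>R\<close>, and one element of the ideal to a member of \<open>A - m\<close>.  A
  denominator \<open>w\<close> for \<open>1\<close> and all \<open>d\<^sub>b\<close> makes \<open>w c / r\<close> a multiplier over \<open>A\<close>.
\<close>

theorem regular_fg_invertible_restrict:
  assumes rf: "regular_fg_invertible R"
    and reg: "regular_elements (R\<lparr>carrier := A\<rparr>) \<subseteq> regular_elements R"
  shows "regular_fg_invertible (R\<lparr>carrier := A\<rparr>)"
  unfolding regular_fg_invertible_def
proof (intro allI impI, elim conjE)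
  fix S r
  assume S: "finite S" and "S \<subseteq> carrier (R\<lparr>carrier := A\<rparr>)"
    and rS: "r \<in> Idl\<^bsub>R\<lparr>carrier := A\<rparr>\<^esub> S" and r: "r \<in> regular_elements (R\<lparr>carrier := A\<rparr>)"
  then have SA: "S \<subseteq> A" by simp
  then have SR: "S \<subseteq> carrier R" using A_carrier by blast
  have rR: "r \<in> regular_elements R" using r reg by blast
  have rc: "r \<in> carrier R" by (rule regular_elementsD(1)[OF rR])
  let ?E = "inverse_products (R\<lparr>carrier := A\<rparr>) S r"
  have idE: "ideal (Idl\<^bsub>R\<lparr>carrier := A\<rparr>\<^esub> ?E) (R\<lparr>carrier := A\<rparr>)"
    by (rule A.genideal_ideal[OF A.inverse_products_carrier])
  show "\<one>\<^bsub>R\<lparr>carrier := A\<rparr>\<^esub> \<in> Idl\<^bsub>R\<lparr>carrier := A\<rparr>\<^esub> ?E"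
  proof (rule A.one_in_idealI[OF idE])
    fix m assume m: "primeideal m (R\<lparr>carrier := A\<rparr>)"
      and "Idl\<^bsub>R\<lparr>carrier := A\<rparr>\<^esub> ?E \<subseteq> m"
    then have Em: "?E \<subseteq> m" using A.genideal_self[OF A.inverse_products_carrier] by blast
    have "\<one> \<in> Idl (inverse_products R S r)"
      using rf S SR rR rS genideal_restrict_subset[OF SA] unfolding regular_fg_invertible_def by blast
    then obtain e0 v where e0: "e0 \<in> inverse_products R S r"
      and v: "v \<in> carrier R" "v \<otimes> e0 \<in> A" "v \<otimes> e0 \<notin> m"
      by (rule unit_ideal_local[OF m inverse_products_carrier])
    obtain a c0 where a: "a \<in> S" and c0: "c0 \<in> carrier R" "c0 \<otimes> a = r \<otimes> e0" "e0 \<in> carrier R"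
      and c0S: "\<forall>b \<in> S. \<exists>d \<in> carrier R. c0 \<otimes> b = r \<otimes> d"
      using e0 unfolding inverse_products_def by blast
    define c where "c = v \<otimes> c0"
    have c: "c \<in> carrier R" using v c0 by (simp add: c_def)
    have ca: "c \<otimes> a = r \<otimes> (v \<otimes> e0)"
    proof -
      have ac: "a \<in> carrier R" using a SR by blast
      have "c \<otimes> a = v \<otimes> (c0 \<otimes> a)" unfolding c_def using v(1) c0(1) ac by algebra
      also have "\<dots> = r \<otimes> (v \<otimes> e0)" unfolding c0(2) using v(1) c0(3) rc by algebra
      finally show ?thesis .
    qed
    have "\<forall>b \<in> S. \<exists>d. d \<in> carrier R \<and> c \<otimes> b = r \<otimes> d"
    proof
      fix b assume b: "b \<in> S"
      then obtain d where d: "d \<in> carrier R" "c0 \<otimes> b = r \<otimes> d" using c0S by blast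
      have bc: "b \<in> carrier R" using b SR by blast
      have "c \<otimes> b = v \<otimes> (c0 \<otimes> b)" unfolding c_def using v(1) c0(1) bc by algebra
      also have "\<dots> = r \<otimes> (v \<otimes> d)" unfolding d(2) using v(1) d(1) rc by algebra
      finally show "\<exists>d. d \<in> carrier R \<and> c \<otimes> b = r \<otimes> d" using v d by blast
    qed
    from bchoice[OF this] obtain d where d: "\<And>b. b \<in> S \<Longrightarrow> d b \<in> carrier R"
      and cd: "\<And>b. b \<in> S \<Longrightarrow> c \<otimes> b = r \<otimes> d b" by blast
    let ?F = "insert \<one> (d ` S)"
    have "finite ?F" "?F \<subseteq> carrier R" using S d by auto
    then obtain w l where w: "w \<in> A" and l: "l \<in> ?F" "w \<otimes> l \<notin> m" and wF: "\<forall>x \<in> ?F. w \<otimes> x \<in> A"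
      using denominator[OF A_primeD(1,2)[OF m], of ?F] by blast
    have wc: "w \<in> carrier R" using A_carrier[OF w] .
    have wcd: "(w \<otimes> c) \<otimes> b = r \<otimes> (w \<otimes> d b)" if b: "b \<in> S" for b
    proof -
      have bc: "b \<in> carrier R" using b SR by blast
      have "(w \<otimes> c) \<otimes> b = w \<otimes> (c \<otimes> b)" using wc c bc by algebra
      also have "\<dots> = r \<otimes> (w \<otimes> d b)" unfolding cd[OF b] using m_lcomm[OF wc rc d[OF b]] .
      finally show ?thesis .
    qed
    have "\<exists>y \<in> A. (w \<otimes> c) \<otimes> x = r \<otimes> y" if x: "x \<in> Idl\<^bsub>R\<lparr>carrier := A\<rparr>\<^esub> S" for x
    proof -
      have SA': "S \<subseteq> carrier (R\<lparr>carrier := A\<rparr>)" using SA by simp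
      show ?thesis
        using x SA'
      proof (induction rule: A.genideal_induct)
        case zero
        have "(w \<otimes> c) \<otimes> \<zero> = r \<otimes> \<zero>" using wc c rc by simp
        then show ?case using A_closed(1) by auto
      next
        case (gen s)
        then show ?case using wcd[of s] wF by blast
      next
        case (add x y)
        obtain x' y' where x': "x' \<in> A" "(w \<otimes> c) \<otimes> x = r \<otimes> x'" and y': "y' \<in> A" "(w \<otimes> c) \<otimes> y = r \<otimes> y'"
          using add(3,4) by blast
        have "(w \<otimes> c) \<otimes> (x \<oplus> y) = r \<otimes> (x' \<oplus> y')"
          using x' y' add(1,2) wc c rc A_carrier by (simp add: r_distr)
        then show ?case using A_closed(4)[OF x'(1) y'(1)] by auto
      next
        case (mult x t)
        obtain x' where x': "x' \<in> A" "(w \<otimes> c) \<otimes> x = r \<otimes> x'" using mult(3) by blast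
        have cc: "x \<in> carrier R" "t \<in> carrier R" "x' \<in> carrier R" using mult x' A_carrier by auto
        have "(w \<otimes> c) \<otimes> (t \<otimes> x) = t \<otimes> ((w \<otimes> c) \<otimes> x)" using cc wc c by algebra
        also have "\<dots> = r \<otimes> (t \<otimes> x')" unfolding x'(2) using cc rc by algebra
        finally show ?case using A_closed(3)[of t x'] mult(2) x'(1) by auto
      qed
    qed
    from this[OF rS] obtain y where y: "y \<in> A" "(w \<otimes> c) \<otimes> r = r \<otimes> y" by blast
    have "r \<otimes> (w \<otimes> c) = r \<otimes> y" using y wc c rc by (simp add: m_comm)
    then have "w \<otimes> c = y" using regular_elementsD(3)[OF rR] wc c A_carrier[OF y(1)] by simp
    then have wcA: "w \<otimes> c \<in> A" using y by simp
    have E: "x \<in> ?E" if "x \<in> A" "b \<in> S" "(w \<otimes> c) \<otimes> b = r \<otimes> x" for x b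
    proof -
      have "\<forall>b \<in> S. \<exists>d \<in> A. (w \<otimes> c) \<otimes> b = r \<otimes> d" using wcd wF by blast
      then show ?thesis
        unfolding inverse_products_def using that wcA by (simp) blast
    qed
    have "w \<otimes> d b \<in> m" if b: "b \<in> S" for b
      using E[OF _ b wcd[OF b]] wF b Em by blast
    then have "l = \<one>" using l by blast
    then have "w \<notin> m" using l wc by simp
    then have "w \<otimes> (v \<otimes> e0) \<notin> m" using A_primeD(3)[OF m w v(2)] v(3) by blast
    moreover have "w \<otimes> (v \<otimes> e0) \<in> ?E"
    proof (rule E[OF _ a])
      show "w \<otimes> (v \<otimes> e0) \<in> A" using w v by simp
      have ac: "a \<in> carrier R" using a SR by blast
      have "(w \<otimes> c) \<otimes> a = w \<otimes> (c \<otimes> a)" using wc c ac by algebra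
      also have "\<dots> = r \<otimes> (w \<otimes> (v \<otimes> e0))" unfolding ca using wc v(1) c0(3) rc by algebra
      finally show "(w \<otimes> c) \<otimes> a = r \<otimes> (w \<otimes> (v \<otimes> e0))" .
    qed
    ultimately show False using Em by blast
  qed
qed

text \<open>
  At a prime ideal \<open>m\<close> of \<open>A\<close>, all products of coefficients of \<open>f\<close> and \<open>g\<close> are controlled by one
  square: \<open>U\<^sup>2 f\<^sub>k g\<^sub>l = p\<^sup>2 F\<^sub>k G\<^sub>l\<close>, where a denominator has made \<open>F\<close> and \<open>G\<close> polynomials over \<open>A\<close>
  one of which has a coefficient outside \<open>m\<close>.  For them the content formula holds locally by the
  Dedekind-Mertens lemma, and it carries over to \<open>f\<close> and \<open>g\<close> since \<open>U\<close> becomes a local unit of \<open>A\<close>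
  after multiplication with \<open>l\<close>.
\<close>

theorem Gaussian_restrict:
  assumes sd: "\<And>q. primeideal q R \<Longrightarrow> square_dominated R q"
  shows "Gaussian_ring (R\<lparr>carrier := A\<rparr>)"
  unfolding A.Gaussian_ring_iff
proof (intro ballI allI)
  fix f g :: "nat \<Rightarrow> 'a" and i j :: nat
  assume fup: "f \<in> up (R\<lparr>carrier := A\<rparr>)" and gup: "g \<in> up (R\<lparr>carrier := A\<rparr>)"
  have fA: "f k \<in> A" and gA: "g k \<in> A" for k using fup gup by (auto simp: A.mem_up_iff)
  have fR: "f k \<in> carrier R" and gR: "g k \<in> carrier R" for k using fA gA A_carrier by auto
  obtain N1 N2 where "\<forall>m>N1. f m = \<zero>" "\<forall>m>N2. g m = \<zero>" using fup gup by (auto simp: A.mem_up_iff)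
  then obtain N where N: "\<And>k. k > N \<Longrightarrow> f k = \<zero>" "\<And>k. k > N \<Longrightarrow> g k = \<zero>"
    by (metis max_less_iff_conj)
  have convA: "convolution (R\<lparr>carrier := A\<rparr>) F G = convolution R F G"
    if "\<And>k. F k \<in> A" "\<And>k. G k \<in> A" for F G
    unfolding convolution_def by (rule ext, subst subring_finsum[OF subring]) (use that in auto)
  let ?C = "Idl\<^bsub>R\<lparr>carrier := A\<rparr>\<^esub> (range (convolution R f g))"
  have rangeA: "range (convolution R F G) \<subseteq> carrier (R\<lparr>carrier := A\<rparr>)"
    if "\<And>k. F k \<in> A" "\<And>k. G k \<in> A" for F G
    using A.range_convolution_subset[of F G] that convA by auto
  have C: "ideal ?C (R\<lparr>carrier := A\<rparr>)" by (rule A.genideal_ideal[OF rangeA]) (auto simp: fA gA)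
  let ?x = "f i \<otimes> g j"
  have xA: "?x \<in> A" using fA gA by simp
  let ?D = "{d \<in> A. d \<otimes> ?x \<in> ?C}"
  have D: "ideal ?D (R\<lparr>carrier := A\<rparr>)"
  proof (rule A.idealI_closed)
    show "?D \<subseteq> carrier (R\<lparr>carrier := A\<rparr>)" by auto
    show "\<zero>\<^bsub>R\<lparr>carrier := A\<rparr>\<^esub> \<in> ?D" using A.idealD(2)[OF C] fR gR by simp
    show "y \<oplus>\<^bsub>R\<lparr>carrier := A\<rparr>\<^esub> z \<in> ?D" if "y \<in> ?D" "z \<in> ?D" for y z
      using that A.idealD(3)[OF C, of "y \<otimes> ?x" "z \<otimes> ?x"] A_carrier fR gR by (simp add: l_distr)
    show "r \<otimes>\<^bsub>R\<lparr>carrier := A\<rparr>\<^esub> y \<in> ?D" if "y \<in> ?D" "r \<in> carrier (R\<lparr>carrier := A\<rparr>)" for y r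
      using that A.idealD(5)[OF C, of "y \<otimes> ?x" r] A_carrier fR gR by (simp add: m_assoc)
  qed
  have "\<one>\<^bsub>R\<lparr>carrier := A\<rparr>\<^esub> \<in> ?D"
  proof (rule A.one_in_idealI[OF D])
    fix m assume m: "primeideal m (R\<lparr>carrier := A\<rparr>)" and Dm: "?D \<subseteq> m"
    let ?S = "f ` {..N} \<union> g ` {..N}"
    have S: "finite ?S" "?S \<noteq> {}" "?S \<subseteq> carrier R" using fR gR by auto
    obtain p u y where p: "p \<in> ?S" and u: "u \<in> carrier R" "u \<notin> over_prime m"
      and y0: "y \<in> ?S \<rightarrow> carrier R" and yp: "y p = u"
      and eq: "\<And>s t. s \<in> ?S \<Longrightarrow> t \<in> ?S \<Longrightarrow> (u \<otimes> u) \<otimes> (s \<otimes> t) = (y s \<otimes> y t) \<otimes> (p \<otimes> p)"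
      by (rule square_dominatedD[OF sd[OF primeideal_over_prime[OF m]] S]) (rule that)
    have SA: "s \<in> A" "s \<in> carrier R" if "s \<in> ?S" for s using that fA gA A_carrier by auto
    have y: "y s \<in> carrier R" if "s \<in> ?S" for s using that y0 by blast
    obtain v where v: "v \<in> carrier R" "v \<otimes> u \<in> A" "v \<otimes> u \<notin> m" using not_over_prime[OF u] .
    let ?F = "insert \<one> ((\<lambda>s. v \<otimes> y s) ` ?S)"
    have "finite ?F" "?F \<subseteq> carrier R" using v y by auto
    then obtain w l where w: "w \<in> A" and l: "l \<in> ?F" "w \<otimes> l \<notin> m" and wF: "\<forall>x \<in> ?F. w \<otimes> x \<in> A"
      using denominator[OF A_primeD(1,2)[OF m], of ?F] by blast
    have wc: "w \<in> carrier R" using A_carrier[OF w] .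
    have lc: "l \<in> carrier R" using l v y by auto
    define U where "U = w \<otimes> (v \<otimes> u)"
    define Y where "Y = (\<lambda>s. w \<otimes> (v \<otimes> y s))"
    have Uc: "U \<in> carrier R" using wc u v by (simp add: U_def)
    have YA: "Y s \<in> A" if "s \<in> ?S" for s using that wF by (auto simp: Y_def)
    have Yc: "Y s \<in> carrier R" if "s \<in> ?S" for s using YA[OF that] A_carrier by blast
    have pA: "p \<in> A" and pc: "p \<in> carrier R" using SA[OF p] by auto
    have eqY: "(U \<otimes> U) \<otimes> (s \<otimes> t) = (p \<otimes> p) \<otimes> (Y s \<otimes> Y t)" if st: "s \<in> ?S" "t \<in> ?S" for s t
    proof -
      note c = SA(2)[OF st(1)] SA(2)[OF st(2)] y[OF st(1)] y[OF st(2)] wc v(1) u(1) pc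
      have "(U \<otimes> U) \<otimes> (s \<otimes> t) = ((w \<otimes> v) \<otimes> (w \<otimes> v)) \<otimes> ((u \<otimes> u) \<otimes> (s \<otimes> t))"
        unfolding U_def using c by algebra
      also have "\<dots> = (p \<otimes> p) \<otimes> (Y s \<otimes> Y t)" unfolding eq[OF st] Y_def using c by algebra
      finally show ?thesis .
    qed
    have "\<exists>s \<in> ?S. Y s \<notin> m"
    proof (cases "l = \<one>")
      case True
      then have "w \<notin> m" using l wc by simp
      then have "Y p \<notin> m" unfolding Y_def yp using A_primeD(3)[OF m w v(2)] v(3) by blast
      then show ?thesis using p by blast
    next
      case False
      then show ?thesis using l unfolding Y_def by blast
    qed
    then obtain k0 where k0: "k0 \<le> N" "Y (f k0) \<notin> m \<or> Y (g k0) \<notin> m" by auto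
    define F where "F = (\<lambda>k. if k \<le> N then Y (f k) else \<zero>)"
    define G where "G = (\<lambda>k. if k \<le> N then Y (g k) else \<zero>)"
    have FA: "F k \<in> A" and GA: "G k \<in> A" for k using YA by (auto simp: F_def G_def)
    have Fc: "F k \<in> carrier R" and Gc: "G k \<in> carrier R" for k using FA GA A_carrier by auto
    have FGup: "F \<in> up (R\<lparr>carrier := A\<rparr>)" "G \<in> up (R\<lparr>carrier := A\<rparr>)"
      using FA GA by (auto simp: A.mem_up_iff F_def G_def intro!: exI[of _ N])
    have rel: "(U \<otimes> U) \<otimes> (f k \<otimes> g h) = (p \<otimes> p) \<otimes> (F k \<otimes> G h)" for k h
    proof (cases "k \<le> N \<and> h \<le> N")
      case True
      then show ?thesis unfolding F_def G_def using eqY[of "f k" "g h"] by simp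
    next
      case False
      then have "f k = \<zero> \<and> F k = \<zero> \<or> g h = \<zero> \<and> G h = \<zero>"
        using N[of k] N[of h] by (auto simp: F_def G_def)
      then have "f k \<otimes> g h = \<zero>" "F k \<otimes> G h = \<zero>"
        using fR[of k] gR[of h] Fc[of k] Gc[of h] by auto
      then show ?thesis using Uc pc by simp
    qed
    have conv: "(U \<otimes> U) \<otimes> convolution R f g n = (p \<otimes> p) \<otimes> convolution R F G n" for n
    proof -
      have "(U \<otimes> U) \<otimes> convolution R f g n = (\<Oplus>k \<in> {..n}. (U \<otimes> U) \<otimes> (f k \<otimes> g (n - k)))"
        unfolding convolution_def by (rule finsum_rdistr) (use Uc fR gR in auto)
      also have "\<dots> = (\<Oplus>k \<in> {..n}. (p \<otimes> p) \<otimes> (F k \<otimes> G (n - k)))" by (simp only: rel)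
      also have "\<dots> = (p \<otimes> p) \<otimes> convolution R F G n"
        unfolding convolution_def by (rule finsum_rdistr[symmetric]) (use pc Fc Gc in auto)
      finally show ?thesis .
    qed
    let ?C' = "Idl\<^bsub>R\<lparr>carrier := A\<rparr>\<^esub> (range (convolution R F G))"
    have C': "ideal ?C' (R\<lparr>carrier := A\<rparr>)" by (rule A.genideal_ideal[OF rangeA]) (auto simp: FA GA)
    have gen: "range (convolution R F G) \<subseteq> ?C'"
      by (rule A.genideal_self[OF rangeA]) (auto simp: FA GA)
    have "\<exists>W \<in> A - m. W \<otimes> (F i \<otimes> G j) \<in> ?C'"
      using k0(2)
    proof
      assume nm: "Y (f k0) \<notin> m"
      have "\<exists>K::nat. \<forall>h. F k0 [^]\<^bsub>R\<lparr>carrier := A\<rparr>\<^esub> K \<otimes>\<^bsub>R\<lparr>carrier := A\<rparr>\<^esub> G h \<in> ?C'"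
      proof (rule A.coefficient_power_mult_mem[OF C', of _ _ "Suc N" "Suc N"])
        show "convolution (R\<lparr>carrier := A\<rparr>) F G n \<in> ?C'" for n using gen convA[of F G] FA GA by auto
      qed (use FA GA A.idealD(2)[OF C'] in \<open>auto simp: F_def G_def\<close>)
      then obtain K :: nat where K: "F k0 [^]\<^bsub>R\<lparr>carrier := A\<rparr>\<^esub> K \<otimes> G j \<in> ?C'" by auto
      let ?W = "F k0 [^]\<^bsub>R\<lparr>carrier := A\<rparr>\<^esub> K"
      have "F k0 = Y (f k0)" using k0 by (simp add: F_def)
      then have Wm: "?W \<notin> m" using A.primeideal_pow[OF m, of "F k0" K] FA[of k0] nm by simp
      have WA: "?W \<in> A" using A.nat_pow_closed[of "F k0" K] FA by simp
      have "F i \<otimes> (?W \<otimes> G j) \<in> ?C'" using A.idealD(5)[OF C' K, of "F i"] FA by simp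
      moreover have "?W \<otimes> (F i \<otimes> G j) = F i \<otimes> (?W \<otimes> G j)"
        using Fc Gc A_carrier[OF WA] by (simp add: m_lcomm)
      ultimately show ?thesis using Wm WA by (intro bexI[of _ ?W]) auto
    next
      assume nm: "Y (g k0) \<notin> m"
      have "\<exists>K::nat. \<forall>h. G k0 [^]\<^bsub>R\<lparr>carrier := A\<rparr>\<^esub> K \<otimes>\<^bsub>R\<lparr>carrier := A\<rparr>\<^esub> F h \<in> ?C'"
      proof (rule A.coefficient_power_mult_mem[OF C', of _ _ "Suc N" "Suc N"])
        show "convolution (R\<lparr>carrier := A\<rparr>) G F n \<in> ?C'" for n
          using gen convA[of F G] FA GA A.convolution_comm[OF FGup(2,1)] by auto
      qed (use FA GA A.idealD(2)[OF C'] in \<open>auto simp: F_def G_def\<close>)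
      then obtain K :: nat where K: "G k0 [^]\<^bsub>R\<lparr>carrier := A\<rparr>\<^esub> K \<otimes> F i \<in> ?C'" by auto
      let ?W = "G k0 [^]\<^bsub>R\<lparr>carrier := A\<rparr>\<^esub> K"
      have "G k0 = Y (g k0)" using k0 by (simp add: G_def)
      then have Wm: "?W \<notin> m" using A.primeideal_pow[OF m, of "G k0" K] GA[of k0] nm by simp
      have WA: "?W \<in> A" using A.nat_pow_closed[of "G k0" K] GA by simp
      have "G j \<otimes> (?W \<otimes> F i) \<in> ?C'" using A.idealD(5)[OF C' K, of "G j"] GA by simp
      moreover have "?W \<otimes> (F i \<otimes> G j) = G j \<otimes> (?W \<otimes> F i)"
        using Fc Gc A_carrier[OF WA] by (simp add: m_comm[of "F i"] m_lcomm)
      ultimately show ?thesis using Wm WA by (intro bexI[of _ ?W]) auto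
    qed
    then obtain W where W: "W \<in> A" "W \<notin> m" "W \<otimes> (F i \<otimes> G j) \<in> ?C'" by blast
    have Wc: "W \<in> carrier R" using A_carrier[OF W(1)] .
    have "\<exists>c \<in> ?C. (p \<otimes> p) \<otimes> x = (U \<otimes> U) \<otimes> c" if x: "x \<in> ?C'" for x
      using x rangeA[of F G, OF FA GA]
    proof (induction rule: A.genideal_induct)
      case zero
      have "(p \<otimes> p) \<otimes> \<zero> = (U \<otimes> U) \<otimes> \<zero>" using pc Uc by simp
      then show ?case using A.idealD(2)[OF C] by auto
    next
      case (gen s)
      then obtain n where "s = convolution R F G n" by blast
      then have "(p \<otimes> p) \<otimes> s = (U \<otimes> U) \<otimes> convolution R f g n" using conv by simp
      moreover have "convolution R f g n \<in> ?C"
        using A.genideal_self[OF rangeA[of f g, OF fA gA]] by blast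
      ultimately show ?case by blast
    next
      case (add x z)
      obtain c d where c: "c \<in> ?C" "(p \<otimes> p) \<otimes> x = (U \<otimes> U) \<otimes> c"
        and d: "d \<in> ?C" "(p \<otimes> p) \<otimes> z = (U \<otimes> U) \<otimes> d" using add(3,4) by blast
      have cc: "c \<in> carrier R" "d \<in> carrier R" "x \<in> carrier R" "z \<in> carrier R"
        using c d A.idealD(1)[OF C] add A_carrier by auto
      have "(p \<otimes> p) \<otimes> (x \<oplus> z) = (U \<otimes> U) \<otimes> (c \<oplus> d)"
        using c d cc pc Uc by (simp add: r_distr)
      then show ?case using A.idealD(3)[OF C c(1) d(1)] by auto
    next
      case (mult x t)
      obtain c where c: "c \<in> ?C" "(p \<otimes> p) \<otimes> x = (U \<otimes> U) \<otimes> c" using mult(3) by blast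
      have cc: "c \<in> carrier R" "x \<in> carrier R" "t \<in> carrier R"
        using c A.idealD(1)[OF C] mult A_carrier by auto
      have "(p \<otimes> p) \<otimes> (t \<otimes> x) = t \<otimes> ((p \<otimes> p) \<otimes> x)" using cc pc by algebra
      also have "\<dots> = (U \<otimes> U) \<otimes> (t \<otimes> c)" unfolding c(2) using cc Uc by algebra
      finally show ?case using A.idealD(5)[OF C c(1) mult(2)] by auto
    qed
    from this[OF W(3)] obtain c where c: "c \<in> ?C" "(p \<otimes> p) \<otimes> (W \<otimes> (F i \<otimes> G j)) = (U \<otimes> U) \<otimes> c"
      by blast
    have cc: "c \<in> carrier R" using c A.idealD(1)[OF C] A_carrier by auto
    have xc: "?x \<in> carrier R" "F i \<otimes> G j \<in> carrier R" using fR gR Fc Gc by auto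
    have Wx: "W \<otimes> ((U \<otimes> U) \<otimes> ?x) = (U \<otimes> U) \<otimes> c"
    proof -
      have "W \<otimes> ((U \<otimes> U) \<otimes> ?x) = W \<otimes> ((p \<otimes> p) \<otimes> (F i \<otimes> G j))" by (simp only: rel)
      also have "\<dots> = (p \<otimes> p) \<otimes> (W \<otimes> (F i \<otimes> G j))" using Wc pc xc by (simp add: m_lcomm)
      finally show ?thesis using c by simp
    qed
    define k where "k = (w \<otimes> l) \<otimes> (v \<otimes> u)"
    have wl: "w \<otimes> l \<in> A" using wF l by blast
    have kA: "k \<in> A" using wl v by (simp add: k_def)
    have km: "k \<notin> m" unfolding k_def by (rule A_primeD(3)[OF m wl v(2) l(2) v(3)])
    have kc: "k \<in> carrier R" using A_carrier[OF kA] .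
    have kU: "k = l \<otimes> U" unfolding k_def U_def using wc lc v(1) u(1) by algebra
    have "(W \<otimes> (k \<otimes> k)) \<otimes> ?x = (l \<otimes> l) \<otimes> (W \<otimes> ((U \<otimes> U) \<otimes> ?x))"
      unfolding kU using Wc Uc lc fR[of i] gR[of j] by (simp add: m_ac)
    also have "\<dots> = (k \<otimes> k) \<otimes> c" unfolding Wx kU using Uc lc cc by algebra
    finally have fin: "(W \<otimes> (k \<otimes> k)) \<otimes> ?x = (k \<otimes> k) \<otimes> c" .
    have "(k \<otimes> k) \<otimes> c \<in> ?C" using A.idealD(5)[OF C c(1), of "k \<otimes> k"] kA by simp
    then have "W \<otimes> (k \<otimes> k) \<in> ?D" using W(1) kA fin by simp
    then have "W \<otimes> (k \<otimes> k) \<in> m" using Dm by blast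
    moreover have "W \<otimes> (k \<otimes> k) \<notin> m" using A_primeD(3)[OF m] W kA km by simp
    ultimately show False by blast
  qed
  then have "?x \<in> ?C" using fR gR by simp
  then show "f i \<otimes>\<^bsub>R\<lparr>carrier := A\<rparr>\<^esub> g j \<in>
      Idl\<^bsub>R\<lparr>carrier := A\<rparr>\<^esub> (range (convolution (R\<lparr>carrier := A\<rparr>) f g))"
    using convA[of f g] fA gA by simp
qed

end

section \<open>Semihereditary rings in terms of elements\<close>

text \<open>
  A copy of the module \<open>I\<^sup>n\<close> whose elements have the same type for all \<open>n\<close>.
\<close>

definition list_module :: "('a, 'm) ring_scheme \<Rightarrow> 'a set \<Rightarrow> nat \<Rightarrow> ('a, 'a list) module" where
  "list_module R I n =
     \<lparr> carrier = {u. length u = n \<and> set u \<subseteq> I}, monoid.mult = (\<lambda>u v. u), one = [],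
       ring.zero = replicate n \<zero>\<^bsub>R\<^esub>, add = (\<lambda>u v. map2 (\<oplus>\<^bsub>R\<^esub>) u v),
       smult = (\<lambda>r u. map ((\<otimes>\<^bsub>R\<^esub>) r) u) \<rparr>"

lemma list_module_simps [simp]:
  "u \<in> carrier (list_module R I n) \<longleftrightarrow> length u = n \<and> set u \<subseteq> I"
  "\<zero>\<^bsub>list_module R I n\<^esub> = replicate n \<zero>\<^bsub>R\<^esub>"
  "u \<oplus>\<^bsub>list_module R I n\<^esub> v = map2 (\<oplus>\<^bsub>R\<^esub>) u v"
  "r \<odot>\<^bsub>list_module R I n\<^esub> u = map ((\<otimes>\<^bsub>R\<^esub>) r) u"
  by (auto simp: list_module_def)

lemma ideal_module_simps [simp]:
  "carrier (ideal_module R I) = I"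
  "\<zero>\<^bsub>ideal_module R I\<^esub> = \<zero>\<^bsub>R\<^esub>"
  "x \<oplus>\<^bsub>ideal_module R I\<^esub> y = x \<oplus>\<^bsub>R\<^esub> y"
  "r \<odot>\<^bsub>ideal_module R I\<^esub> x = r \<otimes>\<^bsub>R\<^esub> x"
  by (auto simp: ideal_module_def scalar_module_def)

lemma module_homD:
  assumes "f \<in> module_hom R M N"
  shows "x \<in> carrier M \<Longrightarrow> f x \<in> carrier N"
    and "x \<in> carrier M \<Longrightarrow> y \<in> carrier M \<Longrightarrow> f (x \<oplus>\<^bsub>M\<^esub> y) = f x \<oplus>\<^bsub>N\<^esub> f y"
    and "r \<in> carrier R \<Longrightarrow> x \<in> carrier M \<Longrightarrow> f (r \<odot>\<^bsub>M\<^esub> x) = r \<odot>\<^bsub>N\<^esub> f x"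
  using assms by (auto simp: module_hom_def)

lemma module_homI:
  assumes "\<And>x. x \<in> carrier M \<Longrightarrow> f x \<in> carrier N"
    and "\<And>x y. x \<in> carrier M \<Longrightarrow> y \<in> carrier M \<Longrightarrow> f (x \<oplus>\<^bsub>M\<^esub> y) = f x \<oplus>\<^bsub>N\<^esub> f y"
    and "\<And>r x. r \<in> carrier R \<Longrightarrow> x \<in> carrier M \<Longrightarrow> f (r \<odot>\<^bsub>M\<^esub> x) = r \<odot>\<^bsub>N\<^esub> f x"
  shows "f \<in> module_hom R M N"
  using assms by (auto simp: module_hom_def)

context cring
begin

lemma module_list_module:
  assumes I: "ideal I R" shows "module R (list_module R I n)"
proof -
  note Id = idealD[OF I]
  have nth: "u ! i \<in> I" "u ! i \<in> carrier R" if "length u = n" "set u \<subseteq> I" "i < n" for u i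
  proof -
    show "u ! i \<in> I" using that nth_mem[of i u] by blast
    then show "u ! i \<in> carrier R" using Id(1) by blast
  qed
  have neg: "\<ominus> x \<in> I" if "x \<in> I" for x
    using Id(4)[OF Id(2) that] Id(1) that by (auto simp: a_minus_def)
  have add: "set (map2 (\<oplus>) u v) \<subseteq> I" if "set u \<subseteq> I" "set v \<subseteq> I" for u v
    using that Id(3) by (force simp: set_zip dest: in_set_zipE)
  show ?thesis
  proof (rule moduleI)
    show "cring R" by (rule is_cring)
    show "abelian_group (list_module R I n)"
    proof (rule abelian_groupI, simp_all only: list_module_simps)
      fix u v w
      assume u: "length u = n \<and> set u \<subseteq> I" and v: "length v = n \<and> set v \<subseteq> I"
        and w: "length w = n \<and> set w \<subseteq> I"
      show "length (map2 (\<oplus>) u v) = n \<and> set (map2 (\<oplus>) u v) \<subseteq> I" using u v add by simp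
      show "map2 (\<oplus>) (map2 (\<oplus>) u v) w = map2 (\<oplus>) u (map2 (\<oplus>) v w)"
        by (rule nth_equalityI) (use u v w nth in \<open>simp_all add: a_assoc\<close>)
      show "map2 (\<oplus>) u v = map2 (\<oplus>) v u"
        by (rule nth_equalityI) (use u v nth in \<open>simp_all add: a_comm\<close>)
      show "map2 (\<oplus>) (replicate n \<zero>) u = u"
        by (rule nth_equalityI) (use u nth in \<open>simp_all\<close>)
      have "map2 (\<oplus>) (map (\<lambda>x. \<ominus> x) u) u = replicate n \<zero>"
        by (rule nth_equalityI) (use u nth in \<open>simp_all add: l_neg\<close>)
      moreover have "length (map (\<lambda>x. \<ominus> x) u) = n \<and> set (map (\<lambda>x. \<ominus> x) u) \<subseteq> I"
        using u neg by auto
      ultimately show "\<exists>v\<in>carrier (list_module R I n). map2 (\<oplus>) v u = replicate n \<zero>"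
        by (intro bexI[of _ "map (\<lambda>x. \<ominus> x) u"]) auto
    next
      show "length (replicate n \<zero>) = n \<and> set (replicate n \<zero>) \<subseteq> I" using Id(2) by auto
    qed
  next
    fix r s u v assume r: "r \<in> carrier R" and s: "s \<in> carrier R"
      and "u \<in> carrier (list_module R I n)" "v \<in> carrier (list_module R I n)"
    then have u: "length u = n" "set u \<subseteq> I" and v: "length v = n" "set v \<subseteq> I" by auto
    show "r \<odot>\<^bsub>list_module R I n\<^esub> u \<in> carrier (list_module R I n)"
      using u r Id(5) by auto
    show "(r \<oplus> s) \<odot>\<^bsub>list_module R I n\<^esub> u =
        r \<odot>\<^bsub>list_module R I n\<^esub> u \<oplus>\<^bsub>list_module R I n\<^esub> s \<odot>\<^bsub>list_module R I n\<^esub> u"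
      by (rule nth_equalityI) (use u r s nth in \<open>simp_all add: l_distr\<close>)
    show "r \<odot>\<^bsub>list_module R I n\<^esub> (u \<oplus>\<^bsub>list_module R I n\<^esub> v) =
        r \<odot>\<^bsub>list_module R I n\<^esub> u \<oplus>\<^bsub>list_module R I n\<^esub> r \<odot>\<^bsub>list_module R I n\<^esub> v"
      by (rule nth_equalityI) (use u v r nth in \<open>simp_all add: r_distr\<close>)
    show "(r \<otimes> s) \<odot>\<^bsub>list_module R I n\<^esub> u = r \<odot>\<^bsub>list_module R I n\<^esub> (s \<odot>\<^bsub>list_module R I n\<^esub> u)"
      by (rule nth_equalityI) (use u r s nth in \<open>simp_all add: m_assoc\<close>)
  next
    show "\<one> \<odot>\<^bsub>list_module R I n\<^esub> u = u" if u: "u \<in> carrier (list_module R I n)" for u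
      by (rule nth_equalityI) (use u nth in \<open>simp_all\<close>)
  qed
qed

lemma module_ideal_module:
  assumes I: "ideal I R" shows "module R (ideal_module R I)"
proof -
  note Id = idealD[OF I]
  have c: "x \<in> carrier R" if "x \<in> I" for x using that Id(1) by blast
  have neg: "\<ominus> x \<in> I" if "x \<in> I" for x
    using Id(4)[OF Id(2) that] c[OF that] by (auto simp: a_minus_def)
  show ?thesis
  proof (rule moduleI)
    show "cring R" by (rule is_cring)
    show "abelian_group (ideal_module R I)"
    proof (rule abelian_groupI, simp_all only: ideal_module_simps)
      fix x y w assume x: "x \<in> I" and y: "y \<in> I" and w: "w \<in> I"
      show "x \<oplus> y \<in> I" by (rule Id(3)[OF x y])
      show "x \<oplus> y \<oplus> w = x \<oplus> (y \<oplus> w)" using x y w c by (simp add: a_assoc)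
      show "x \<oplus> y = y \<oplus> x" using x y c by (simp add: a_comm)
      show "\<zero> \<oplus> x = x" using x c by simp
      show "\<exists>v\<in>I. v \<oplus> x = \<zero>" using neg[OF x] l_neg[OF c[OF x]] by blast
    qed (rule Id(2))
  qed (use c Id in \<open>auto simp: l_distr r_distr m_assoc\<close>)
qed

text \<open>
  The surjection from \<open>R\<^sup>2\<close> onto the projective module \<open>(a, b)\<close> splits.  Its target is represented by
  singleton lists, so that both modules have elements of the same type.
\<close>

lemma projective_pair_section:
  assumes sh: "semihereditary_ring TYPE('a list) R" and ab: "a \<in> carrier R" "b \<in> carrier R"
  obtains k where "k \<in> module_hom R (ideal_module R (Idl {a, b})) (list_module R (carrier R) 2)"
    "\<And>x. x \<in> Idl {a, b} \<Longrightarrow> (k x ! 0) \<otimes> a \<oplus> (k x ! 1) \<otimes> b = x"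
proof -
  let ?I = "Idl {a, b}"
  have S: "{a, b} \<subseteq> carrier R" using ab by auto
  have I: "ideal ?I R" by (rule genideal_ideal[OF S])
  note Id = idealD[OF I]
  have aI: "a \<in> ?I" and bI: "b \<in> ?I" using genideal_self[OF S] by auto
  let ?M = "ideal_module R ?I" and ?N = "list_module R (carrier R) 2" and ?N' = "list_module R ?I 1"
  have "fg_ideal ?I R" unfolding fg_ideal_def by (rule exI[of _ "{a, b}"]) (use S in simp)
  then have proj: "projective_module TYPE('a list) R ?M"
    using sh unfolding semihereditary_ring_def by blast
  define g where "g = (\<lambda>u. [(u ! 0) \<otimes> a \<oplus> (u ! 1) \<otimes> b])"
  have N: "module R ?N" and N': "module R ?N'" using module_list_module oneideal I by auto
  have two: "\<exists>x y. u = [x, y]" if "length u = 2" for u :: "'a list"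
    using that by (auto simp: numeral_2_eq_2 length_Suc_conv)
  have g: "g \<in> module_hom R ?N ?N'"
  proof (rule module_homI)
    fix u assume "u \<in> carrier ?N"
    then obtain x y where u: "u = [x, y]" "x \<in> carrier R" "y \<in> carrier R" using two[of u] by auto
    show "g u \<in> carrier ?N'" using u Id(3,5) aI bI by (auto simp: g_def)
    show "g (r \<odot>\<^bsub>?N\<^esub> u) = r \<odot>\<^bsub>?N'\<^esub> g u" if "r \<in> carrier R" for r
      using u that ab by (simp add: g_def m_assoc r_distr)
    fix v assume "v \<in> carrier ?N"
    then obtain z w where v: "v = [z, w]" "z \<in> carrier R" "w \<in> carrier R" using two[of v] by auto
    have "(x \<oplus> z) \<otimes> a \<oplus> (y \<oplus> w) \<otimes> b = (x \<otimes> a \<oplus> y \<otimes> b) \<oplus> (z \<otimes> a \<oplus> w \<otimes> b)"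
      using u(2,3) v(2,3) ab by algebra
    then show "g (u \<oplus>\<^bsub>?N\<^esub> v) = g u \<oplus>\<^bsub>?N'\<^esub> g v" using u v by (simp add: g_def)
  qed
  have surj: "g ` carrier ?N = carrier ?N'"
  proof
    show "g ` carrier ?N \<subseteq> carrier ?N'" using module_homD(1)[OF g] by blast
    show "carrier ?N' \<subseteq> g ` carrier ?N"
    proof
      fix u assume "u \<in> carrier ?N'"
      then obtain x where x: "u = [x]" "x \<in> ?I" by (auto simp: length_Suc_conv)
      have "{a, b} = {a, b, b}" by auto
      then obtain \<alpha> \<beta> \<gamma> where c: "\<alpha> \<in> carrier R" "\<beta> \<in> carrier R" "\<gamma> \<in> carrier R"
        "x = \<alpha> \<otimes> a \<oplus> \<beta> \<otimes> b \<oplus> \<gamma> \<otimes> b"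
        using genideal_triple[of x a b b] x(2) ab by metis
      have "x = \<alpha> \<otimes> a \<oplus> (\<beta> \<oplus> \<gamma>) \<otimes> b" unfolding c(4) using c(1-3) ab by algebra
      then have "u = g [\<alpha>, \<beta> \<oplus> \<gamma>]" using x by (simp add: g_def)
      moreover have "[\<alpha>, \<beta> \<oplus> \<gamma>] \<in> carrier ?N" using c by simp
      ultimately show "u \<in> g ` carrier ?N" by blast
    qed
  qed
  have h: "(\<lambda>x. [x]) \<in> module_hom R ?M ?N'"
    by (rule module_homI) auto
  have "\<exists>k \<in> module_hom R ?M ?N. \<forall>x \<in> carrier ?M. g (k x) = [x]"
    using proj N N' g surj h unfolding projective_module_def by blast
  then show thesis using that by (auto simp: g_def)
qed

text \<open>
  Let \<open>k\<close> be a section of \<open>R\<^sup>2 \<rightarrow> (a, b)\<close>.  Comparing the second coordinates in \<open>b k(a) = a k(b)\<close> gives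
  one of the two divisibilities, and \<open>k(b)\<^sub>0 a + k(b)\<^sub>1 b = b\<close> gives the other one.
\<close>

lemma semihereditary_imp_comaximal_quotients:
  assumes "semihereditary_ring TYPE('a list) R"
  shows "comaximal_quotients R"
proof (rule comaximal_quotientsI)
  fix a b assume ab: "a \<in> carrier R" "b \<in> carrier R"
  obtain k where k: "k \<in> module_hom R (ideal_module R (Idl {a, b})) (list_module R (carrier R) 2)"
    and sec: "\<And>x. x \<in> Idl {a, b} \<Longrightarrow> (k x ! 0) \<otimes> a \<oplus> (k x ! 1) \<otimes> b = x"
    by (rule projective_pair_section[OF assms ab]) (rule that)
  have "{a, b} \<subseteq> Idl {a, b}" by (rule genideal_self) (use ab in auto)
  then have aI: "a \<in> Idl {a, b}" and bI: "b \<in> Idl {a, b}" by auto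
  have len: "length (k x) = 2 \<and> set (k x) \<subseteq> carrier R" if "x \<in> Idl {a, b}" for x
    using module_homD(1)[OF k] that by simp
  have kc: "k x ! 0 \<in> carrier R" "k x ! 1 \<in> carrier R" if "x \<in> Idl {a, b}" for x
    using len[OF that] nth_mem[of 0 "k x"] nth_mem[of 1 "k x"] by auto
  have "map ((\<otimes>) b) (k a) = map ((\<otimes>) a) (k b)"
    using module_homD(3)[OF k ab(2), of a] module_homD(3)[OF k ab(1), of b] aI bI m_comm[OF ab] by simp
  then have "map ((\<otimes>) b) (k a) ! 1 = map ((\<otimes>) a) (k b) ! 1" by simp
  then have "b \<otimes> (k a ! 1) = a \<otimes> (k b ! 1)" using len[OF aI] len[OF bI] by simp
  then have 1: "(k b ! 1) \<otimes> a = (k a ! 1) \<otimes> b" using kc aI bI ab by (simp add: m_comm)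
  define p q where "p = k b ! 0" and "q = k b ! 1"
  have pq: "p \<in> carrier R" "q \<in> carrier R" using kc bI by (auto simp: p_def q_def)
  have "(\<one> \<ominus> q) \<otimes> b = b \<ominus> q \<otimes> b" using pq ab by algebra
  also have "\<dots> = (p \<otimes> a \<oplus> q \<otimes> b) \<ominus> q \<otimes> b" using sec[OF bI] by (simp add: p_def q_def)
  also have "\<dots> = p \<otimes> a" using pq ab by algebra
  finally show "\<exists>u \<in> carrier R. \<exists>v \<in> carrier R. \<exists>w \<in> carrier R. u \<otimes> a = v \<otimes> b \<and> (\<one> \<ominus> u) \<otimes> b = w \<otimes> a"
    using 1 kc aI pq unfolding q_def[symmetric] by blast
qed

text \<open>
  A section of \<open>R\<^sup>2 \<rightarrow> (a, 0)\<close> takes \<open>a\<close> to some \<open>f\<close> in the first coordinate with \<open>f a = a\<close>, and linearity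
  makes everything that kills \<open>a\<close> kill \<open>f\<close>; so \<open>1 - f\<close> is the required idempotent.
\<close>

lemma semihereditary_imp_idempotent_annihilators:
  assumes "semihereditary_ring TYPE('a list) R"
  shows "idempotent_annihilators R"
  unfolding idempotent_annihilators_def
proof
  fix a assume a: "a \<in> carrier R"
  obtain k where k: "k \<in> module_hom R (ideal_module R (Idl {a, \<zero>})) (list_module R (carrier R) 2)"
    and sec: "\<And>x. x \<in> Idl {a, \<zero>} \<Longrightarrow> (k x ! 0) \<otimes> a \<oplus> (k x ! 1) \<otimes> \<zero> = x"
    by (rule projective_pair_section[OF assms a zero_closed]) (rule that)
  have "{a, \<zero>} \<subseteq> Idl {a, \<zero>}" by (rule genideal_self) (use a in auto)
  then have aI: "a \<in> Idl {a, \<zero>}" and zI: "\<zero> \<in> Idl {a, \<zero>}" by auto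
  have len: "length (k x) = 2 \<and> set (k x) \<subseteq> carrier R" if "x \<in> Idl {a, \<zero>}" for x
    using module_homD(1)[OF k] that by simp
  have kc: "k x ! 0 \<in> carrier R" "k x ! 1 \<in> carrier R" if "x \<in> Idl {a, \<zero>}" for x
    using len[OF that] nth_mem[of 0 "k x"] nth_mem[of 1 "k x"] by auto
  define f where "f = k a ! 0"
  have f: "f \<in> carrier R" using kc aI by (simp add: f_def)
  have fa: "f \<otimes> a = a" using sec[OF aI] kc[OF aI] a by (simp add: f_def)
  have scale: "k (x \<otimes> y) ! 0 = x \<otimes> (k y ! 0)" if "x \<in> carrier R" "y \<in> Idl {a, \<zero>}" for x y
    using module_homD(3)[OF k that(1), of y] that len[OF that(2)] by simp
  have k0: "k \<zero> ! 0 = \<zero>" using scale[of \<zero> \<zero>] zI kc by simp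
  have ann: "x \<otimes> f = \<zero>" if "x \<in> carrier R" "x \<otimes> a = \<zero>" for x
    using scale[OF that(1) aI] that(2) k0 by (simp add: f_def)
  let ?e = "\<one> \<ominus> f"
  have "?e \<otimes> a = a \<ominus> f \<otimes> a" using f a by algebra
  then have ea: "?e \<otimes> a = \<zero>" using fa a by simp
  have stable: "x \<otimes> ?e = x" if x: "x \<in> carrier R" "x \<otimes> a = \<zero>" for x
  proof -
    have "x \<otimes> ?e = x \<ominus> x \<otimes> f" using x(1) f by algebra
    then show ?thesis using ann[OF x] x by (simp add: a_minus_def)
  qed
  show "\<exists>e \<in> carrier R. e \<otimes> e = e \<and> e \<otimes> a = \<zero> \<and> (\<forall>x \<in> carrier R. x \<otimes> a = \<zero> \<longrightarrow> x \<otimes> e = x)"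
    using ea stable[of ?e] stable f by (intro bexI[of _ ?e]) auto
qed

text \<open>
  The scalars \<open>r\<close> for which \<open>r h\<close> lifts form an ideal.  At a prime ideal one generator \<open>i\<close> divides
  \<open>u\<close> times the others, so \<open>u x = \<phi>(x) i\<close>; the annihilator of \<open>i\<close> is generated by an idempotent
  \<open>e\<close>, and \<open>\<phi>(x)\<close> becomes unique, hence linear in \<open>x\<close>, when chosen in \<open>(1 - e) R\<close>.  Then
  \<open>x \<mapsto> \<phi>(x) n\<close> with \<open>g n = h i\<close> lifts \<open>u h\<close>.
\<close>

theorem semihereditaryI:
  assumes cq: "comaximal_quotients R" and ia: "idempotent_annihilators R"
  shows "semihereditary_ring TYPE('n) R"
  unfolding semihereditary_ring_def
proof (intro allI impI)
  fix I assume "fg_ideal I R"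
  then obtain S0 where S0: "finite S0" "S0 \<subseteq> carrier R" "I = Idl S0" unfolding fg_ideal_def by blast
  have I: "ideal I R" unfolding S0(3) by (rule genideal_ideal[OF S0(2)])
  note Id = idealD[OF I]
  have Ic: "x \<in> carrier R" if "x \<in> I" for x using that Id(1) by blast
  let ?M = "ideal_module R I"
  show "projective_module TYPE('n) R ?M"
    unfolding projective_module_def
  proof (intro conjI allI impI, rule module_ideal_module[OF I], elim conjE)
    fix N N' :: "('a, 'n) module" and g h
    assume N: "module R N" and N': "module R N'" and g: "g \<in> module_hom R N N'"
      and surj: "g ` carrier N = carrier N'" and h: "h \<in> module_hom R ?M N'"
    interpret N: module R N by fact
    interpret N': module R N' by fact
    let ?lift = "\<lambda>r k. k \<in> module_hom R ?M N \<and> (\<forall>x \<in> I. g (k x) = h (r \<otimes> x))"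
    let ?D = "{r \<in> carrier R. \<exists>k. ?lift r k}"
    have h0: "h \<zero> = \<zero>\<^bsub>N'\<^esub>"
      using module_homD(3)[OF h zero_closed, of \<zero>] module_homD(1)[OF h, of \<zero>] Id(2)
        N'.smult_l_null by simp
    have g0: "g \<zero>\<^bsub>N\<^esub> = \<zero>\<^bsub>N'\<^esub>"
      using module_homD(3)[OF g zero_closed, of "\<zero>\<^bsub>N\<^esub>"] module_homD(1)[OF g, of "\<zero>\<^bsub>N\<^esub>"]
        N'.smult_l_null N.smult_l_null by simp
    have D: "ideal ?D R"
    proof (rule idealI_closed)
      show "?D \<subseteq> carrier R" by auto
      have "?lift \<zero> (\<lambda>x. \<zero>\<^bsub>N\<^esub>)" using g0 h0 Ic by (auto intro!: module_homI)
      then show "\<zero> \<in> ?D" by blast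
      show "r \<oplus> s \<in> ?D" if "r \<in> ?D" "s \<in> ?D" for r s
      proof -
        from that obtain k l where r: "r \<in> carrier R" "?lift r k" and s: "s \<in> carrier R" "?lift s l"
          by blast
        have k: "k \<in> module_hom R ?M N" and l: "l \<in> module_hom R ?M N" using r s by auto
        have "(\<lambda>x. k x \<oplus>\<^bsub>N\<^esub> l x) \<in> module_hom R ?M N"
          using module_homD[OF k] module_homD[OF l]
          by (auto intro!: module_homI simp: N.smult_r_distr N.M.a_ac)
        moreover have "g (k x \<oplus>\<^bsub>N\<^esub> l x) = h ((r \<oplus> s) \<otimes> x)" if x: "x \<in> I" for x
        proof -
          have "h ((r \<oplus> s) \<otimes> x) = h (r \<otimes> x \<oplus> s \<otimes> x)" using r s Ic[OF x] by (simp add: l_distr)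
          also have "\<dots> = h (r \<otimes> x) \<oplus>\<^bsub>N'\<^esub> h (s \<otimes> x)"
            using module_homD(2)[OF h, of "r \<otimes> x" "s \<otimes> x"] Id(5) x r s by simp
          also have "\<dots> = g (k x) \<oplus>\<^bsub>N'\<^esub> g (l x)" using r s x by simp
          also have "\<dots> = g (k x \<oplus>\<^bsub>N\<^esub> l x)"
            using module_homD(2)[OF g, of "k x" "l x"] module_homD(1)[OF k] module_homD(1)[OF l] x by simp
          finally show ?thesis by simp
        qed
        ultimately have "?lift (r \<oplus> s) (\<lambda>x. k x \<oplus>\<^bsub>N\<^esub> l x)" by blast
        then show ?thesis using r s by blast
      qed
      show "t \<otimes> r \<in> ?D" if "r \<in> ?D" and t: "t \<in> carrier R" for r t
      proof -
        from that obtain k where r: "r \<in> carrier R" "?lift r k" by blast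
        have k: "k \<in> module_hom R ?M N" using r by auto
        have "(\<lambda>x. t \<odot>\<^bsub>N\<^esub> k x) \<in> module_hom R ?M N"
          using module_homD[OF k] t
          by (auto intro!: module_homI simp: N.smult_r_distr N.smult_assoc1[symmetric] m_comm)
        moreover have "g (t \<odot>\<^bsub>N\<^esub> k x) = h ((t \<otimes> r) \<otimes> x)" if x: "x \<in> I" for x
        proof -
          have "g (t \<odot>\<^bsub>N\<^esub> k x) = t \<odot>\<^bsub>N'\<^esub> h (r \<otimes> x)"
            using module_homD(3)[OF g t, of "k x"] module_homD(1)[OF k, of x] x r by simp
          also have "\<dots> = h (t \<otimes> (r \<otimes> x))"
            using module_homD(3)[OF h t, of "r \<otimes> x"] Id(5)[OF x r(1)] by simp
          finally show ?thesis using t r Ic[OF x] by (simp add: m_assoc)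
        qed
        ultimately have "?lift (t \<otimes> r) (\<lambda>x. t \<odot>\<^bsub>N\<^esub> k x)" by blast
        then show ?thesis using r t by blast
      qed
    qed
    have "\<one> \<in> ?D"
    proof (rule one_in_idealI[OF D])
      fix P assume P: "primeideal P R" and DP: "?D \<subseteq> P"
      have "finite (insert \<zero> S0)" "insert \<zero> S0 \<noteq> {}" "insert \<zero> S0 \<subseteq> carrier R" using S0 by auto
      then obtain i u y where i: "i \<in> insert \<zero> S0" and u: "u \<in> carrier R" "u \<notin> P"
        and y: "y \<in> insert \<zero> S0 \<rightarrow> carrier R" "\<And>s. s \<in> insert \<zero> S0 \<Longrightarrow> u \<otimes> s = y s \<otimes> i"
        using comaximal_quotients_local[OF cq P, of "insert \<zero> S0"] by blast
      have iI: "i \<in> I" using i Id(2) genideal_self[OF S0(2)] S0(3) by auto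
      have ic: "i \<in> carrier R" using Ic[OF iI] .
      have "\<exists>z. z \<in> carrier R \<and> u \<otimes> x = z \<otimes> i" if x: "x \<in> I" for x
        using x[unfolded S0(3)] S0(2)
      proof (induction rule: genideal_induct)
        case zero
        have "u \<otimes> \<zero> = \<zero> \<otimes> i" using u ic by simp
        then show ?case by blast
      next
        case (gen s) then show ?case using y by blast
      next
        case (add x x')
        then obtain z z' where z: "z \<in> carrier R" "u \<otimes> x = z \<otimes> i" "z' \<in> carrier R" "u \<otimes> x' = z' \<otimes> i"
          by blast
        have "u \<otimes> (x \<oplus> x') = (z \<oplus> z') \<otimes> i" using z u ic add by (simp add: r_distr l_distr)
        then show ?case using z by blast
      next
        case (mult x r)
        then obtain z where z: "z \<in> carrier R" "u \<otimes> x = z \<otimes> i" by blast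
        have "u \<otimes> (r \<otimes> x) = r \<otimes> (u \<otimes> x)" using u(1) mult(1,2) by algebra
        also have "\<dots> = (r \<otimes> z) \<otimes> i" unfolding z(2) using z(1) ic mult(2) by algebra
        finally show ?case using z mult by blast
      qed
      then have "\<forall>x \<in> I. \<exists>z. z \<in> carrier R \<and> u \<otimes> x = z \<otimes> i" by blast
      from bchoice[OF this] obtain z where zc: "\<And>x. x \<in> I \<Longrightarrow> z x \<in> carrier R"
        and z: "\<And>x. x \<in> I \<Longrightarrow> u \<otimes> x = z x \<otimes> i" by blast
      obtain e where e: "e \<in> carrier R" "e \<otimes> i = \<zero>"
        "\<And>x. x \<in> carrier R \<Longrightarrow> x \<otimes> i = \<zero> \<Longrightarrow> x \<otimes> e = x"
        using ia ic unfolding idempotent_annihilators_def by blast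
      have unique: "(\<one> \<ominus> e) \<otimes> p = (\<one> \<ominus> e) \<otimes> q"
        if pq: "p \<in> carrier R" "q \<in> carrier R" "p \<otimes> i = q \<otimes> i" for p q
      proof -
        have "(p \<ominus> q) \<otimes> i = p \<otimes> i \<ominus> q \<otimes> i" using pq(1,2) ic by algebra
        then have "(p \<ominus> q) \<otimes> i = \<zero>" using pq ic by simp
        then have pe: "(p \<ominus> q) \<otimes> e = p \<ominus> q" using e(3) pq by simp
        have "(\<one> \<ominus> e) \<otimes> p \<ominus> (\<one> \<ominus> e) \<otimes> q = (p \<ominus> q) \<ominus> (p \<ominus> q) \<otimes> e" using pq(1,2) e(1) by algebra
        then have "(\<one> \<ominus> e) \<otimes> p \<ominus> (\<one> \<ominus> e) \<otimes> q = \<zero>" using pe pq e by simp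
        then show ?thesis using pq e by simp
      qed
      define \<phi> where "\<phi> = (\<lambda>x. (\<one> \<ominus> e) \<otimes> z x)"
      have \<phi>c: "\<phi> x \<in> carrier R" if "x \<in> I" for x using zc[OF that] e by (simp add: \<phi>_def)
      have \<phi>i: "\<phi> x \<otimes> i = u \<otimes> x" if x: "x \<in> I" for x
      proof -
        have "\<phi> x \<otimes> i = z x \<otimes> i \<ominus> z x \<otimes> (e \<otimes> i)" unfolding \<phi>_def using zc[OF x] e(1) ic by algebra
        then show ?thesis using e(2) z[OF x] zc[OF x] ic by (simp add: a_minus_def)
      qed
      have \<phi>add: "\<phi> (x \<oplus> x') = \<phi> x \<oplus> \<phi> x'" if x: "x \<in> I" "x' \<in> I" for x x'
      proof -
        have "z (x \<oplus> x') \<otimes> i = u \<otimes> x \<oplus> u \<otimes> x'"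
          using z[OF Id(3)[OF x]] u Ic x by (simp add: r_distr)
        also have "\<dots> = (z x \<oplus> z x') \<otimes> i" using z x zc ic by (simp add: l_distr)
        finally have "(\<one> \<ominus> e) \<otimes> z (x \<oplus> x') = (\<one> \<ominus> e) \<otimes> (z x \<oplus> z x')"
          using zc x Id(3)[OF x] by (intro unique) auto
        then show ?thesis using zc x e by (simp add: \<phi>_def r_distr)
      qed
      have \<phi>smult: "\<phi> (r \<otimes> x) = r \<otimes> \<phi> x" if x: "x \<in> I" "r \<in> carrier R" for r x
      proof -
        have rx: "r \<otimes> x \<in> I" using Id(5)[OF x] .
        have "z (r \<otimes> x) \<otimes> i = r \<otimes> (u \<otimes> x)"
          using z[OF rx] u Ic x by (simp add: m_lcomm)
        also have "\<dots> = (r \<otimes> z x) \<otimes> i" using z x zc ic by (simp add: m_assoc)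
        finally have "(\<one> \<ominus> e) \<otimes> z (r \<otimes> x) = (\<one> \<ominus> e) \<otimes> (r \<otimes> z x)"
          using zc[OF x(1)] zc[OF rx] x by (intro unique) auto
        then show ?thesis using zc[OF x(1)] x e by (simp add: \<phi>_def m_lcomm)
      qed
      have "h i \<in> carrier N'" using module_homD(1)[OF h] iI by simp
      then obtain n where n: "n \<in> carrier N" "g n = h i" using surj by (metis imageE)
      have "(\<lambda>x. \<phi> x \<odot>\<^bsub>N\<^esub> n) \<in> module_hom R ?M N"
        using \<phi>c \<phi>add \<phi>smult n
        by (auto intro!: module_homI simp: N.smult_l_distr N.smult_assoc1)
      moreover have "g (\<phi> x \<odot>\<^bsub>N\<^esub> n) = h (u \<otimes> x)" if x: "x \<in> I" for x
        using module_homD(3)[OF g \<phi>c[OF x] n(1)] module_homD(3)[OF h \<phi>c[OF x], of i] iI n(2) \<phi>i[OF x]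
        by simp
      ultimately have "?lift u (\<lambda>x. \<phi> x \<odot>\<^bsub>N\<^esub> n)" by blast
      then have "u \<in> ?D" using u by blast
      then show False using DP u by blast
    qed
    then obtain k where k: "k \<in> module_hom R ?M N" "\<forall>x \<in> I. g (k x) = h (\<one> \<otimes> x)" by blast
    then have "\<forall>x \<in> carrier ?M. g (k x) = h x" using Ic by simp
    then show "\<exists>k \<in> module_hom R ?M N. \<forall>x \<in> carrier ?M. g (k x) = h x" using k(1) by blast
  qed
qed

end

section \<open>Tensor products\<close>

text \<open>
  \<open>\<Phi>\<close> extends \<open>\<psi>\<close> additively from the generators to the free abelian group.  A relation keeps the
  values of \<open>\<Phi>\<close> outside of this group arbitrary.
\<close>

definition frag_hom :: "'x set \<Rightarrow> ('y, 'm) ring_scheme \<Rightarrow> ('x \<Rightarrow> 'y) \<Rightarrow> (('x \<Rightarrow>\<^sub>0 int) \<Rightarrow> 'y) \<Rightarrow> bool" where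
  "frag_hom S G \<psi> \<Phi> \<longleftrightarrow> \<Phi> \<in> hom (free_Abelian_group S) (add_monoid G) \<and> (\<forall>x \<in> S. \<Phi> (frag_of x) = \<psi> x)"

lemma (in abelian_group) frag_hom_exists:
  assumes "\<And>x. x \<in> S \<Longrightarrow> \<psi> x \<in> carrier G"
  obtains \<Phi> where "frag_hom S G \<psi> \<Phi>"
proof -
  have "\<psi> ` S \<subseteq> carrier (add_monoid G)" using assms by auto
  then obtain \<Phi> where "\<Phi> \<in> hom (free_Abelian_group S) (add_monoid G)" "\<And>x. x \<in> S \<Longrightarrow> \<Phi> (frag_of x) = \<psi> x"
    using comm_group.free_Abelian_group_universal[OF a_comm_group, of \<psi> S] by blast
  then show thesis using that unfolding frag_hom_def by blast
qed

lemma (in abelian_group) frag_homD: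
  assumes "frag_hom S G \<psi> \<Phi>"
  shows "x \<in> S \<Longrightarrow> \<Phi> (frag_of x) = \<psi> x" "\<Phi> 0 = \<zero>"
    and "Poly_Mapping.keys c \<subseteq> S \<Longrightarrow> \<Phi> c \<in> carrier G"
    and "Poly_Mapping.keys c \<subseteq> S \<Longrightarrow> Poly_Mapping.keys d \<subseteq> S \<Longrightarrow> \<Phi> (c - d) = \<Phi> c \<ominus> \<Phi> d"
proof -
  have hom: "\<Phi> \<in> hom (free_Abelian_group S) (add_monoid G)" using assms by (simp add: frag_hom_def)
  show "x \<in> S \<Longrightarrow> \<Phi> (frag_of x) = \<psi> x" using assms by (simp add: frag_hom_def)
  have cl: "\<Phi> c \<in> carrier G" if "Poly_Mapping.keys c \<subseteq> S" for c
    using hom_in_carrier[OF hom, of c] that by simp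
  have add: "\<Phi> (c + d) = \<Phi> c \<oplus> \<Phi> d" if "Poly_Mapping.keys c \<subseteq> S" "Poly_Mapping.keys d \<subseteq> S" for c d
    using hom_mult[OF hom, of c d] that by simp
  show "Poly_Mapping.keys c \<subseteq> S \<Longrightarrow> \<Phi> c \<in> carrier G" by (rule cl)
  show "\<Phi> 0 = \<zero>" using add[of 0 0] cl[of 0] by simp
  show "\<Phi> (c - d) = \<Phi> c \<ominus> \<Phi> d" if c: "Poly_Mapping.keys c \<subseteq> S" and d: "Poly_Mapping.keys d \<subseteq> S"
  proof -
    have cd: "Poly_Mapping.keys (c - d) \<subseteq> S" by (rule order_trans[OF keys_diff]) (use c d in simp)
    have "\<Phi> c = \<Phi> (c - d) \<oplus> \<Phi> d" using add[OF cd d] by simp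
    then have "\<Phi> c \<ominus> \<Phi> d = \<Phi> (c - d) \<oplus> (\<Phi> d \<oplus> \<ominus> \<Phi> d)"
      using cl[OF cd] cl[OF d] by (simp add: a_minus_def a_assoc)
    then show ?thesis using cl[OF cd] cl[OF d] by (simp add: r_neg)
  qed
qed

lemma tensor_relations_cases [consumes 1, case_names left right scalar]:
  assumes "c \<in> tensor_relations R M N"
    and "\<And>x y n. c = frag_of (x \<oplus>\<^bsub>M\<^esub> y, n) - frag_of (x, n) - frag_of (y, n) \<Longrightarrow>
      x \<in> carrier M \<Longrightarrow> y \<in> carrier M \<Longrightarrow> n \<in> carrier N \<Longrightarrow> P"
    and "\<And>x n k. c = frag_of (x, n \<oplus>\<^bsub>N\<^esub> k) - frag_of (x, n) - frag_of (x, k) \<Longrightarrow>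
      x \<in> carrier M \<Longrightarrow> n \<in> carrier N \<Longrightarrow> k \<in> carrier N \<Longrightarrow> P"
    and "\<And>r x n. c = frag_of (r \<odot>\<^bsub>M\<^esub> x, n) - frag_of (x, r \<odot>\<^bsub>N\<^esub> n) \<Longrightarrow>
      r \<in> carrier R \<Longrightarrow> x \<in> carrier M \<Longrightarrow> n \<in> carrier N \<Longrightarrow> P"
  shows P
  using assms(1) unfolding tensor_relations_def
proof (elim UnE CollectE exE conjE)
  show P if "c = frag_of (x \<oplus>\<^bsub>M\<^esub> y, n) - frag_of (x, n) - frag_of (y, n)"
    "x \<in> carrier M" "y \<in> carrier M" "n \<in> carrier N" for x y n
    using assms(2)[OF that] .
  show P if "c = frag_of (x, n \<oplus>\<^bsub>N\<^esub> k) - frag_of (x, n) - frag_of (x, k)"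
    "x \<in> carrier M" "n \<in> carrier N" "k \<in> carrier N" for x n k
    using assms(3)[OF that] .
  show P if "c = frag_of (r \<odot>\<^bsub>M\<^esub> x, n) - frag_of (x, r \<odot>\<^bsub>N\<^esub> n)"
    "r \<in> carrier R" "x \<in> carrier M" "n \<in> carrier N" for r x n
    using assms(4)[OF that] .
qed

lemma tensor_relations_keys:
  assumes "module R M" "module R N" "c \<in> tensor_relations R M N"
  shows "Poly_Mapping.keys c \<subseteq> carrier M \<times> carrier N"
proof -
  interpret M: module R M by fact
  interpret N: module R N by fact
  have 3: "Poly_Mapping.keys (frag_of p - frag_of q - frag_of r) \<subseteq> S" if "p \<in> S" "q \<in> S" "r \<in> S" for p q r S
    using that keys_diff[of "frag_of p - frag_of q" "frag_of r"] keys_diff[of "frag_of p" "frag_of q"]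
    by (auto simp: keys_frag_of)
  have 2: "Poly_Mapping.keys (frag_of p - frag_of q) \<subseteq> S" if "p \<in> S" "q \<in> S" for p q S
    using that keys_diff[of "frag_of p" "frag_of q"] by (auto simp: keys_frag_of)
  show ?thesis
    using assms(3)
  proof (cases rule: tensor_relations_cases)
    case (left x y n)
    show ?thesis unfolding left(1) by (rule 3) (use left in auto)
  next
    case (right x n k)
    show ?thesis unfolding right(1) by (rule 3) (use right in auto)
  next
    case (scalar r x n)
    show ?thesis unfolding scalar(1) by (rule 2) (use scalar in auto)
  qed
qed

lemma tensor_null_induct [consumes 3, case_names zero rel diff]:
  assumes M: "module R M" and N: "module R N" and c: "c \<in> tensor_null R M N"
    and P: "P 0" "\<And>r. r \<in> tensor_relations R M N \<Longrightarrow> P r"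
      "\<And>x y. Poly_Mapping.keys x \<subseteq> carrier M \<times> carrier N \<Longrightarrow> Poly_Mapping.keys y \<subseteq> carrier M \<times> carrier N \<Longrightarrow>
        P x \<Longrightarrow> P y \<Longrightarrow> P (x - y)"
  shows "P c"
proof -
  note keys = tensor_relations_keys[OF M N]
  have "Poly_Mapping.keys c \<subseteq> carrier M \<times> carrier N \<and> P c"
    using c unfolding tensor_null_def tensor_free_def
  proof (induction rule: generate.induct)
    case one then show ?case using P(1) by simp
  next
    case (incl h) then show ?case using keys P(2) by blast
  next
    case (inv h)
    then have "P (0 - h)" using P(3)[of 0 h] P(1,2) keys by simp
    then show ?case using inv keys by (simp add: keys_minus)
  next
    case (eng x y)
    then have "P (0 - y)" "Poly_Mapping.keys (0 - y) \<subseteq> carrier M \<times> carrier N"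
      using P(3)[of 0 y] P(1) by (auto simp: keys_minus)
    then have "P (x - (0 - y))" using P(3)[of x "0 - y"] eng by blast
    then show ?case using eng keys_add[of x y] by auto
  qed
  then show ?thesis ..
qed

lemma tensor_null_keys:
  assumes "module R M" "module R N" "c \<in> tensor_null R M N"
  shows "Poly_Mapping.keys c \<subseteq> carrier M \<times> carrier N"
  using assms
proof (induction rule: tensor_null_induct)
  case (rel r) then show ?case using tensor_relations_keys[OF assms(1,2)] by blast
next
  case (diff x y)
  then show ?case by (intro order_trans[OF keys_diff]) simp
qed simp

lemma tensor_null_closed:
  assumes "module R M" "module R N"
  shows "0 \<in> tensor_null R M N"
    and "r \<in> tensor_relations R M N \<Longrightarrow> r \<in> tensor_null R M N"
    and "x \<in> tensor_null R M N \<Longrightarrow> y \<in> tensor_null R M N \<Longrightarrow> x + y \<in> tensor_null R M N"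
    and "x \<in> tensor_null R M N \<Longrightarrow> y \<in> tensor_null R M N \<Longrightarrow> x - y \<in> tensor_null R M N"
proof -
  let ?G = "tensor_free M N"
  have rel: "tensor_relations R M N \<subseteq> carrier ?G"
    using tensor_relations_keys[OF assms] by (auto simp: tensor_free_def)
  have sub: "subgroup (tensor_null R M N) ?G"
    unfolding tensor_null_def
    by (rule group.generate_is_subgroup[OF _ rel]) (simp add: tensor_free_def)
  show "0 \<in> tensor_null R M N" using subgroup.one_closed[OF sub] by (simp add: tensor_free_def)
  show "r \<in> tensor_relations R M N \<Longrightarrow> r \<in> tensor_null R M N"
    unfolding tensor_null_def by (rule generate.incl)
  show add: "x + y \<in> tensor_null R M N" if "x \<in> tensor_null R M N" "y \<in> tensor_null R M N" for x y
    using subgroup.m_closed[OF sub that] by (simp add: tensor_free_def)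
  have "- y \<in> tensor_null R M N" if "y \<in> tensor_null R M N" for y
    using subgroup.m_inv_closed[OF sub that] tensor_null_keys[OF assms that]
    by (simp add: tensor_free_def)
  then show "x \<in> tensor_null R M N \<Longrightarrow> y \<in> tensor_null R M N \<Longrightarrow> x - y \<in> tensor_null R M N"
    using add[of x "- y"] by simp
qed

lemma tensor_nullI_diff:
  assumes "module R M" "module R N" "x - y \<in> tensor_null R M N" "y \<in> tensor_null R M N"
  shows "x \<in> tensor_null R M N"
  using tensor_null_closed(3)[OF assms] by simp

lemma tensor_null_rules:
  assumes M: "module R M" and N: "module R N"
  shows "x \<in> carrier M \<Longrightarrow> y \<in> carrier M \<Longrightarrow> n \<in> carrier N \<Longrightarrow>
      frag_of (x \<oplus>\<^bsub>M\<^esub> y, n) - frag_of (x, n) - frag_of (y, n) \<in> tensor_null R M N"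
    and "x \<in> carrier M \<Longrightarrow> n \<in> carrier N \<Longrightarrow> k \<in> carrier N \<Longrightarrow>
      frag_of (x, n \<oplus>\<^bsub>N\<^esub> k) - frag_of (x, n) - frag_of (x, k) \<in> tensor_null R M N"
    and "r \<in> carrier R \<Longrightarrow> x \<in> carrier M \<Longrightarrow> n \<in> carrier N \<Longrightarrow>
      frag_of (r \<odot>\<^bsub>M\<^esub> x, n) - frag_of (x, r \<odot>\<^bsub>N\<^esub> n) \<in> tensor_null R M N"
    and "n \<in> carrier N \<Longrightarrow> frag_of (\<zero>\<^bsub>M\<^esub>, n) \<in> tensor_null R M N"
    and "x \<in> carrier M \<Longrightarrow> frag_of (x, \<zero>\<^bsub>N\<^esub>) \<in> tensor_null R M N"
    and "x \<in> carrier M \<Longrightarrow> n \<in> carrier N \<Longrightarrow> k \<in> carrier N \<Longrightarrow>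
      frag_of (x, n \<ominus>\<^bsub>N\<^esub> k) - (frag_of (x, n) - frag_of (x, k)) \<in> tensor_null R M N"
proof -
  interpret M: module R M by fact
  interpret N: module R N by fact
  note closed = tensor_null_closed[OF M N]
  show 1: "frag_of (x \<oplus>\<^bsub>M\<^esub> y, n) - frag_of (x, n) - frag_of (y, n) \<in> tensor_null R M N"
    if "x \<in> carrier M" "y \<in> carrier M" "n \<in> carrier N" for x y n
    by (rule closed(2)) (use that in \<open>unfold tensor_relations_def, blast\<close>)
  show 2: "frag_of (x, n \<oplus>\<^bsub>N\<^esub> k) - frag_of (x, n) - frag_of (x, k) \<in> tensor_null R M N"
    if "x \<in> carrier M" "n \<in> carrier N" "k \<in> carrier N" for x n k
    by (rule closed(2)) (use that in \<open>unfold tensor_relations_def, blast\<close>)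
  show "frag_of (r \<odot>\<^bsub>M\<^esub> x, n) - frag_of (x, r \<odot>\<^bsub>N\<^esub> n) \<in> tensor_null R M N"
    if "r \<in> carrier R" "x \<in> carrier M" "n \<in> carrier N" for r x n
    by (rule closed(2)) (use that in \<open>unfold tensor_relations_def, blast\<close>)
  show "frag_of (\<zero>\<^bsub>M\<^esub>, n) \<in> tensor_null R M N" if "n \<in> carrier N" for n
    using closed(4)[OF closed(1) 1[of "\<zero>\<^bsub>M\<^esub>" "\<zero>\<^bsub>M\<^esub>" n]] that by simp
  show "frag_of (x, \<zero>\<^bsub>N\<^esub>) \<in> tensor_null R M N" if "x \<in> carrier M" for x
    using closed(4)[OF closed(1) 2[of x "\<zero>\<^bsub>N\<^esub>" "\<zero>\<^bsub>N\<^esub>"]] that by simp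
  show "frag_of (x, n \<ominus>\<^bsub>N\<^esub> k) - (frag_of (x, n) - frag_of (x, k)) \<in> tensor_null R M N"
    if xnk: "x \<in> carrier M" "n \<in> carrier N" "k \<in> carrier N" for x n k
  proof -
    have "(n \<ominus>\<^bsub>N\<^esub> k) \<oplus>\<^bsub>N\<^esub> k = n \<oplus>\<^bsub>N\<^esub> (\<ominus>\<^bsub>N\<^esub> k \<oplus>\<^bsub>N\<^esub> k)"
      using xnk by (simp add: a_minus_def N.M.a_assoc)
    then have "(n \<ominus>\<^bsub>N\<^esub> k) \<oplus>\<^bsub>N\<^esub> k = n" using xnk by (simp add: N.M.l_neg)
    then show ?thesis
      using closed(4)[OF closed(1) 2[of x "n \<ominus>\<^bsub>N\<^esub> k" k]] xnk by (simp add: algebra_simps)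
  qed
qed

text \<open>Linear maps take bilinearity relations to bilinearity relations.\<close>

lemma tensor_null_map:
  assumes M: "module R M" and N: "module R N" and M': "module R M'" and N': "module R N'"
    and f: "f \<in> module_hom R M M'" and g: "g \<in> module_hom R N N'" and c: "c \<in> tensor_null R M N"
  shows "frag_extend (\<lambda>(m, n). frag_of (f m, g n)) c \<in> tensor_null R M' N'"
  using M N c
proof (induction rule: tensor_null_induct)
  case zero then show ?case using tensor_null_closed(1)[OF M' N'] by simp
next
  case (rel r)
  note f = module_homD[OF f] and g = module_homD[OF g]
  show ?case
    using rel unfolding tensor_relations_def
    by (auto simp: frag_extend_diff f g intro!: tensor_null_rules[OF M' N'])
next
  case (diff x y)
  then show ?case using tensor_null_closed(4)[OF M' N'] by (simp add: frag_extend_diff)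
qed

lemma frag_map_keys:
  assumes "Poly_Mapping.keys c \<subseteq> A \<times> B" "\<And>m. m \<in> A \<Longrightarrow> f m \<in> A'" "\<And>n. n \<in> B \<Longrightarrow> g n \<in> B'"
  shows "Poly_Mapping.keys (frag_extend (\<lambda>(m, n). frag_of (f m, g n)) c) \<subseteq> A' \<times> B'"
proof -
  have "Poly_Mapping.keys (frag_extend (\<lambda>(m, n). frag_of (f m, g n)) c) \<subseteq>
      (\<Union>x \<in> Poly_Mapping.keys c. Poly_Mapping.keys ((\<lambda>(m, n). frag_of (f m, g n)) x))"
    by (rule keys_frag_extend)
  also have "\<dots> \<subseteq> A' \<times> B'" using assms by (auto simp: keys_frag_of)
  finally show ?thesis .
qed

lemma tensor_coset_eq_iff:
  assumes "module R M" "module R N"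
  shows "tensor_null R M N #>\<^bsub>tensor_free M N\<^esub> c = tensor_null R M N #>\<^bsub>tensor_free M N\<^esub> d \<longleftrightarrow>
    c - d \<in> tensor_null R M N"
proof -
  note closed = tensor_null_closed[OF assms]
  have coset: "tensor_null R M N #>\<^bsub>tensor_free M N\<^esub> c = {h + c | h. h \<in> tensor_null R M N}" for c
    by (auto simp: r_coset_def tensor_free_def)
  show ?thesis
    unfolding coset
  proof
    assume eq: "{h + c | h. h \<in> tensor_null R M N} = {h + d | h. h \<in> tensor_null R M N}"
    have "0 + c \<in> {h + c | h. h \<in> tensor_null R M N}" using closed(1) by blast
    then obtain h where "0 + c = h + d" "h \<in> tensor_null R M N" unfolding eq by blast
    then show "c - d \<in> tensor_null R M N" by (simp add: algebra_simps)
  next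
    assume cd: "c - d \<in> tensor_null R M N"
    have "h + c \<in> {h + d | h. h \<in> tensor_null R M N}" if "h \<in> tensor_null R M N" for h
      using closed(3)[OF that cd] by (intro CollectI exI[of _ "h + (c - d)"]) simp
    moreover have "h + d \<in> {h + c | h. h \<in> tensor_null R M N}" if "h \<in> tensor_null R M N" for h
      using closed(4)[OF that cd] by (intro CollectI exI[of _ "h - (c - d)"]) simp
    ultimately show "{h + c | h. h \<in> tensor_null R M N} = {h + d | h. h \<in> tensor_null R M N}" by blast
  qed
qed

text \<open>
  Injectivity of \<open>id \<otimes> f\<close> in terms of representatives in the free abelian groups, which is how
  flatness is used and proved below.
\<close>

lemma tensor_map_inj_iff:
  assumes M: "module R M" and N: "module R N" and N': "module R N'" and f: "f \<in> module_hom R N N'"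
  shows "inj_on (tensor_map R M N' f) (carrier (tensor R M N)) \<longleftrightarrow>
    (\<forall>c. Poly_Mapping.keys c \<subseteq> carrier M \<times> carrier N \<longrightarrow>
      frag_extend (\<lambda>(m, n). frag_of (m, f n)) c \<in> tensor_null R M N' \<longrightarrow> c \<in> tensor_null R M N)"
proof -
  let ?f = "frag_extend (\<lambda>(m, n). frag_of (m, f n))"
  let ?K = "tensor_null R M N" and ?K' = "tensor_null R M N'"
  let ?c = "\<lambda>c. ?K #>\<^bsub>tensor_free M N\<^esub> c" and ?c' = "\<lambda>c. ?K' #>\<^bsub>tensor_free M N'\<^esub> c"
  have id: "(\<lambda>m. m) \<in> module_hom R M M" by (rule module_homI) auto
  have null: "?f c \<in> ?K'" if "c \<in> ?K" for c using tensor_null_map[OF M N M N' id f that] .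
  have mem: "d \<in> ?c c \<longleftrightarrow> d - c \<in> ?K" for c d
  proof
    assume "d \<in> ?c c" then show "d - c \<in> ?K" by (auto simp: r_coset_def tensor_free_def)
  next
    assume "d - c \<in> ?K"
    then show "d \<in> ?c c" unfolding r_coset_def by (intro UN_I[of "d - c"]) (auto simp: tensor_free_def)
  qed
  have map: "tensor_map R M N' f (?c c) = ?c' (?f c)" for c
  proof -
    have "?c' (?f d) = ?c' (?f c)" if "d \<in> ?c c" for d
      unfolding tensor_coset_eq_iff[OF M N'] using null[of "d - c"] that mem by (simp add: frag_extend_diff)
    moreover have "c \<in> ?c c" using mem tensor_null_closed(1)[OF M N] by simp
    ultimately have "(\<lambda>c. ?c' (?f c)) ` (?c c) = {?c' (?f c)}" by blast
    then show ?thesis unfolding tensor_map_def by simp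
  qed
  have carrier: "carrier (tensor R M N) = ?c ` {c. Poly_Mapping.keys c \<subseteq> carrier M \<times> carrier N}"
    unfolding tensor_def FactGroup_def RCOSETS_def by (auto simp: tensor_free_def)
  show ?thesis
  proof
    assume inj: "inj_on (tensor_map R M N' f) (carrier (tensor R M N))"
    show "\<forall>c. Poly_Mapping.keys c \<subseteq> carrier M \<times> carrier N \<longrightarrow> ?f c \<in> ?K' \<longrightarrow> c \<in> ?K"
    proof (intro allI impI)
      fix c assume c: "Poly_Mapping.keys c \<subseteq> carrier M \<times> carrier N" "?f c \<in> ?K'"
      then have "?c' (?f c) = ?c' (?f 0)" unfolding tensor_coset_eq_iff[OF M N'] by simp
      then have "tensor_map R M N' f (?c c) = tensor_map R M N' f (?c 0)" by (simp only: map)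
      then have "?c c = ?c 0" by (rule inj_onD[OF inj]) (use c in \<open>auto simp: carrier\<close>)
      then show "c \<in> ?K" unfolding tensor_coset_eq_iff[OF M N] by simp
    qed
  next
    assume ker: "\<forall>c. Poly_Mapping.keys c \<subseteq> carrier M \<times> carrier N \<longrightarrow> ?f c \<in> ?K' \<longrightarrow> c \<in> ?K"
    show "inj_on (tensor_map R M N' f) (carrier (tensor R M N))"
    proof (rule inj_onI)
      fix X Y assume "X \<in> carrier (tensor R M N)" "Y \<in> carrier (tensor R M N)"
      then obtain c d where c: "X = ?c c" "Poly_Mapping.keys c \<subseteq> carrier M \<times> carrier N"
        and d: "Y = ?c d" "Poly_Mapping.keys d \<subseteq> carrier M \<times> carrier N" unfolding carrier by blast
      assume "tensor_map R M N' f X = tensor_map R M N' f Y"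
      then have "?f (c - d) \<in> ?K'"
        unfolding c d map tensor_coset_eq_iff[OF M N'] by (simp add: frag_extend_diff)
      moreover have "Poly_Mapping.keys (c - d) \<subseteq> carrier M \<times> carrier N" by (rule order_trans[OF keys_diff]) (use c d in simp)
      ultimately show "X = Y" unfolding c d tensor_coset_eq_iff[OF M N] using ker by blast
    qed
  qed
qed

section \<open>Rings of weak global dimension at most one in terms of elements\<close>

context cring
begin

text \<open>
  A tensor \<open>a \<otimes> b - c \<otimes> d\<close> with \<open>a b = c d\<close> dies in \<open>I \<otimes> R\<close>, so by flatness it dies in \<open>I \<otimes> J\<close>.
  Hence so does its image under every bilinear form modulo an ideal \<open>D\<close>, here the product of two
  functions that are linear modulo \<open>D\<close>.
\<close>

lemma flat_ideal_bilinear: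
  assumes flat: "flat_module TYPE('a list) R (ideal_module R I)"
    and I: "ideal I R" and J: "ideal J R" and D: "ideal D R"
    and p: "\<And>x. x \<in> I \<Longrightarrow> p x \<in> carrier R"
      "\<And>x y. x \<in> I \<Longrightarrow> y \<in> I \<Longrightarrow> p (x \<oplus> y) \<ominus> (p x \<oplus> p y) \<in> D"
      "\<And>r x. r \<in> carrier R \<Longrightarrow> x \<in> I \<Longrightarrow> p (r \<otimes> x) \<ominus> r \<otimes> p x \<in> D"
    and q: "\<And>x. x \<in> J \<Longrightarrow> q x \<in> carrier R"
      "\<And>x y. x \<in> J \<Longrightarrow> y \<in> J \<Longrightarrow> q (x \<oplus> y) \<ominus> (q x \<oplus> q y) \<in> D"
      "\<And>r x. r \<in> carrier R \<Longrightarrow> x \<in> J \<Longrightarrow> q (r \<otimes> x) \<ominus> r \<otimes> q x \<in> D"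
    and abcd: "a \<in> I" "c \<in> I" "b \<in> J" "d \<in> J" "a \<otimes> b = c \<otimes> d"
  shows "p a \<otimes> q b \<ominus> p c \<otimes> q d \<in> D"
proof -
  let ?M = "ideal_module R I" and ?N = "list_module R J 1" and ?N' = "list_module R (carrier R) 1"
  have M: "module R ?M" and N: "module R ?N" and N': "module R ?N'"
    using module_ideal_module[OF I] module_list_module[OF J] module_list_module[OF oneideal] by auto
  note Jc = idealD(1)[OF J] and Ic = idealD(1)[OF I]
  have cc: "a \<in> carrier R" "b \<in> carrier R" "c \<in> carrier R" "d \<in> carrier R" using abcd Jc Ic by auto
  let ?c = "frag_of (a, [b]) - frag_of (c, [d])"
  have inc: "(\<lambda>n. n) \<in> module_hom R ?N ?N'" by (rule module_homI) (use Jc in auto)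
  have "inj_on (tensor_map R ?M ?N' (\<lambda>n. n)) (carrier (tensor R ?M ?N))"
  proof -
    have "inj_on (\<lambda>n. n) (carrier ?N)" by simp
    with N N' inc show ?thesis
      using flat[unfolded flat_module_def, THEN conjunct2, rule_format, of ?N ?N' "\<lambda>n. n"] by blast
  qed
  then have ker: "x \<in> tensor_null R ?M ?N"
    if "Poly_Mapping.keys x \<subseteq> carrier ?M \<times> carrier ?N"
      "frag_extend (\<lambda>(m, n). frag_of (m, n)) x \<in> tensor_null R ?M ?N'" for x
    using that unfolding tensor_map_inj_iff[OF M N N' inc] by blast
  have "?c \<in> tensor_null R ?M ?N"
  proof (rule ker)
    show "Poly_Mapping.keys ?c \<subseteq> carrier ?M \<times> carrier ?N"
      by (rule order_trans[OF keys_diff]) (use abcd in \<open>simp add: keys_frag_of\<close>)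
    note closed = tensor_null_closed[OF M N'] and rules = tensor_null_rules[OF M N']
    have 1: "frag_of (b \<otimes> a, [\<one>]) - frag_of (a, [b]) \<in> tensor_null R ?M ?N'"
      using rules(3)[of b a "[\<one>]"] cc abcd by simp
    have 2: "frag_of (d \<otimes> c, [\<one>]) - frag_of (c, [d]) \<in> tensor_null R ?M ?N'"
      using rules(3)[of d c "[\<one>]"] cc abcd by simp
    have "b \<otimes> a = d \<otimes> c" using abcd(5) cc by (simp add: m_comm)
    then have "?c \<in> tensor_null R ?M ?N'" using closed(4)[OF 2 1] by simp
    then show "frag_extend (\<lambda>(m, n). frag_of (m, n)) ?c \<in> tensor_null R ?M ?N'"
      by (simp add: frag_extend_diff)
  qed
  obtain \<Phi> where \<Phi>: "frag_hom (carrier ?M \<times> carrier ?N) R (\<lambda>(m, n). p m \<otimes> q (n ! 0)) \<Phi>"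
  proof (rule frag_hom_exists)
    show "(case x of (m, n) \<Rightarrow> p m \<otimes> q (n ! 0)) \<in> carrier R" if "x \<in> carrier ?M \<times> carrier ?N" for x
      using that p(1) q(1) by (auto simp: length_Suc_conv)
  qed (rule that)
  note \<Phi>D = frag_homD[OF \<Phi>]
  have val: "\<Phi> (frag_of (m, [n])) = p m \<otimes> q n" if "m \<in> I" "n \<in> J" for m n
    using \<Phi>D(1)[of "(m, [n])"] that by simp
  have \<Phi>3: "\<Phi> (frag_of x - frag_of y - frag_of z) = \<Phi> (frag_of x) \<ominus> \<Phi> (frag_of y) \<ominus> \<Phi> (frag_of z)"
    if "x \<in> carrier ?M \<times> carrier ?N" "y \<in> carrier ?M \<times> carrier ?N" "z \<in> carrier ?M \<times> carrier ?N" for x y z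
  proof -
    have "Poly_Mapping.keys (frag_of x - frag_of y) \<subseteq> carrier ?M \<times> carrier ?N"
      by (rule order_trans[OF keys_diff]) (use that in \<open>simp add: keys_frag_of\<close>)
    then show ?thesis using that \<Phi>D(4)[of "frag_of x - frag_of y" "frag_of z"]
        \<Phi>D(4)[of "frag_of x" "frag_of y"] by (simp add: keys_frag_of)
  qed
  have \<Phi>2: "\<Phi> (frag_of x - frag_of y) = \<Phi> (frag_of x) \<ominus> \<Phi> (frag_of y)"
    if "x \<in> carrier ?M \<times> carrier ?N" "y \<in> carrier ?M \<times> carrier ?N" for x y
    using \<Phi>D(4)[of "frag_of x" "frag_of y"] that by (simp add: keys_frag_of)
  note Dd = idealD[OF D]
  have single: "\<exists>x \<in> J. n = [x]" if "n \<in> carrier ?N" for n using that by (auto simp: length_Suc_conv)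
  have "\<Phi> x \<in> D" if "x \<in> tensor_null R ?M ?N" for x
    using M N that
  proof (induction rule: tensor_null_induct)
    case zero then show ?case using \<Phi>D(2) Dd(2) by simp
  next
    case (diff x y) then show ?case using \<Phi>D(4) Dd(4) by simp
  next
    case (rel r)
    then show ?case
    proof (cases rule: tensor_relations_cases)
      case (left x y n)
      then obtain j where j: "j \<in> J" "n = [j]" using single by blast
      have x: "x \<in> I" "y \<in> I" "x \<oplus> y \<in> I" using left idealD(3)[OF I] by auto
      note c = p(1)[OF x(1)] p(1)[OF x(2)] p(1)[OF x(3)] q(1)[OF j(1)]
      have "\<Phi> r = p (x \<oplus> y) \<otimes> q j \<ominus> p x \<otimes> q j \<ominus> p y \<otimes> q j"
        unfolding left(1) using \<Phi>3[of "(x \<oplus> y, n)" "(x, n)" "(y, n)"] val x j left by simp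
      also have "\<dots> = (p (x \<oplus> y) \<ominus> (p x \<oplus> p y)) \<otimes> q j" using c by algebra
      finally show ?thesis using Dd(6)[OF p(2)[OF x(1,2)] c(4)] by simp
    next
      case (right x n k)
      then obtain i j where ij: "i \<in> J" "n = [i]" "j \<in> J" "k = [j]" using single by meson
      have x: "x \<in> I" and s: "i \<oplus> j \<in> J" using right idealD(3)[OF J] ij by auto
      note c = p(1)[OF x] q(1)[OF ij(1)] q(1)[OF ij(3)] q(1)[OF s]
      have "\<Phi> r = p x \<otimes> q (i \<oplus> j) \<ominus> p x \<otimes> q i \<ominus> p x \<otimes> q j"
        unfolding right(1) using \<Phi>3[of "(x, [i \<oplus> j])" "(x, n)" "(x, k)"] val x ij s by simp
      also have "\<dots> = p x \<otimes> (q (i \<oplus> j) \<ominus> (q i \<oplus> q j))" using c by algebra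
      finally show ?thesis using Dd(5)[OF q(2)[OF ij(1,3)] c(1)] by simp
    next
      case (scalar t x n)
      then obtain j where j: "j \<in> J" "n = [j]" using single by blast
      have x: "x \<in> I" "t \<otimes> x \<in> I" and tj: "t \<otimes> j \<in> J" and t: "t \<in> carrier R"
        using scalar idealD(5)[OF I] idealD(5)[OF J] j by auto
      note c = p(1)[OF x(1)] p(1)[OF x(2)] q(1)[OF j(1)] q(1)[OF tj] t
      have "\<Phi> r = p (t \<otimes> x) \<otimes> q j \<ominus> p x \<otimes> q (t \<otimes> j)"
        unfolding scalar(1) using \<Phi>2[of "(t \<otimes> x, n)" "(x, [t \<otimes> j])"] val x j tj by simp
      also have "\<dots> = (p (t \<otimes> x) \<ominus> t \<otimes> p x) \<otimes> q j \<ominus> p x \<otimes> (q (t \<otimes> j) \<ominus> t \<otimes> q j)"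
        using c by algebra
      finally show ?thesis
        using Dd(4)[OF Dd(6)[OF p(3)[OF t x(1)] c(3)] Dd(5)[OF q(3)[OF t j(1)] c(1)]] by simp
    qed
  qed
  from this[OF \<open>?c \<in> tensor_null R ?M ?N\<close>] show ?thesis
    using \<Phi>2[of "(a, [b])" "(c, [d])"] val abcd by simp
qed

lemma pair_coordinates:
  assumes ab: "a \<in> carrier R" "b \<in> carrier R"
  obtains p q where "\<And>x. x \<in> Idl {a, b} \<Longrightarrow> p x \<in> carrier R" "\<And>x. x \<in> Idl {a, b} \<Longrightarrow> q x \<in> carrier R"
    "\<And>x. x \<in> Idl {a, b} \<Longrightarrow> x = p x \<otimes> a \<oplus> q x \<otimes> b"
proof -
  have "\<exists>p q. p \<in> carrier R \<and> q \<in> carrier R \<and> x = p \<otimes> a \<oplus> q \<otimes> b" if x: "x \<in> Idl {a, b}" for x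
  proof -
    have "{a, b} = {a, b, b}" by auto
    then obtain \<alpha> \<beta> \<gamma> where c: "\<alpha> \<in> carrier R" "\<beta> \<in> carrier R" "\<gamma> \<in> carrier R"
      "x = \<alpha> \<otimes> a \<oplus> \<beta> \<otimes> b \<oplus> \<gamma> \<otimes> b"
      using genideal_triple[of x a b b] x ab by metis
    have "x = \<alpha> \<otimes> a \<oplus> (\<beta> \<oplus> \<gamma>) \<otimes> b" unfolding c(4) using c(1-3) ab by algebra
    then show ?thesis using c by blast
  qed
  then show thesis using that by metis
qed

text \<open>
  Write the members of \<open>(a, b)\<close> as \<open>p(x) a + q(x) b\<close>.  If a prime ideal contained \<open>((b) : a)\<close> and
  \<open>((a) : b)\<close>, the coordinates \<open>p\<close> and \<open>q\<close> would be unique and hence linear modulo this prime ideal.  The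
  bilinear form \<open>p(x) q(y)\<close> would have the value \<open>1\<close> at \<open>(a, b)\<close> and \<open>0\<close> at \<open>(b, a)\<close>, in spite of
  \<open>a b = b a\<close>.
\<close>

lemma flat_imp_comaximal_quotients:
  assumes wg: "weak_gldim_le_1 TYPE('a list) R"
  shows "comaximal_quotients R"
proof (rule comaximal_quotients_if_local)
  fix a b P assume ab: "a \<in> carrier R" "b \<in> carrier R" and P: "primeideal P R"
  let ?I = "Idl {a, b}"
  have S: "{a, b} \<subseteq> carrier R" using ab by auto
  have I: "ideal ?I R" by (rule genideal_ideal[OF S])
  note Id = idealD[OF I]
  have aI: "a \<in> ?I" and bI: "b \<in> ?I" using genideal_self[OF S] by auto
  show "\<exists>u \<in> carrier R - P. \<exists>v \<in> carrier R. u \<otimes> a = v \<otimes> b \<or> u \<otimes> b = v \<otimes> a"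
  proof (rule ccontr)
    assume neg: "\<not> ?thesis"
    have Pa: "u \<in> P" if "u \<in> carrier R" "v \<in> carrier R" "u \<otimes> a = v \<otimes> b" for u v using neg that by blast
    have Pb: "u \<in> P" if "u \<in> carrier R" "v \<in> carrier R" "u \<otimes> b = v \<otimes> a" for u v using neg that by blast
    obtain p q where p: "\<And>x. x \<in> ?I \<Longrightarrow> p x \<in> carrier R" and q: "\<And>x. x \<in> ?I \<Longrightarrow> q x \<in> carrier R"
      and x: "\<And>x. x \<in> ?I \<Longrightarrow> x = p x \<otimes> a \<oplus> q x \<otimes> b" by (rule pair_coordinates[OF ab]) (rule that)
    have unique: "s \<ominus> s' \<in> P" "t \<ominus> t' \<in> P"
      if c: "s \<in> carrier R" "t \<in> carrier R" "s' \<in> carrier R" "t' \<in> carrier R"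
        and eq: "s \<otimes> a \<oplus> t \<otimes> b = s' \<otimes> a \<oplus> t' \<otimes> b" for s t s' t'
    proof -
      have "(s \<ominus> s') \<otimes> a = (s \<otimes> a \<oplus> t \<otimes> b) \<ominus> s' \<otimes> a \<ominus> t \<otimes> b" using c ab by algebra
      also have "\<dots> = (t' \<ominus> t) \<otimes> b" unfolding eq using c ab by algebra
      finally show "s \<ominus> s' \<in> P" using Pa[of "s \<ominus> s'" "t' \<ominus> t"] c by simp
      have "(t \<ominus> t') \<otimes> b = (s \<otimes> a \<oplus> t \<otimes> b) \<ominus> s \<otimes> a \<ominus> t' \<otimes> b" using c ab by algebra
      also have "\<dots> = (s' \<ominus> s) \<otimes> a" unfolding eq using c ab by algebra
      finally show "t \<ominus> t' \<in> P" using Pb[of "t \<ominus> t'" "s' \<ominus> s"] c by simp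
    qed
    have add: "p (x \<oplus> y) \<ominus> (p x \<oplus> p y) \<in> P" "q (x \<oplus> y) \<ominus> (q x \<oplus> q y) \<in> P"
      if xy: "x \<in> ?I" "y \<in> ?I" for x y
    proof -
      note c = p[OF xy(1)] p[OF xy(2)] q[OF xy(1)] q[OF xy(2)]
      have "p (x \<oplus> y) \<otimes> a \<oplus> q (x \<oplus> y) \<otimes> b = x \<oplus> y" using x[OF Id(3)[OF xy]] by simp
      also have "\<dots> = (p x \<otimes> a \<oplus> q x \<otimes> b) \<oplus> (p y \<otimes> a \<oplus> q y \<otimes> b)"
        using x[OF xy(1)] x[OF xy(2)] by simp
      also have "\<dots> = (p x \<oplus> p y) \<otimes> a \<oplus> (q x \<oplus> q y) \<otimes> b" using c ab by algebra
      finally have eq: "p (x \<oplus> y) \<otimes> a \<oplus> q (x \<oplus> y) \<otimes> b = (p x \<oplus> p y) \<otimes> a \<oplus> (q x \<oplus> q y) \<otimes> b" .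
      have "p x \<oplus> p y \<in> carrier R" "q x \<oplus> q y \<in> carrier R" using c by auto
      from unique[OF p[OF Id(3)[OF xy]] q[OF Id(3)[OF xy]] this eq]
      show "p (x \<oplus> y) \<ominus> (p x \<oplus> p y) \<in> P" "q (x \<oplus> y) \<ominus> (q x \<oplus> q y) \<in> P" .
    qed
    have smult: "p (r \<otimes> x) \<ominus> r \<otimes> p x \<in> P" "q (r \<otimes> x) \<ominus> r \<otimes> q x \<in> P"
      if r: "r \<in> carrier R" and xI: "x \<in> ?I" for r x
    proof -
      note c = p[OF xI] q[OF xI] r
      have "p (r \<otimes> x) \<otimes> a \<oplus> q (r \<otimes> x) \<otimes> b = r \<otimes> x" using x[OF Id(5)[OF xI r]] by simp
      also have "\<dots> = r \<otimes> (p x \<otimes> a \<oplus> q x \<otimes> b)" using x[OF xI] by simp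
      also have "\<dots> = (r \<otimes> p x) \<otimes> a \<oplus> (r \<otimes> q x) \<otimes> b" using c ab by algebra
      finally have eq: "p (r \<otimes> x) \<otimes> a \<oplus> q (r \<otimes> x) \<otimes> b = (r \<otimes> p x) \<otimes> a \<oplus> (r \<otimes> q x) \<otimes> b" .
      have "r \<otimes> p x \<in> carrier R" "r \<otimes> q x \<in> carrier R" using c by auto
      from unique[OF p[OF Id(5)[OF xI r]] q[OF Id(5)[OF xI r]] this eq]
      show "p (r \<otimes> x) \<ominus> r \<otimes> p x \<in> P" "q (r \<otimes> x) \<ominus> r \<otimes> q x \<in> P" .
    qed
    note PI = primeidealD(1)[OF P] and Pd = idealD[OF primeidealD(1)[OF P]]
    have "flat_module TYPE('a list) R (ideal_module R ?I)" using wg I unfolding weak_gldim_le_1_def by blast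
    then have main: "p a \<otimes> q b \<ominus> p b \<otimes> q a \<in> P"
      by (rule flat_ideal_bilinear[OF _ I I PI p add(1) smult(1) q add(2) smult(2)])
        (use aI bI m_comm ab in auto)
    note c = p[OF aI] p[OF bI] q[OF aI] q[OF bI]
    have "p a \<otimes> a \<oplus> q a \<otimes> b = \<one> \<otimes> a \<oplus> \<zero> \<otimes> b" using x[OF aI] ab by simp
    from unique[OF c(1,3) one_closed zero_closed this] have a1: "p a \<ominus> \<one> \<in> P" and a0: "q a \<ominus> \<zero> \<in> P" .
    have "p b \<otimes> a \<oplus> q b \<otimes> b = \<zero> \<otimes> a \<oplus> \<one> \<otimes> b" using x[OF bI] ab by simp
    from unique(2)[OF c(2,4) zero_closed one_closed this] have b1: "q b \<ominus> \<one> \<in> P" .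
    have "\<one> = (p a \<otimes> q b \<ominus> p b \<otimes> q a) \<ominus> (p a \<ominus> \<one>) \<otimes> q b \<ominus> (q b \<ominus> \<one>) \<oplus> p b \<otimes> (q a \<ominus> \<zero>)"
      using c by algebra
    also have "\<dots> \<in> P"
      by (intro Pd(3,4) main b1 Pd(6)[OF a1 c(4)] Pd(5)[OF a0 c(2)])
    finally show False using primeidealD(2)[OF P] by blast
  qed
qed

lemma principal_coordinate:
  assumes a: "a \<in> carrier R"
  obtains p where "\<And>x. x \<in> PIdl a \<Longrightarrow> p x \<in> carrier R" "\<And>x. x \<in> PIdl a \<Longrightarrow> x = p x \<otimes> a"
proof -
  have "\<forall>x \<in> PIdl a. \<exists>p. p \<in> carrier R \<and> x = p \<otimes> a" by (auto simp: cgenideal_def)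
  from bchoice[OF this] show thesis using that by blast
qed

text \<open>
  For \<open>a b = 0\<close> the same argument applies to \<open>(a) \<otimes> (b)\<close> and the form \<open>(x a, y b) \<mapsto> x y\<close>, which is well
  defined modulo every prime ideal that contains both annihilators.
\<close>

lemma flat_imp_pure_annihilators:
  assumes wg: "weak_gldim_le_1 TYPE('a list) R"
  shows "pure_annihilators R"
proof (rule pure_annihilators_if_local)
  fix a b P assume ab: "a \<in> carrier R" "b \<in> carrier R" "a \<otimes> b = \<zero>" and P: "primeideal P R"
  show "\<exists>u \<in> carrier R - P. u \<otimes> a = \<zero> \<or> u \<otimes> b = \<zero>"
  proof (rule ccontr)
    assume neg: "\<not> ?thesis"
    note PI = primeidealD(1)[OF P] and Pd = idealD[OF primeidealD(1)[OF P]]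
    have main: "\<exists>p. (\<forall>x \<in> PIdl a. p x \<in> carrier R) \<and>
        (\<forall>x \<in> PIdl a. \<forall>y \<in> PIdl a. p (x \<oplus> y) \<ominus> (p x \<oplus> p y) \<in> P) \<and>
        (\<forall>r \<in> carrier R. \<forall>x \<in> PIdl a. p (r \<otimes> x) \<ominus> r \<otimes> p x \<in> P) \<and> p a \<ominus> \<one> \<in> P \<and> p \<zero> \<ominus> \<zero> \<in> P"
      if a: "a \<in> carrier R" and ann: "\<And>u. u \<in> carrier R \<Longrightarrow> u \<otimes> a = \<zero> \<Longrightarrow> u \<in> P" for a
    proof -
      note I = cgenideal_ideal[OF a]
      note Id = idealD[OF I]
      obtain p where p: "\<And>x. x \<in> PIdl a \<Longrightarrow> p x \<in> carrier R" and x: "\<And>x. x \<in> PIdl a \<Longrightarrow> x = p x \<otimes> a"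
        by (rule principal_coordinate[OF a]) (rule that)
      have unique: "s \<ominus> t \<in> P" if c: "s \<in> carrier R" "t \<in> carrier R" and eq: "s \<otimes> a = t \<otimes> a" for s t
      proof -
        have "(s \<ominus> t) \<otimes> a = s \<otimes> a \<ominus> t \<otimes> a" using c a by algebra
        also have "\<dots> = \<zero>" using eq c a by simp
        finally show ?thesis using ann c by simp
      qed
      have 1: "p (x \<oplus> y) \<ominus> (p x \<oplus> p y) \<in> P" if xy: "x \<in> PIdl a" "y \<in> PIdl a" for x y
      proof (rule unique)
        have "p (x \<oplus> y) \<otimes> a = p x \<otimes> a \<oplus> p y \<otimes> a"
          using x[OF Id(3)[OF xy]] x[OF xy(1)] x[OF xy(2)] by simp
        then show "p (x \<oplus> y) \<otimes> a = (p x \<oplus> p y) \<otimes> a" using p xy a by (simp add: l_distr)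
      qed (use p xy Id(3) in auto)
      have 2: "p (r \<otimes> x) \<ominus> r \<otimes> p x \<in> P" if r: "r \<in> carrier R" and xI: "x \<in> PIdl a" for r x
      proof (rule unique)
        have "p (r \<otimes> x) \<otimes> a = r \<otimes> (p x \<otimes> a)" using x[OF Id(5)[OF xI r]] x[OF xI] by simp
        then show "p (r \<otimes> x) \<otimes> a = (r \<otimes> p x) \<otimes> a" using p xI a r by (simp add: m_assoc)
      qed (use p xI r Id(5) in auto)
      have aI: "a \<in> PIdl a" by (rule cgenideal_self[OF a])
      have 3: "p a \<ominus> \<one> \<in> P" by (rule unique) (use p[OF aI] x[OF aI] a in auto)
      have 4: "p \<zero> \<ominus> \<zero> \<in> P" by (rule unique) (use p[OF Id(2)] x[OF Id(2)] a in auto)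
      show ?thesis using p 1 2 3 4 by blast
    qed
    obtain p where p: "\<And>x. x \<in> PIdl a \<Longrightarrow> p x \<in> carrier R"
      "\<And>x y. x \<in> PIdl a \<Longrightarrow> y \<in> PIdl a \<Longrightarrow> p (x \<oplus> y) \<ominus> (p x \<oplus> p y) \<in> P"
      "\<And>r x. r \<in> carrier R \<Longrightarrow> x \<in> PIdl a \<Longrightarrow> p (r \<otimes> x) \<ominus> r \<otimes> p x \<in> P" "p a \<ominus> \<one> \<in> P" "p \<zero> \<ominus> \<zero> \<in> P"
      using main[OF ab(1)] neg by blast
    obtain q where q: "\<And>x. x \<in> PIdl b \<Longrightarrow> q x \<in> carrier R"
      "\<And>x y. x \<in> PIdl b \<Longrightarrow> y \<in> PIdl b \<Longrightarrow> q (x \<oplus> y) \<ominus> (q x \<oplus> q y) \<in> P"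
      "\<And>r x. r \<in> carrier R \<Longrightarrow> x \<in> PIdl b \<Longrightarrow> q (r \<otimes> x) \<ominus> r \<otimes> q x \<in> P" "q b \<ominus> \<one> \<in> P"
      using main[OF ab(2)] neg by blast
    note I = cgenideal_ideal[OF ab(1)] and J = cgenideal_ideal[OF ab(2)]
    have aI: "a \<in> PIdl a" and bJ: "b \<in> PIdl b" using cgenideal_self ab by auto
    have "flat_module TYPE('a list) R (ideal_module R (PIdl a))"
      using wg I unfolding weak_gldim_le_1_def by blast
    then have m: "p a \<otimes> q b \<ominus> p \<zero> \<otimes> q \<zero> \<in> P"
      by (rule flat_ideal_bilinear[OF _ I J PI p(1-3) q(1-3)])
        (use aI bJ ab idealD(2)[OF I] idealD(2)[OF J] in auto)
    note c = p(1)[OF aI] p(1)[OF idealD(2)[OF I]] q(1)[OF bJ] q(1)[OF idealD(2)[OF J]]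
    have "\<one> = (p a \<otimes> q b \<ominus> p \<zero> \<otimes> q \<zero>) \<ominus> (p a \<ominus> \<one>) \<otimes> q b \<ominus> (q b \<ominus> \<one>) \<oplus> (p \<zero> \<ominus> \<zero>) \<otimes> q \<zero>"
      using c by algebra
    also have "\<dots> \<in> P"
      by (intro Pd(3,4) m q(4) Pd(6)[OF p(4) c(3)] Pd(6)[OF p(5) c(4)])
    finally show False using primeidealD(2)[OF P] by blast
  qed
qed

end

lemmas frag_induct = free_Abelian_group_induct [consumes 1, case_names zero diff gen]

context cring
begin

text \<open>
  The members \<open>s\<close> of \<open>S\<close> are locally the multiples \<open>(y\<^sub>s / u) b\<close> of \<open>b\<close>, and \<open>\<Phi>\<close> is the corresponding
  coordinate \<open>s \<otimes> n \<mapsto> y\<^sub>s n\<close> of tensors.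
\<close>

definition local_coordinates ::
  "'a set \<Rightarrow> ('a, 'd, 'q) module_scheme \<Rightarrow> 'a set \<Rightarrow> 'a \<Rightarrow> ('a \<Rightarrow> 'a) \<Rightarrow> (('a \<times> 'd \<Rightarrow>\<^sub>0 int) \<Rightarrow> 'd) \<Rightarrow> bool" where
  "local_coordinates I N S b y \<Phi> \<longleftrightarrow> b \<in> carrier R \<and> y \<in> I \<rightarrow> carrier R \<and>
     (\<exists>u \<in> carrier R. \<forall>s \<in> S. u \<otimes> s = y s \<otimes> b) \<and>
     frag_hom (I \<times> carrier N) N (\<lambda>(s, n). y s \<odot>\<^bsub>N\<^esub> n) \<Phi>"

text \<open>
  If \<open>x = 0\<close> in \<open>I \<otimes> N\<close> and locally all members of \<open>I\<close> in question are multiples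
  \<open>s = (y\<^sub>s / u) b\<close> of one \<open>b \<in> I\<close>, then the coordinate \<open>\<Phi>(x)\<close> of \<open>x = b \<otimes> \<Phi>(x)\<close> vanishes locally,
  unless \<open>b\<close> does.  The finite set \<open>S\<close> must contain the members of \<open>I\<close> used by the bilinearity
  relations that make up \<open>x\<close>: on these \<open>y\<close> is linear up to annihilators of \<open>b\<close>.
\<close>


lemma tensor_null_coordinate:
  assumes pa: "pure_annihilators R" and P: "primeideal P R" and I: "ideal I R" and N: "module R N"
    and x: "x \<in> tensor_null R (ideal_module R I) N"
  shows "\<exists>S. finite S \<and> S \<subseteq> I \<and> (\<forall>b y \<Phi>. local_coordinates I N S b y \<Phi> \<longrightarrow>
    (\<exists>v \<in> carrier R - P. v \<otimes> b = \<zero> \<or> v \<odot>\<^bsub>N\<^esub> \<Phi> x = \<zero>\<^bsub>N\<^esub>))"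
proof -
  interpret N: module R N by fact
  let ?M = "ideal_module R I"
  have M: "module R ?M" by (rule module_ideal_module[OF I])
  note Id = idealD[OF I]
  have one: "\<one> \<in> carrier R - P" using primeidealD(2)[OF P] by simp
  have val: "\<Phi> (frag_of (s, n)) = y s \<odot>\<^bsub>N\<^esub> n"
    if "local_coordinates I N S b y \<Phi>" "s \<in> I" "n \<in> carrier N" for S b y \<Phi> s n
    using that N.frag_homD(1)[of "I \<times> carrier N" "\<lambda>(s, n). y s \<odot>\<^bsub>N\<^esub> n" \<Phi> "(s, n)"]
    unfolding local_coordinates_def by simp
  have \<Phi>_diff: "\<Phi> (c - d) = \<Phi> c \<ominus>\<^bsub>N\<^esub> \<Phi> d"
    if "local_coordinates I N S b y \<Phi>" "Poly_Mapping.keys c \<subseteq> I \<times> carrier N"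
      "Poly_Mapping.keys d \<subseteq> I \<times> carrier N" for S b y \<Phi> c d
    using that N.frag_homD(4) unfolding local_coordinates_def by blast
  have closed: "\<Phi> c \<in> carrier N"
    if "local_coordinates I N S b y \<Phi>" "Poly_Mapping.keys c \<subseteq> I \<times> carrier N" for S b y \<Phi> c
    using that N.frag_homD(3) unfolding local_coordinates_def by blast
  have diff2: "\<Phi> (frag_of p - frag_of q) = \<Phi> (frag_of p) \<ominus>\<^bsub>N\<^esub> \<Phi> (frag_of q)"
    if "local_coordinates I N S b y \<Phi>" "p \<in> I \<times> carrier N" "q \<in> I \<times> carrier N" for S b y \<Phi> p q
    using \<Phi>_diff[OF that(1)] that(2,3) by (simp add: keys_frag_of)
  have diff3: "\<Phi> (frag_of p - frag_of q - frag_of r) = \<Phi> (frag_of p) \<ominus>\<^bsub>N\<^esub> \<Phi> (frag_of q) \<ominus>\<^bsub>N\<^esub> \<Phi> (frag_of r)"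
    if lc: "local_coordinates I N S b y \<Phi>" and p: "p \<in> I \<times> carrier N" and q: "q \<in> I \<times> carrier N"
      and r: "r \<in> I \<times> carrier N" for S b y \<Phi> p q r
  proof -
    have "Poly_Mapping.keys (frag_of p - frag_of q) \<subseteq> I \<times> carrier N"
      by (rule order_trans[OF keys_diff]) (use p q in \<open>simp add: keys_frag_of\<close>)
    then show ?thesis using \<Phi>_diff[OF lc] diff2[OF lc p q] r by (simp add: keys_frag_of)
  qed
  have vanish: "\<exists>v \<in> carrier R - P. v \<otimes> b = \<zero> \<or> v \<odot>\<^bsub>N\<^esub> (z \<odot>\<^bsub>N\<^esub> n) = \<zero>\<^bsub>N\<^esub>"
    if z: "z \<in> carrier R" "b \<in> carrier R" "z \<otimes> b = \<zero>" and n: "n \<in> carrier N" for z b n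
  proof -
    obtain v where v: "v \<in> carrier R - P" "v \<otimes> z = \<zero> \<or> v \<otimes> b = \<zero>"
      using pure_annihilators_local[OF pa P z] by blast
    have "v \<odot>\<^bsub>N\<^esub> (z \<odot>\<^bsub>N\<^esub> n) = (v \<otimes> z) \<odot>\<^bsub>N\<^esub> n" using v z n by (simp add: N.smult_assoc1)
    then have "v \<otimes> b = \<zero> \<or> v \<odot>\<^bsub>N\<^esub> (z \<odot>\<^bsub>N\<^esub> n) = \<zero>\<^bsub>N\<^esub>" using v(2) n by auto
    then show ?thesis using v(1) by blast
  qed
  have smult_diff: "(a \<ominus> c) \<odot>\<^bsub>N\<^esub> n = a \<odot>\<^bsub>N\<^esub> n \<ominus>\<^bsub>N\<^esub> c \<odot>\<^bsub>N\<^esub> n"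
    if "a \<in> carrier R" "c \<in> carrier R" "n \<in> carrier N" for a c n
    using that by (simp add: a_minus_def N.smult_l_distr N.smult_l_minus)
  show ?thesis
    using M N x
  proof (induction rule: tensor_null_induct)
    case zero
    have "\<Phi> 0 = \<zero>\<^bsub>N\<^esub>" if "local_coordinates I N {} b y \<Phi>" for b y \<Phi>
      using that N.frag_homD(2) unfolding local_coordinates_def by blast
    then have "\<one> \<odot>\<^bsub>N\<^esub> \<Phi> 0 = \<zero>\<^bsub>N\<^esub>" if "local_coordinates I N {} b y \<Phi>" for b y \<Phi>
      using that N.smult_r_null by simp
    then show ?case using one by (intro exI[of _ "{}"]) blast
  next
    case (diff c d)
    note keys = diff(1,2)[unfolded ideal_module_simps]
    obtain S where S: "finite S" "S \<subseteq> I" and Sv: "\<And>b y \<Phi>. local_coordinates I N S b y \<Phi> \<Longrightarrow>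
        \<exists>v \<in> carrier R - P. v \<otimes> b = \<zero> \<or> v \<odot>\<^bsub>N\<^esub> \<Phi> c = \<zero>\<^bsub>N\<^esub>"
      using diff(3) by metis
    obtain T where T: "finite T" "T \<subseteq> I" and Tv: "\<And>b y \<Phi>. local_coordinates I N T b y \<Phi> \<Longrightarrow>
        \<exists>v \<in> carrier R - P. v \<otimes> b = \<zero> \<or> v \<odot>\<^bsub>N\<^esub> \<Phi> d = \<zero>\<^bsub>N\<^esub>"
      using diff(4) by metis
    have "\<exists>v \<in> carrier R - P. v \<otimes> b = \<zero> \<or> v \<odot>\<^bsub>N\<^esub> \<Phi> (c - d) = \<zero>\<^bsub>N\<^esub>"
      if lc: "local_coordinates I N (S \<union> T) b y \<Phi>" for b y \<Phi>
    proof -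
      have "local_coordinates I N S b y \<Phi>" "local_coordinates I N T b y \<Phi>"
        using lc unfolding local_coordinates_def by auto
      from Sv[OF this(1)] Tv[OF this(2)] obtain v w where v: "v \<in> carrier R" "v \<notin> P"
        and w: "w \<in> carrier R" "w \<notin> P" and alt: "v \<otimes> b = \<zero> \<or> v \<odot>\<^bsub>N\<^esub> \<Phi> c = \<zero>\<^bsub>N\<^esub>"
          "w \<otimes> b = \<zero> \<or> w \<odot>\<^bsub>N\<^esub> \<Phi> d = \<zero>\<^bsub>N\<^esub>" by blast
      note \<Phi> = closed[OF lc keys(1)] closed[OF lc keys(2)]
      show ?thesis
      proof (cases "v \<otimes> b = \<zero> \<or> w \<otimes> b = \<zero>")
        case True then show ?thesis using v w by blast
      next
        case False
        then have z: "v \<odot>\<^bsub>N\<^esub> \<Phi> c = \<zero>\<^bsub>N\<^esub>" "w \<odot>\<^bsub>N\<^esub> \<Phi> d = \<zero>\<^bsub>N\<^esub>" using alt by auto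
        have "(v \<otimes> w) \<odot>\<^bsub>N\<^esub> \<Phi> c = w \<odot>\<^bsub>N\<^esub> (v \<odot>\<^bsub>N\<^esub> \<Phi> c)"
          using v w \<Phi> by (simp add: m_comm[of v w] N.smult_assoc1)
        moreover have "(v \<otimes> w) \<odot>\<^bsub>N\<^esub> \<Phi> d = v \<odot>\<^bsub>N\<^esub> (w \<odot>\<^bsub>N\<^esub> \<Phi> d)"
          using v w \<Phi> by (simp add: N.smult_assoc1)
        ultimately have "(v \<otimes> w) \<odot>\<^bsub>N\<^esub> \<Phi> c = \<zero>\<^bsub>N\<^esub>" "(v \<otimes> w) \<odot>\<^bsub>N\<^esub> \<Phi> d = \<zero>\<^bsub>N\<^esub>"
          using z v w by simp_all
        then have "(v \<otimes> w) \<odot>\<^bsub>N\<^esub> \<Phi> (c - d) = \<zero>\<^bsub>N\<^esub>"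
          using \<Phi>_diff[OF lc keys] v w \<Phi>
          by (simp add: a_minus_def N.smult_r_distr N.smult_r_minus)
        then show ?thesis using primeidealD(3)[OF P v(1) w(1) v(2) w(2)] v w by blast
      qed
    qed
    then show ?case using S T by (intro exI[of _ "S \<union> T"]) blast
  next
    case (rel r)
    then show ?case
    proof (cases rule: tensor_relations_cases)
      case (left s t n)
      then have st: "s \<in> I" "t \<in> I" "s \<oplus> t \<in> I" "n \<in> carrier N" using Id(3) by auto
      have "\<exists>v \<in> carrier R - P. v \<otimes> b = \<zero> \<or> v \<odot>\<^bsub>N\<^esub> \<Phi> r = \<zero>\<^bsub>N\<^esub>"
        if lc: "local_coordinates I N {s, t, s \<oplus> t} b y \<Phi>" for b y \<Phi>
      proof -
        obtain u where u: "u \<in> carrier R" "u \<otimes> s = y s \<otimes> b" "u \<otimes> t = y t \<otimes> b" "u \<otimes> (s \<oplus> t) = y (s \<oplus> t) \<otimes> b"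
          using lc unfolding local_coordinates_def by auto
        have c: "b \<in> carrier R" "y s \<in> carrier R" "y t \<in> carrier R" "y (s \<oplus> t) \<in> carrier R"
          "s \<in> carrier R" "t \<in> carrier R"
          using lc st Id(1) unfolding local_coordinates_def by auto
        let ?z = "y (s \<oplus> t) \<ominus> y s \<ominus> y t"
        have "?z \<otimes> b = y (s \<oplus> t) \<otimes> b \<ominus> y s \<otimes> b \<ominus> y t \<otimes> b" using c by algebra
        also have "\<dots> = u \<otimes> (s \<oplus> t) \<ominus> u \<otimes> s \<ominus> u \<otimes> t" by (simp only: u(2-4))
        also have "\<dots> = \<zero>" using c u(1) by algebra
        finally have "?z \<otimes> b = \<zero>" .
        then have "\<exists>v \<in> carrier R - P. v \<otimes> b = \<zero> \<or> v \<odot>\<^bsub>N\<^esub> (?z \<odot>\<^bsub>N\<^esub> n) = \<zero>\<^bsub>N\<^esub>"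
          using c st by (intro vanish) auto
        moreover have "\<Phi> r = ?z \<odot>\<^bsub>N\<^esub> n"
          unfolding left(1) using diff3[OF lc, of "(s \<oplus> t, n)" "(s, n)" "(t, n)"] val[OF lc] st c
          by (simp add: smult_diff)
        ultimately show ?thesis by simp
      qed
      then show ?thesis using st by (intro exI[of _ "{s, t, s \<oplus> t}"]) simp
    next
      case (right s n k)
      then have s: "s \<in> I" by simp
      have "\<exists>v \<in> carrier R - P. v \<otimes> b = \<zero> \<or> v \<odot>\<^bsub>N\<^esub> \<Phi> r = \<zero>\<^bsub>N\<^esub>"
        if lc: "local_coordinates I N {} b y \<Phi>" for b y \<Phi>
      proof -
        have c: "y s \<in> carrier R" using lc s unfolding local_coordinates_def by auto
        have "\<Phi> r = y s \<odot>\<^bsub>N\<^esub> (n \<oplus>\<^bsub>N\<^esub> k) \<ominus>\<^bsub>N\<^esub> y s \<odot>\<^bsub>N\<^esub> n \<ominus>\<^bsub>N\<^esub> y s \<odot>\<^bsub>N\<^esub> k"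
          unfolding right(1) using diff3[OF lc, of "(s, n \<oplus>\<^bsub>N\<^esub> k)" "(s, n)" "(s, k)"] val[OF lc] s right by simp
        also have "\<dots> = \<zero>\<^bsub>N\<^esub>"
          using c right by (simp add: N.smult_r_distr a_minus_def N.M.a_ac N.M.r_neg1 N.M.r_neg2 N.M.r_neg N.M.l_neg)
        finally have "\<one> \<odot>\<^bsub>N\<^esub> \<Phi> r = \<zero>\<^bsub>N\<^esub>" by simp
        then show ?thesis using one by blast
      qed
      then show ?thesis by (intro exI[of _ "{}"]) simp
    next
      case (scalar t s n)
      then have st: "s \<in> I" "t \<in> carrier R" "t \<otimes> s \<in> I" "n \<in> carrier N" using Id(5) by auto
      have "\<exists>v \<in> carrier R - P. v \<otimes> b = \<zero> \<or> v \<odot>\<^bsub>N\<^esub> \<Phi> r = \<zero>\<^bsub>N\<^esub>"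
        if lc: "local_coordinates I N {s, t \<otimes> s} b y \<Phi>" for b y \<Phi>
      proof -
        obtain u where u: "u \<in> carrier R" "u \<otimes> s = y s \<otimes> b" "u \<otimes> (t \<otimes> s) = y (t \<otimes> s) \<otimes> b"
          using lc unfolding local_coordinates_def by auto
        have c: "b \<in> carrier R" "y s \<in> carrier R" "y (t \<otimes> s) \<in> carrier R" "s \<in> carrier R"
          using lc st Id(1) unfolding local_coordinates_def by auto
        let ?z = "y (t \<otimes> s) \<ominus> y s \<otimes> t"
        have "?z \<otimes> b = y (t \<otimes> s) \<otimes> b \<ominus> t \<otimes> (y s \<otimes> b)" using c st(2) by algebra
        also have "\<dots> = u \<otimes> (t \<otimes> s) \<ominus> t \<otimes> (u \<otimes> s)" by (simp only: u(2,3))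
        also have "\<dots> = \<zero>" using c u(1) st(2) by algebra
        finally have "?z \<otimes> b = \<zero>" .
        then have "\<exists>v \<in> carrier R - P. v \<otimes> b = \<zero> \<or> v \<odot>\<^bsub>N\<^esub> (?z \<odot>\<^bsub>N\<^esub> n) = \<zero>\<^bsub>N\<^esub>"
          using c st by (intro vanish) auto
        moreover have "\<Phi> r = ?z \<odot>\<^bsub>N\<^esub> n"
          unfolding scalar(1) using diff2[OF lc, of "(t \<otimes> s, n)" "(s, t \<odot>\<^bsub>N\<^esub> n)"] val[OF lc] st c
          by (simp add: smult_diff N.smult_assoc1)
        ultimately show ?thesis by simp
      qed
      then show ?thesis using st by (intro exI[of _ "{s, t \<otimes> s}"]) simp
    qed
  qed
qed

text \<open>
  Let \<open>c \<in> I \<otimes> N\<close> die in \<open>I \<otimes> N'\<close>.  Locally \<open>c = b \<otimes> n\<close> for one \<open>b \<in> I\<close>, because of any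
  finitely many members of \<open>I\<close> one divides the others, and \<open>b \<otimes> f(n) = 0\<close> implies that \<open>b\<close> or
  \<open>f(n)\<close>, and so \<open>n\<close>, vanishes locally.  Hence \<open>c\<close> is annihilated by an element outside of each prime.
\<close>

theorem weak_gldimI:
  assumes cq: "comaximal_quotients R" and pa: "pure_annihilators R"
  shows "weak_gldim_le_1 TYPE('n) R"
  unfolding weak_gldim_le_1_def flat_module_def
proof (intro allI impI conjI)
  fix I assume I: "ideal I R"
  let ?M = "ideal_module R I"
  show M: "module R ?M" by (rule module_ideal_module[OF I])
  note Id = idealD[OF I]
  have Ic: "x \<in> carrier R" if "x \<in> I" for x using that Id(1) by blast
  fix N N' :: "('a, 'n) module" and f
  assume "module R N \<and> module R N' \<and> f \<in> module_hom R N N' \<and> inj_on f (carrier N)"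
  then have N: "module R N" and N': "module R N'" and f: "f \<in> module_hom R N N'"
    and inj: "inj_on f (carrier N)" by auto
  interpret N: module R N by fact
  interpret N': module R N' by fact
  note fD = module_homD[OF f]
  have f0: "f \<zero>\<^bsub>N\<^esub> = \<zero>\<^bsub>N'\<^esub>"
    using fD(3)[of \<zero> "\<zero>\<^bsub>N\<^esub>"] fD(1)[of "\<zero>\<^bsub>N\<^esub>"] N.smult_l_null N'.smult_l_null by simp
  have fminus: "f (x \<ominus>\<^bsub>N\<^esub> y) = f x \<ominus>\<^bsub>N'\<^esub> f y" if "x \<in> carrier N" "y \<in> carrier N" for x y
  proof -
    have "f (\<ominus>\<^bsub>N\<^esub> y) \<oplus>\<^bsub>N'\<^esub> f y = f (\<ominus>\<^bsub>N\<^esub> y \<oplus>\<^bsub>N\<^esub> y)" using fD(2)[of "\<ominus>\<^bsub>N\<^esub> y" y] that by simp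
    also have "\<dots> = \<zero>\<^bsub>N'\<^esub>" using that f0 by (simp add: N.M.l_neg)
    finally have "\<ominus>\<^bsub>N'\<^esub> f y = f (\<ominus>\<^bsub>N\<^esub> y)"
      using N'.M.minus_equality fD(1) that by simp
    then show ?thesis using fD(2)[of x "\<ominus>\<^bsub>N\<^esub> y"] that by (simp add: a_minus_def)
  qed
  let ?K = "tensor_null R ?M N" and ?K' = "tensor_null R ?M N'"
  note K = tensor_null_closed[OF M N] and rules = tensor_null_rules[OF M N]
  let ?f = "frag_extend (\<lambda>(m, n). frag_of (m, f n))"
  let ?s = "\<lambda>r. frag_extend (\<lambda>(m, n). frag_of (r \<otimes> m, n))"
  show "inj_on (tensor_map R ?M N' f) (carrier (tensor R ?M N))"
    unfolding tensor_map_inj_iff[OF M N N' f]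
  proof (intro allI impI)
    fix c assume c: "Poly_Mapping.keys c \<subseteq> carrier ?M \<times> carrier N" and fc: "?f c \<in> ?K'"
    have cI: "Poly_Mapping.keys c \<subseteq> I \<times> carrier N" using c by simp
    have hom_id: "(\<lambda>n. n) \<in> module_hom R N N" by (rule module_homI) auto
    have hom_s: "(\<lambda>m. r \<otimes> m) \<in> module_hom R ?M ?M" if "r \<in> carrier R" for r
      by (rule module_homI) (use that Ic Id(5) in \<open>auto simp: r_distr m_lcomm\<close>)
    have s_null: "?s r x \<in> ?K" if "r \<in> carrier R" "x \<in> ?K" for r x
      using tensor_null_map[OF M N M N hom_s[OF that(1)] hom_id that(2)] .
    have s_mult: "?s t (?s r x) = ?s (t \<otimes> r) x"
      if tr: "t \<in> carrier R" "r \<in> carrier R" and x: "Poly_Mapping.keys x \<subseteq> I \<times> carrier N" for t r x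
      using x
    proof (induction rule: frag_induct)
      case (gen a)
      then show ?case using tr Ic by (auto simp: m_assoc)
    qed (simp_all add: frag_extend_diff)
    have s_one: "?s \<one> x = x" if "Poly_Mapping.keys x \<subseteq> I \<times> carrier N" for x
      using that
    proof (induction rule: frag_induct)
      case (gen a)
      then show ?case using Ic by auto
    qed (simp_all add: frag_extend_diff)
    have s_add: "?s (t \<oplus> r) x - ?s t x - ?s r x \<in> ?K"
      if tr: "t \<in> carrier R" "r \<in> carrier R" and x: "Poly_Mapping.keys x \<subseteq> I \<times> carrier N" for t r x
      using x
    proof (induction rule: frag_induct)
      case zero then show ?case using K(1) by simp
    next
      case (diff x y)
      have "?s (t \<oplus> r) (x - y) - ?s t (x - y) - ?s r (x - y) =
          (?s (t \<oplus> r) x - ?s t x - ?s r x) - (?s (t \<oplus> r) y - ?s t y - ?s r y)"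
        by (simp add: frag_extend_diff)
      then show ?case using K(4)[OF diff(3,4)] by simp
    next
      case (gen a)
      then obtain m n where a: "a = (m, n)" "m \<in> I" "n \<in> carrier N" by blast
      have "(t \<oplus> r) \<otimes> m = t \<otimes> m \<oplus> r \<otimes> m" using tr a Ic by (auto simp: l_distr)
      then show ?case using rules(1)[of "t \<otimes> m" "r \<otimes> m" n] a tr Id(5) by simp
    qed
    have s_zero: "?s \<zero> x \<in> ?K" if "Poly_Mapping.keys x \<subseteq> I \<times> carrier N" for x
      using that
    proof (induction rule: frag_induct)
      case zero then show ?case using K(1) by simp
    next
      case (diff x y) then show ?case using K(4) by (simp add: frag_extend_diff)
    next
      case (gen a)
      then show ?case using rules(4) Ic by auto
    qed
    let ?D = "{r \<in> carrier R. ?s r c \<in> ?K}"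
    have D: "ideal ?D R"
    proof (rule idealI_closed)
      show "?D \<subseteq> carrier R" by auto
      show "\<zero> \<in> ?D" using s_zero[OF cI] by simp
      show "t \<oplus> r \<in> ?D" if "t \<in> ?D" "r \<in> ?D" for t r
      proof -
        have "?s (t \<oplus> r) c - ?s t c - ?s r c \<in> ?K" using s_add[OF _ _ cI] that by simp
        then have "(?s (t \<oplus> r) c - ?s t c - ?s r c) + ?s t c + ?s r c \<in> ?K"
          using K(3) that by blast
        then show ?thesis using that by simp
      qed
      show "t \<otimes> r \<in> ?D" if "r \<in> ?D" "t \<in> carrier R" for t r
        using s_null[OF that(2), of "?s r c"] s_mult[OF that(2) _ cI, of r] that by simp
    qed
    have "\<one> \<in> ?D"
    proof (rule one_in_idealI[OF D])
      fix P assume P: "primeideal P R" and DP: "?D \<subseteq> P"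
      obtain S0 where S0: "finite S0" "S0 \<subseteq> I" and S0v: "\<And>b y \<Phi>. local_coordinates I N' S0 b y \<Phi> \<Longrightarrow>
          \<exists>v \<in> carrier R - P. v \<otimes> b = \<zero> \<or> v \<odot>\<^bsub>N'\<^esub> \<Phi> (?f c) = \<zero>\<^bsub>N'\<^esub>"
        using tensor_null_coordinate[OF pa P I N' fc] by metis
      let ?S = "insert \<zero> (S0 \<union> fst ` Poly_Mapping.keys c)"
      have SI: "?S \<subseteq> I" using S0 cI Id(2) by auto
      have "finite ?S" "?S \<noteq> {}" "?S \<subseteq> carrier R" using S0 SI Id(1) by auto
      then obtain b u y0 where b: "b \<in> ?S" and u: "u \<in> carrier R" "u \<notin> P"
        and y0: "y0 \<in> ?S \<rightarrow> carrier R" "\<And>s. s \<in> ?S \<Longrightarrow> u \<otimes> s = y0 s \<otimes> b"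
        using comaximal_quotients_local[OF cq P, of ?S] by blast
      define y where "y = (\<lambda>s. if s \<in> ?S then y0 s else \<zero>)"
      have y: "y s \<in> carrier R" for s using y0(1) by (auto simp: y_def)
      have yb: "u \<otimes> s = y s \<otimes> b" if "s \<in> ?S" for s using y0(2)[OF that] that by (simp add: y_def)
      have bI: "b \<in> I" and bc: "b \<in> carrier R" using b SI Id(1) by auto
      obtain \<Phi> where \<Phi>: "frag_hom (I \<times> carrier N') N' (\<lambda>(s, n). y s \<odot>\<^bsub>N'\<^esub> n) \<Phi>"
        by (rule N'.frag_hom_exists[of "I \<times> carrier N'" "\<lambda>(s, n). y s \<odot>\<^bsub>N'\<^esub> n"]) (use y in auto)
      obtain \<Psi> where \<Psi>: "frag_hom (I \<times> carrier N) N (\<lambda>(s, n). y s \<odot>\<^bsub>N\<^esub> n) \<Psi>"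
        by (rule N.frag_hom_exists[of "I \<times> carrier N" "\<lambda>(s, n). y s \<odot>\<^bsub>N\<^esub> n"]) (use y in auto)
      note \<Phi>D = N'.frag_homD[OF \<Phi>] and \<Psi>D = N.frag_homD[OF \<Psi>]
      have \<Psi>c: "\<Psi> c \<in> carrier N" by (rule \<Psi>D(3)[OF cI])
      have "local_coordinates I N' S0 b y \<Phi>"
        unfolding local_coordinates_def using bc y u \<Phi> yb by blast
      from S0v[OF this] obtain v where v: "v \<in> carrier R" "v \<notin> P"
        and alt: "v \<otimes> b = \<zero> \<or> v \<odot>\<^bsub>N'\<^esub> \<Phi> (?f c) = \<zero>\<^bsub>N'\<^esub>" by blast
      have \<Phi>f: "\<Phi> (?f x) = f (\<Psi> x)" if "Poly_Mapping.keys x \<subseteq> I \<times> carrier N" for x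
        using that
      proof (induction rule: frag_induct)
        case zero then show ?case using \<Phi>D(2) \<Psi>D(2) f0 by simp
      next
        case (diff p q)
        have k: "Poly_Mapping.keys (?f p) \<subseteq> I \<times> carrier N'" "Poly_Mapping.keys (?f q) \<subseteq> I \<times> carrier N'"
          using frag_map_keys[OF diff(1), of "\<lambda>m. m" I f "carrier N'"]
            frag_map_keys[OF diff(2), of "\<lambda>m. m" I f "carrier N'"] fD(1) by auto
        have "\<Phi> (?f (p - q)) = \<Phi> (?f p) \<ominus>\<^bsub>N'\<^esub> \<Phi> (?f q)"
          using \<Phi>D(4)[OF k] by (simp add: frag_extend_diff)
        then show ?case using diff \<Psi>D(3,4) fminus by simp
      next
        case (gen a)
        then obtain m n where a: "a = (m, n)" "m \<in> I" "n \<in> carrier N" by blast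
        then show ?case using \<Phi>D(1)[of "(m, f n)"] \<Psi>D(1)[of "(m, n)"] fD(1,3) y by simp
      qed
      have vu: "v \<otimes> u \<in> carrier R" "v \<otimes> u \<notin> P" using v u primeidealD(3)[OF P] by auto
      have collapse: "?s (v \<otimes> u) x - frag_of (b, v \<odot>\<^bsub>N\<^esub> \<Psi> x) \<in> ?K"
        if x: "Poly_Mapping.keys x \<subseteq> ?S \<times> carrier N" for x
        using x
      proof (induction rule: frag_induct)
        case zero
        have "frag_of (b, \<zero>\<^bsub>N\<^esub>) \<in> ?K" using rules(5)[of b] bI by simp
        then show ?case using K(4)[OF K(1)] \<Psi>D(2) v by simp
      next
        case (diff p q)
        have k: "Poly_Mapping.keys p \<subseteq> I \<times> carrier N" "Poly_Mapping.keys q \<subseteq> I \<times> carrier N"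
          using order_trans[OF diff(1) Sigma_mono[OF SI]] order_trans[OF diff(2) Sigma_mono[OF SI]] by simp_all
        note pq = \<Psi>D(3)[OF k(1)] \<Psi>D(3)[OF k(2)]
        let ?p = "frag_of (b, v \<odot>\<^bsub>N\<^esub> \<Psi> p)" and ?q = "frag_of (b, v \<odot>\<^bsub>N\<^esub> \<Psi> q)"
          and ?d = "frag_of (b, v \<odot>\<^bsub>N\<^esub> \<Psi> (p - q))"
        have "v \<odot>\<^bsub>N\<^esub> \<Psi> (p - q) = v \<odot>\<^bsub>N\<^esub> \<Psi> p \<ominus>\<^bsub>N\<^esub> v \<odot>\<^bsub>N\<^esub> \<Psi> q"
          using \<Psi>D(4)[OF k] pq v by (simp add: a_minus_def N.smult_r_distr N.smult_r_minus)
        then have 1: "?d - (?p - ?q) \<in> ?K"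
          using rules(6)[of b "v \<odot>\<^bsub>N\<^esub> \<Psi> p" "v \<odot>\<^bsub>N\<^esub> \<Psi> q"] bI v pq by simp
        have "?s (v \<otimes> u) (p - q) - ?d =
            ((?s (v \<otimes> u) p - ?p) - (?s (v \<otimes> u) q - ?q)) - (?d - (?p - ?q))"
          by (simp add: frag_extend_diff)
        also have "\<dots> \<in> ?K" by (rule K(4)[OF K(4)[OF diff(3,4)] 1])
        finally show ?case .
      next
        case (gen a)
        then obtain s n where a: "a = (s, n)" "s \<in> ?S" "n \<in> carrier N" by blast
        have sI: "s \<in> I" and sc: "s \<in> carrier R" using a SI Id(1) by auto
        have "(v \<otimes> u) \<otimes> s = v \<otimes> (u \<otimes> s)" using v(1) u(1) sc by algebra
        also have "\<dots> = (v \<otimes> y s) \<otimes> b" unfolding yb[OF a(2)] using v(1) y[of s] bc by (simp add: m_assoc)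
        finally have "(v \<otimes> u) \<otimes> s = (v \<otimes> y s) \<otimes> b" .
        moreover have "v \<odot>\<^bsub>N\<^esub> \<Psi> (frag_of a) = (v \<otimes> y s) \<odot>\<^bsub>N\<^esub> n"
          using \<Psi>D(1)[of a] a sI v y by (simp add: N.smult_assoc1)
        ultimately show ?case using rules(3)[of "v \<otimes> y s" b n] v y bI a by simp
      qed
      have "Poly_Mapping.keys c \<subseteq> ?S \<times> carrier N" using cI by force
      note coll = collapse[OF this]
      have "frag_of (b, v \<odot>\<^bsub>N\<^esub> \<Psi> c) \<in> ?K"
        using alt
      proof
        assume "v \<otimes> b = \<zero>"
        then have "frag_of (\<zero>, \<Psi> c) - frag_of (b, v \<odot>\<^bsub>N\<^esub> \<Psi> c) \<in> ?K"
          using rules(3)[of v b "\<Psi> c"] v bI \<Psi>c by simp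
        moreover have "frag_of (\<zero>, \<Psi> c) \<in> ?K" using rules(4)[of "\<Psi> c"] \<Psi>c by simp
        ultimately show ?thesis using K(4) by fastforce
      next
        assume "v \<odot>\<^bsub>N'\<^esub> \<Phi> (?f c) = \<zero>\<^bsub>N'\<^esub>"
        then have "f (v \<odot>\<^bsub>N\<^esub> \<Psi> c) = f \<zero>\<^bsub>N\<^esub>" using \<Phi>f[OF cI] fD(3) v \<Psi>c f0 by simp
        then have "v \<odot>\<^bsub>N\<^esub> \<Psi> c = \<zero>\<^bsub>N\<^esub>" using inj_onD[OF inj] v \<Psi>c by simp
        then show ?thesis using rules(5)[of b] bI by simp
      qed
      then have "?s (v \<otimes> u) c \<in> ?K" by (rule tensor_nullI_diff[OF M N coll])
      then show False using vu DP by blast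
    qed
    then show "c \<in> ?K" using s_one[OF cI] by simp
  qed
qed

end

section \<open>The total ring of fractions\<close>

lemma tot_simps:
  "carrier (tot R) = {fraction R a s | a s. a \<in> carrier R \<and> s \<in> regular_elements R}"
  "\<one>\<^bsub>tot R\<^esub> = fraction R \<one>\<^bsub>R\<^esub> \<one>\<^bsub>R\<^esub>" "\<zero>\<^bsub>tot R\<^esub> = fraction R \<zero>\<^bsub>R\<^esub> \<one>\<^bsub>R\<^esub>"
  "X \<otimes>\<^bsub>tot R\<^esub> Y = (\<Union>(a, s) \<in> X. \<Union>(b, t) \<in> Y. fraction R (a \<otimes>\<^bsub>R\<^esub> b) (s \<otimes>\<^bsub>R\<^esub> t))"
  "X \<oplus>\<^bsub>tot R\<^esub> Y =
    (\<Union>(a, s) \<in> X. \<Union>(b, t) \<in> Y. fraction R ((a \<otimes>\<^bsub>R\<^esub> t) \<oplus>\<^bsub>R\<^esub> (b \<otimes>\<^bsub>R\<^esub> s)) (s \<otimes>\<^bsub>R\<^esub> t))"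
  by (simp_all add: tot_def)

context cring
begin

lemma regular_elements_closed:
  "\<one> \<in> regular_elements R"
  "s \<in> regular_elements R \<Longrightarrow> t \<in> regular_elements R \<Longrightarrow> s \<otimes> t \<in> regular_elements R"
proof -
  show "\<one> \<in> regular_elements R" by (rule regular_elementsI) auto
  show "s \<otimes> t \<in> regular_elements R" if "s \<in> regular_elements R" "t \<in> regular_elements R"
  proof (rule regular_elementsI)
    note s = regular_elementsD[OF that(1)] and t = regular_elementsD[OF that(2)]
    show "s \<otimes> t \<in> carrier R" using s(1) t(1) by simp
    show "x = \<zero>" if "x \<in> carrier R" "(s \<otimes> t) \<otimes> x = \<zero>" for x
      using that s(2)[of "t \<otimes> x"] t(2)[of x] s(1) t(1) by (simp add: m_assoc)
  qed
qed

lemma fraction_self: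
  assumes "a \<in> carrier R" "s \<in> regular_elements R" shows "(a, s) \<in> fraction R a s"
  using assms by (simp add: fraction_def)

lemma fraction_eq_iff:
  assumes "a \<in> carrier R" "s \<in> regular_elements R" "b \<in> carrier R" "t \<in> regular_elements R"
  shows "fraction R a s = fraction R b t \<longleftrightarrow> a \<otimes> t = b \<otimes> s"
proof
  assume "fraction R a s = fraction R b t"
  then have "(b, t) \<in> fraction R a s" using fraction_self[OF assms(3,4)] by simp
  then show "a \<otimes> t = b \<otimes> s" by (simp add: fraction_def)
next
  have sub: "fraction R a s \<subseteq> fraction R b t"
    if c: "a \<in> carrier R" "s \<in> regular_elements R" "b \<in> carrier R" "t \<in> regular_elements R"
      and eq: "a \<otimes> t = b \<otimes> s" for a s b t
  proof
    fix z assume "z \<in> fraction R a s"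
    then obtain x w where z: "z = (x, w)" "x \<in> carrier R" "w \<in> regular_elements R" "a \<otimes> w = x \<otimes> s"
      by (auto simp: fraction_def)
    note cc = c(1,3) regular_elementsD(1)[OF c(2)] regular_elementsD(1)[OF c(4)]
      z(2) regular_elementsD(1)[OF z(3)]
    have "s \<otimes> (b \<otimes> w) = w \<otimes> (b \<otimes> s)" using cc by algebra
    also have "\<dots> = t \<otimes> (a \<otimes> w)" unfolding eq[symmetric] using cc by algebra
    also have "\<dots> = s \<otimes> (x \<otimes> t)" unfolding z(4) using cc by algebra
    finally have "b \<otimes> w = x \<otimes> t" using regular_elementsD(3)[OF c(2)] cc by simp
    then show "z \<in> fraction R b t" using z by (simp add: fraction_def)
  qed
  assume "a \<otimes> t = b \<otimes> s"
  then show "fraction R a s = fraction R b t" using sub assms by (metis subset_antisym)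
qed

lemma fraction_memD:
  assumes "a \<in> carrier R" "s \<in> regular_elements R" "(b, t) \<in> fraction R a s"
  shows "b \<in> carrier R" "t \<in> regular_elements R" "fraction R b t = fraction R a s"
proof -
  show b: "b \<in> carrier R" "t \<in> regular_elements R" using assms(3) by (auto simp: fraction_def)
  show "fraction R b t = fraction R a s"
    using assms(3) fraction_eq_iff[OF b assms(1,2)] by (auto simp: fraction_def)
qed

lemma fraction_mult:
  assumes c: "a \<in> carrier R" "s \<in> regular_elements R" "b \<in> carrier R" "t \<in> regular_elements R"
  shows "fraction R a s \<otimes>\<^bsub>tot R\<^esub> fraction R b t = fraction R (a \<otimes> b) (s \<otimes> t)"
proof -
  have eq: "fraction R (x \<otimes> y) (p \<otimes> q) = fraction R (a \<otimes> b) (s \<otimes> t)"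
    if xp: "(x, p) \<in> fraction R a s" and yq: "(y, q) \<in> fraction R b t" for x p y q
  proof -
    note x = fraction_memD[OF c(1,2) xp] and y = fraction_memD[OF c(3,4) yq]
    note cc = c(1,3) x(1) y(1) regular_elementsD(1)[OF c(2)] regular_elementsD(1)[OF c(4)]
      regular_elementsD(1)[OF x(2)] regular_elementsD(1)[OF y(2)]
    have 1: "x \<otimes> s = a \<otimes> p" using x(3) fraction_eq_iff[OF x(1,2) c(1,2)] by simp
    have 2: "y \<otimes> t = b \<otimes> q" using y(3) fraction_eq_iff[OF y(1,2) c(3,4)] by simp
    have "(x \<otimes> y) \<otimes> (s \<otimes> t) = (x \<otimes> s) \<otimes> (y \<otimes> t)" using cc by algebra
    also have "\<dots> = (a \<otimes> b) \<otimes> (p \<otimes> q)" unfolding 1 2 using cc by algebra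
    finally show ?thesis
      using fraction_eq_iff[of "x \<otimes> y" "p \<otimes> q" "a \<otimes> b" "s \<otimes> t"] x y c regular_elements_closed(2) by simp
  qed
  show ?thesis
    unfolding tot_simps using eq fraction_self[OF c(1,2)] fraction_self[OF c(3,4)] by fast
qed

lemma fraction_add:
  assumes c: "a \<in> carrier R" "s \<in> regular_elements R" "b \<in> carrier R" "t \<in> regular_elements R"
  shows "fraction R a s \<oplus>\<^bsub>tot R\<^esub> fraction R b t = fraction R (a \<otimes> t \<oplus> b \<otimes> s) (s \<otimes> t)"
proof -
  have eq: "fraction R (x \<otimes> q \<oplus> y \<otimes> p) (p \<otimes> q) = fraction R (a \<otimes> t \<oplus> b \<otimes> s) (s \<otimes> t)"
    if xp: "(x, p) \<in> fraction R a s" and yq: "(y, q) \<in> fraction R b t" for x p y q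
  proof -
    note x = fraction_memD[OF c(1,2) xp] and y = fraction_memD[OF c(3,4) yq]
    note reg = regular_elementsD(1)[OF c(2)] regular_elementsD(1)[OF c(4)]
      regular_elementsD(1)[OF x(2)] regular_elementsD(1)[OF y(2)]
    note cc = c(1,3) x(1) y(1) reg
    have 1: "x \<otimes> s = a \<otimes> p" using x(3) fraction_eq_iff[OF x(1,2) c(1,2)] by simp
    have 2: "y \<otimes> t = b \<otimes> q" using y(3) fraction_eq_iff[OF y(1,2) c(3,4)] by simp
    have "(x \<otimes> q \<oplus> y \<otimes> p) \<otimes> (s \<otimes> t) = (x \<otimes> s) \<otimes> (q \<otimes> t) \<oplus> (y \<otimes> t) \<otimes> (p \<otimes> s)" using cc by algebra
    also have "\<dots> = (a \<otimes> t \<oplus> b \<otimes> s) \<otimes> (p \<otimes> q)" unfolding 1 2 using cc by algebra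
    finally show ?thesis
      using fraction_eq_iff[of "x \<otimes> q \<oplus> y \<otimes> p" "p \<otimes> q" "a \<otimes> t \<oplus> b \<otimes> s" "s \<otimes> t"]
        x y c reg regular_elements_closed(2) by simp
  qed
  show ?thesis
    unfolding tot_simps using eq fraction_self[OF c(1,2)] fraction_self[OF c(3,4)] by fast
qed

lemma fraction_in_tot:
  assumes "a \<in> carrier R" "s \<in> regular_elements R" shows "fraction R a s \<in> carrier (tot R)"
  using assms unfolding tot_simps by blast

lemma tot_cases:
  assumes "X \<in> carrier (tot R)"
  obtains a s where "a \<in> carrier R" "s \<in> regular_elements R" "X = fraction R a s"
  using assms unfolding tot_simps by blast

lemma cring_tot: "cring (tot R)"
proof -
  note one = regular_elements_closed(1) and mult = regular_elements_closed(2)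
  have reg: "s \<in> carrier R" if "s \<in> regular_elements R" for s using regular_elementsD(1)[OF that] .
  have "abelian_group (tot R)"
  proof (rule abelian_groupI)
    fix X Y Z assume XYZ: "X \<in> carrier (tot R)" "Y \<in> carrier (tot R)" "Z \<in> carrier (tot R)"
    obtain a s where a: "a \<in> carrier R" "s \<in> regular_elements R" and X: "X = fraction R a s"
      using tot_cases[OF XYZ(1)] .
    obtain b t where b: "b \<in> carrier R" "t \<in> regular_elements R" and Y: "Y = fraction R b t"
      using tot_cases[OF XYZ(2)] .
    obtain c u where c: "c \<in> carrier R" "u \<in> regular_elements R" and Z: "Z = fraction R c u"
      using tot_cases[OF XYZ(3)] .
    note cc = a(1) b(1) c(1) reg[OF a(2)] reg[OF b(2)] reg[OF c(2)]
    show "X \<oplus>\<^bsub>tot R\<^esub> Y \<in> carrier (tot R)"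
      unfolding X Y fraction_add[OF a b] by (rule fraction_in_tot) (use a b reg mult in auto)
    have "(a \<otimes> t \<oplus> b \<otimes> s) \<otimes> u \<oplus> c \<otimes> (s \<otimes> t) = a \<otimes> (t \<otimes> u) \<oplus> (b \<otimes> u \<oplus> c \<otimes> t) \<otimes> s"
      using cc by algebra
    moreover have "(s \<otimes> t) \<otimes> u = s \<otimes> (t \<otimes> u)" using cc by (simp add: m_assoc)
    ultimately show "(X \<oplus>\<^bsub>tot R\<^esub> Y) \<oplus>\<^bsub>tot R\<^esub> Z = X \<oplus>\<^bsub>tot R\<^esub> (Y \<oplus>\<^bsub>tot R\<^esub> Z)"
      unfolding X Y Z using a b c reg mult by (simp add: fraction_add)
    have "(a \<otimes> t \<oplus> b \<otimes> s) \<otimes> (t \<otimes> s) = (b \<otimes> s \<oplus> a \<otimes> t) \<otimes> (s \<otimes> t)" using cc by algebra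
    then show "X \<oplus>\<^bsub>tot R\<^esub> Y = Y \<oplus>\<^bsub>tot R\<^esub> X"
      unfolding X Y using a b reg mult by (simp add: fraction_add fraction_eq_iff)
    have "(\<zero> \<otimes> s \<oplus> a \<otimes> \<one>) \<otimes> s = a \<otimes> (\<one> \<otimes> s)" using cc by algebra
    then show "\<zero>\<^bsub>tot R\<^esub> \<oplus>\<^bsub>tot R\<^esub> X = X"
      unfolding X tot_simps(3) using a reg mult one by (simp add: fraction_add fraction_eq_iff)
    have "(\<ominus> a \<otimes> s \<oplus> a \<otimes> s) \<otimes> \<one> = \<zero> \<otimes> (s \<otimes> s)" using cc by algebra
    then have "fraction R (\<ominus> a) s \<oplus>\<^bsub>tot R\<^esub> X = \<zero>\<^bsub>tot R\<^esub>"
      unfolding X tot_simps(3) using a reg mult one by (simp add: fraction_add fraction_eq_iff)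
    then show "\<exists>Y\<in>carrier (tot R). Y \<oplus>\<^bsub>tot R\<^esub> X = \<zero>\<^bsub>tot R\<^esub>"
      using fraction_in_tot[of "\<ominus> a" s] a by blast
  next
    show "\<zero>\<^bsub>tot R\<^esub> \<in> carrier (tot R)" unfolding tot_simps(3) by (rule fraction_in_tot) (use one in auto)
  qed
  moreover have "comm_monoid (tot R)"
  proof (rule comm_monoidI)
    fix X Y Z assume XYZ: "X \<in> carrier (tot R)" "Y \<in> carrier (tot R)" "Z \<in> carrier (tot R)"
    obtain a s where a: "a \<in> carrier R" "s \<in> regular_elements R" and X: "X = fraction R a s"
      using tot_cases[OF XYZ(1)] .
    obtain b t where b: "b \<in> carrier R" "t \<in> regular_elements R" and Y: "Y = fraction R b t"
      using tot_cases[OF XYZ(2)] .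
    obtain c u where c: "c \<in> carrier R" "u \<in> regular_elements R" and Z: "Z = fraction R c u"
      using tot_cases[OF XYZ(3)] .
    note cc = a(1) b(1) c(1) reg[OF a(2)] reg[OF b(2)] reg[OF c(2)]
    show "X \<otimes>\<^bsub>tot R\<^esub> Y \<in> carrier (tot R)"
      unfolding X Y fraction_mult[OF a b] by (rule fraction_in_tot) (use a b reg mult in auto)
    show "(X \<otimes>\<^bsub>tot R\<^esub> Y) \<otimes>\<^bsub>tot R\<^esub> Z = X \<otimes>\<^bsub>tot R\<^esub> (Y \<otimes>\<^bsub>tot R\<^esub> Z)"
      unfolding X Y Z using a b c reg mult by (simp add: fraction_mult m_assoc)
    show "X \<otimes>\<^bsub>tot R\<^esub> Y = Y \<otimes>\<^bsub>tot R\<^esub> X"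
      unfolding X Y using a b reg mult by (simp add: fraction_mult m_comm)
    show "\<one>\<^bsub>tot R\<^esub> \<otimes>\<^bsub>tot R\<^esub> X = X"
      unfolding X tot_simps(2) using a reg mult one by (simp add: fraction_mult)
  next
    show "\<one>\<^bsub>tot R\<^esub> \<in> carrier (tot R)" unfolding tot_simps(2) by (rule fraction_in_tot) (use one in auto)
  qed
  moreover have "(X \<oplus>\<^bsub>tot R\<^esub> Y) \<otimes>\<^bsub>tot R\<^esub> Z = X \<otimes>\<^bsub>tot R\<^esub> Z \<oplus>\<^bsub>tot R\<^esub> Y \<otimes>\<^bsub>tot R\<^esub> Z"
    if XYZ: "X \<in> carrier (tot R)" "Y \<in> carrier (tot R)" "Z \<in> carrier (tot R)" for X Y Z
  proof -
    obtain a s where a: "a \<in> carrier R" "s \<in> regular_elements R" and X: "X = fraction R a s"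
      using tot_cases[OF XYZ(1)] .
    obtain b t where b: "b \<in> carrier R" "t \<in> regular_elements R" and Y: "Y = fraction R b t"
      using tot_cases[OF XYZ(2)] .
    obtain c u where c: "c \<in> carrier R" "u \<in> regular_elements R" and Z: "Z = fraction R c u"
      using tot_cases[OF XYZ(3)] .
    note cc = a(1) b(1) c(1) reg[OF a(2)] reg[OF b(2)] reg[OF c(2)]
    have "((a \<otimes> t \<oplus> b \<otimes> s) \<otimes> c) \<otimes> ((s \<otimes> u) \<otimes> (t \<otimes> u)) =
        ((a \<otimes> c) \<otimes> (t \<otimes> u) \<oplus> (b \<otimes> c) \<otimes> (s \<otimes> u)) \<otimes> ((s \<otimes> t) \<otimes> u)" using cc by algebra
    then show ?thesis
      unfolding X Y Z using a b c reg mult by (simp add: fraction_add fraction_mult fraction_eq_iff)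
  qed
  ultimately show ?thesis by (rule cringI)
qed

lemma tot_embed_hom: "tot_embed R \<in> ring_hom R (tot R)"
proof (rule ring_hom_memI)
  note one = regular_elements_closed(1)
  fix a b assume ab: "a \<in> carrier R" "b \<in> carrier R"
  show "tot_embed R a \<in> carrier (tot R)" unfolding tot_embed_def by (rule fraction_in_tot[OF ab(1) one])
  show "tot_embed R (a \<otimes> b) = tot_embed R a \<otimes>\<^bsub>tot R\<^esub> tot_embed R b"
    unfolding tot_embed_def using ab one by (simp add: fraction_mult)
  show "tot_embed R (a \<oplus> b) = tot_embed R a \<oplus>\<^bsub>tot R\<^esub> tot_embed R b"
    unfolding tot_embed_def using ab one by (simp add: fraction_add)
next
  show "tot_embed R \<one> = \<one>\<^bsub>tot R\<^esub>" by (simp add: tot_embed_def tot_simps)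
qed

lemma tot_embed_inj: "inj_on (tot_embed R) (carrier R)"
  by (rule inj_onI) (simp add: tot_embed_def fraction_eq_iff regular_elements_closed(1))

lemma tot_embed_mult_fraction:
  assumes "a \<in> carrier R" "s \<in> regular_elements R" "b \<in> carrier R"
  shows "tot_embed R b \<otimes>\<^bsub>tot R\<^esub> fraction R a s = fraction R (b \<otimes> a) s"
  unfolding tot_embed_def
  using assms regular_elementsD(1)[OF assms(2)] by (simp add: fraction_mult regular_elements_closed(1))

lemma tot_embed_denominator:
  assumes "X \<in> carrier (tot R)"
  shows "\<exists>s \<in> regular_elements R. \<exists>a \<in> carrier R. tot_embed R s \<otimes>\<^bsub>tot R\<^esub> X = tot_embed R a"
proof -
  obtain a s where a: "a \<in> carrier R" "s \<in> regular_elements R" and X: "X = fraction R a s"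
    using tot_cases[OF assms] .
  have s: "s \<in> carrier R" by (rule regular_elementsD(1)[OF a(2)])
  have "tot_embed R s \<otimes>\<^bsub>tot R\<^esub> X = tot_embed R a"
    unfolding X tot_embed_mult_fraction[OF a s] unfolding tot_embed_def
    using a s by (simp add: fraction_eq_iff regular_elements_closed(1) m_comm)
  then show ?thesis using a by blast
qed

lemma tot_embed_regular:
  assumes r: "r \<in> regular_elements R" and X: "X \<in> carrier (tot R)"
    and z: "tot_embed R r \<otimes>\<^bsub>tot R\<^esub> X = \<zero>\<^bsub>tot R\<^esub>"
  shows "X = \<zero>\<^bsub>tot R\<^esub>"
proof -
  obtain a s where a: "a \<in> carrier R" "s \<in> regular_elements R" and X: "X = fraction R a s"
    using tot_cases[OF X] .
  have c: "r \<in> carrier R" "s \<in> carrier R" using regular_elementsD(1) a r by auto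
  have "fraction R (r \<otimes> a) s = fraction R \<zero> \<one>"
    using z unfolding X tot_embed_mult_fraction[OF a c(1)] tot_simps(3) .
  then have "r \<otimes> a = \<zero>" using a c by (simp add: fraction_eq_iff regular_elements_closed(1))
  then have "a = \<zero>" using regular_elementsD(2)[OF r a(1)] by simp
  then show ?thesis unfolding X tot_simps(3) using a c by (simp add: fraction_eq_iff regular_elements_closed(1))
qed

section \<open>Pruefer rings and the total ring of fractions\<close>

text \<open>
  The inverse of the ideal generated by \<open>S\<close> consists of the fractions \<open>c / r\<close> for which multiplication
  by \<open>c\<close> takes \<open>S\<close> into \<open>r R\<close>.
\<close>

theorem Prufer_ring_iff: "Prufer_ring R \<longleftrightarrow> regular_fg_invertible R"
proof -
  interpret K: cring "tot R" by (rule cring_tot)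
  let ?\<tau> = "tot_embed R"
  interpret \<tau>: ring_hom_cring R "tot R" ?\<tau>
    by unfold_locales (rule tot_embed_hom)
  have inj: "x = y" if "?\<tau> x = ?\<tau> y" "x \<in> carrier R" "y \<in> carrier R" for x y
    using inj_onD[OF tot_embed_inj] that by blast
  have main: "invertible_ideal (Idl S) R \<longleftrightarrow> \<one> \<in> Idl (inverse_products R S r)"
    if S: "S \<subseteq> carrier R" and rS: "r \<in> Idl S" and r: "r \<in> regular_elements R" for S r
  proof
    have I: "ideal (Idl S) R" by (rule genideal_ideal[OF S])
    let ?E = "inverse_products R S r"
    have E: "ideal (Idl ?E) R" by (rule genideal_ideal[OF inverse_products_carrier])
    have rc: "r \<in> carrier R" by (rule regular_elementsD(1)[OF r])
    have SI: "S \<subseteq> Idl S" by (rule genideal_self[OF S])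
    {
      assume "invertible_ideal (Idl S) R"
      then obtain J where J: "submodule J R (scalar_module ?\<tau> (tot R))"
        and eq: "(?\<tau> ` (Idl S)) \<cdot>\<^bsub>tot R\<^esub> J = ?\<tau> ` carrier R" unfolding invertible_ideal_def by blast
      have Jc: "j \<in> carrier (tot R)" if "j \<in> J" for j
        using subgroup.subset[OF submodule.axioms(1)[OF J]] that by (auto simp: scalar_module_def)
      have int: "\<exists>e \<in> carrier R. ?\<tau> a \<otimes>\<^bsub>tot R\<^esub> j = ?\<tau> e" if "a \<in> Idl S" "j \<in> J" for a j
      proof -
        have "?\<tau> a \<otimes>\<^bsub>tot R\<^esub> j \<in> (?\<tau> ` (Idl S)) \<cdot>\<^bsub>tot R\<^esub> J" by (rule ideal_prod.prod) (use that in auto)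
        then show ?thesis unfolding eq by blast
      qed
      have gen: "\<exists>e \<in> Idl ?E. ?\<tau> a \<otimes>\<^bsub>tot R\<^esub> j = ?\<tau> e" if a: "a \<in> Idl S" and j: "j \<in> J" for a j
        using a S
      proof (induction rule: genideal_induct)
        case zero
        have "?\<tau> \<zero> \<otimes>\<^bsub>tot R\<^esub> j = ?\<tau> \<zero>" using Jc[OF j] by simp
        then show ?case using idealD(2)[OF E] by blast
      next
        case (gen a)
        obtain c where c: "c \<in> carrier R" "?\<tau> r \<otimes>\<^bsub>tot R\<^esub> j = ?\<tau> c" using int[OF rS j] by blast
        have cb: "\<exists>d \<in> carrier R. ?\<tau> b \<otimes>\<^bsub>tot R\<^esub> j = ?\<tau> d \<and> c \<otimes> b = r \<otimes> d" if b: "b \<in> S" for b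
        proof -
          have bc: "b \<in> carrier R" using b S by blast
          obtain d where d: "d \<in> carrier R" "?\<tau> b \<otimes>\<^bsub>tot R\<^esub> j = ?\<tau> d" using int[of b j] b SI j by blast
          have "?\<tau> (c \<otimes> b) = (?\<tau> r \<otimes>\<^bsub>tot R\<^esub> j) \<otimes>\<^bsub>tot R\<^esub> ?\<tau> b" using c bc by simp
          also have "\<dots> = ?\<tau> r \<otimes>\<^bsub>tot R\<^esub> (?\<tau> b \<otimes>\<^bsub>tot R\<^esub> j)" using rc bc Jc[OF j] by (simp add: K.m_ac)
          also have "\<dots> = ?\<tau> (r \<otimes> d)" using d rc by simp
          finally have "c \<otimes> b = r \<otimes> d" using inj c bc rc d by simp
          then show ?thesis using d by blast
        qed
        from cb[OF gen] obtain e where e: "e \<in> carrier R" "?\<tau> a \<otimes>\<^bsub>tot R\<^esub> j = ?\<tau> e" "c \<otimes> a = r \<otimes> e" by blast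
        have "\<forall>b \<in> S. \<exists>d \<in> carrier R. c \<otimes> b = r \<otimes> d" using cb by blast
        then have "e \<in> ?E" unfolding inverse_products_def using e c gen by blast
        then show ?case using e genideal_self[OF inverse_products_carrier] by blast
      next
        case (add x y)
        obtain e e' where e: "e \<in> Idl ?E" "?\<tau> x \<otimes>\<^bsub>tot R\<^esub> j = ?\<tau> e" "e' \<in> Idl ?E" "?\<tau> y \<otimes>\<^bsub>tot R\<^esub> j = ?\<tau> e'"
          using add(3,4) by blast
        have "e \<in> carrier R" "e' \<in> carrier R" using e idealD(1)[OF E] by auto
        then have "?\<tau> (x \<oplus> y) \<otimes>\<^bsub>tot R\<^esub> j = ?\<tau> (e \<oplus> e')" using e add Jc[OF j] by (simp add: K.l_distr)
        then show ?case using idealD(3)[OF E e(1,3)] by blast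
      next
        case (mult x t)
        obtain e where e: "e \<in> Idl ?E" "?\<tau> x \<otimes>\<^bsub>tot R\<^esub> j = ?\<tau> e" using mult(3) by blast
        have "e \<in> carrier R" using e idealD(1)[OF E] by auto
        then have "?\<tau> (t \<otimes> x) \<otimes>\<^bsub>tot R\<^esub> j = ?\<tau> (t \<otimes> e)" using e mult Jc[OF j] by (simp add: K.m_assoc)
        then show ?case using idealD(5)[OF E e(1) mult(2)] by blast
      qed
      have "\<exists>e \<in> Idl ?E. x = ?\<tau> e" if "x \<in> (?\<tau> ` (Idl S)) \<cdot>\<^bsub>tot R\<^esub> J" for x
        using that
      proof (induction rule: ideal_prod.induct)
        case (prod i j) then show ?case using gen by blast
      next
        case (sum x y)
        then obtain e e' where e: "e \<in> Idl ?E" "x = ?\<tau> e" "e' \<in> Idl ?E" "y = ?\<tau> e'" by blast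
        have "e \<in> carrier R" "e' \<in> carrier R" using e idealD(1)[OF E] by auto
        then have "x \<oplus>\<^bsub>tot R\<^esub> y = ?\<tau> (e \<oplus> e')" using e by simp
        then show ?case using idealD(3)[OF E e(1,3)] by blast
      qed
      then obtain e where e: "e \<in> Idl ?E" "?\<tau> \<one> = ?\<tau> e" unfolding eq by blast
      then show "\<one> \<in> Idl ?E" using inj[OF e(2)] idealD(1)[OF E] by auto
    }
    assume one: "\<one> \<in> Idl ?E"
    define J where "J = {X \<in> carrier (tot R). \<forall>a \<in> Idl S. ?\<tau> a \<otimes>\<^bsub>tot R\<^esub> X \<in> ?\<tau> ` carrier R}"
    have Ic: "a \<in> carrier R" if "a \<in> Idl S" for a using that idealD(1)[OF I] by blast
    have J0: "\<zero>\<^bsub>tot R\<^esub> \<in> J"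
    proof -
      have "\<zero>\<^bsub>tot R\<^esub> \<in> ?\<tau> ` carrier R" using \<tau>.hom_zero by (metis imageI zero_closed)
      then show ?thesis unfolding J_def using Ic by simp
    qed
    have Jadd: "X \<oplus>\<^bsub>tot R\<^esub> Y \<in> J" if XY: "X \<in> J" "Y \<in> J" for X Y
    proof -
      have c: "X \<in> carrier (tot R)" "Y \<in> carrier (tot R)" using XY by (auto simp: J_def)
      have "?\<tau> a \<otimes>\<^bsub>tot R\<^esub> (X \<oplus>\<^bsub>tot R\<^esub> Y) \<in> ?\<tau> ` carrier R" if a: "a \<in> Idl S" for a
      proof -
        obtain x y where "x \<in> carrier R" "?\<tau> a \<otimes>\<^bsub>tot R\<^esub> X = ?\<tau> x" "y \<in> carrier R" "?\<tau> a \<otimes>\<^bsub>tot R\<^esub> Y = ?\<tau> y"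
          using XY a unfolding J_def by blast
        then have "?\<tau> a \<otimes>\<^bsub>tot R\<^esub> (X \<oplus>\<^bsub>tot R\<^esub> Y) = ?\<tau> (x \<oplus> y)" using c Ic[OF a] by (simp add: K.r_distr)
        then show ?thesis using \<open>x \<in> carrier R\<close> \<open>y \<in> carrier R\<close> by blast
      qed
      then show ?thesis unfolding J_def using c by simp
    qed
    have Jsmult: "?\<tau> t \<otimes>\<^bsub>tot R\<^esub> X \<in> J" if t: "t \<in> carrier R" and X: "X \<in> J" for t X
    proof -
      have c: "X \<in> carrier (tot R)" using X by (auto simp: J_def)
      have "?\<tau> a \<otimes>\<^bsub>tot R\<^esub> (?\<tau> t \<otimes>\<^bsub>tot R\<^esub> X) \<in> ?\<tau> ` carrier R" if a: "a \<in> Idl S" for a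
      proof -
        obtain x where "x \<in> carrier R" "?\<tau> a \<otimes>\<^bsub>tot R\<^esub> X = ?\<tau> x" using X a unfolding J_def by blast
        then have "?\<tau> a \<otimes>\<^bsub>tot R\<^esub> (?\<tau> t \<otimes>\<^bsub>tot R\<^esub> X) = ?\<tau> (t \<otimes> x)"
          using K.m_lcomm[of "?\<tau> a" "?\<tau> t" X] c Ic[OF a] t by simp
        then show ?thesis using \<open>x \<in> carrier R\<close> t by blast
      qed
      then show ?thesis unfolding J_def using c t by simp
    qed
    have Jneg: "\<ominus>\<^bsub>tot R\<^esub> X \<in> J" if X: "X \<in> J" for X
    proof -
      have c: "X \<in> carrier (tot R)" using X by (auto simp: J_def)
      have "?\<tau> (\<ominus> \<one>) \<otimes>\<^bsub>tot R\<^esub> X = \<ominus>\<^bsub>tot R\<^esub> X" using c by (simp add: K.l_minus)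
      then show ?thesis using Jsmult[OF _ X, of "\<ominus> \<one>"] by simp
    qed
    have sub: "submodule J R (scalar_module ?\<tau> (tot R))"
    proof (rule submodule.intro)
      have "subgroup J (add_monoid (tot R))"
        by (rule K.add.subgroupI) (use J0 Jadd Jneg in \<open>auto simp: J_def\<close>)
      then show "subgroup J (add_monoid (scalar_module ?\<tau> (tot R)))"
        unfolding subgroup_def by (simp add: scalar_module_def m_inv_def)
      show "submodule_axioms J R (scalar_module ?\<tau> (tot R))"
        by unfold_locales (use Jsmult in \<open>simp add: scalar_module_def\<close>)
    qed
    let ?P = "(?\<tau> ` (Idl S)) \<cdot>\<^bsub>tot R\<^esub> J"
    have "x \<in> ?\<tau> ` carrier R" if "x \<in> ?P" for x
      using that
    proof (induction rule: ideal_prod.induct)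
      case (prod i j) then show ?case by (auto simp: J_def)
    next
      case (sum x y)
      then obtain p q where "p \<in> carrier R" "x = ?\<tau> p" "q \<in> carrier R" "y = ?\<tau> q" by blast
      then have "x \<oplus>\<^bsub>tot R\<^esub> y = ?\<tau> (p \<oplus> q)" "p \<oplus> q \<in> carrier R" by simp_all
      then show ?case by blast
    qed
    moreover have Pc: "x \<in> carrier (tot R)" if "x \<in> ?P" for x
      using calculation that by auto
    have Psmult: "?\<tau> t \<otimes>\<^bsub>tot R\<^esub> x \<in> ?P" if x: "x \<in> ?P" and t: "t \<in> carrier R" for t x
      using x
    proof (induction rule: ideal_prod.induct)
      case (prod i j)
      then have "i \<in> carrier (tot R)" "j \<in> carrier (tot R)" using Ic by (auto simp: J_def)
      then have "?\<tau> t \<otimes>\<^bsub>tot R\<^esub> (i \<otimes>\<^bsub>tot R\<^esub> j) = i \<otimes>\<^bsub>tot R\<^esub> (?\<tau> t \<otimes>\<^bsub>tot R\<^esub> j)" using t by (simp add: K.m_lcomm)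
      then show ?case using ideal_prod.prod[OF prod(1) Jsmult[OF t prod(2)]] by simp
    next
      case (sum x y)
      then show ?case using ideal_prod.sum[OF sum(3,4)] Pc[OF sum(1)] Pc[OF sum(2)] t
        by (simp add: K.r_distr)
    qed
    have "?\<tau> x \<in> ?P" if "x \<in> Idl ?E" for x
      using that inverse_products_carrier
    proof (induction rule: genideal_induct)
      case zero
      have "?\<tau> \<zero> \<otimes>\<^bsub>tot R\<^esub> \<zero>\<^bsub>tot R\<^esub> \<in> ?P"
        by (rule ideal_prod.prod) (use J0 idealD(2)[OF I] in blast)+
      then show ?case by simp
    next
      case (gen e)
      then obtain a c where e: "e \<in> carrier R" and a: "a \<in> S" and c: "c \<in> carrier R" "c \<otimes> a = r \<otimes> e"
        and cS: "\<forall>b \<in> S. \<exists>d \<in> carrier R. c \<otimes> b = r \<otimes> d" unfolding inverse_products_def by blast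
      have ac: "a \<in> carrier R" using a S by blast
      let ?X = "fraction R c r"
      have Xd: "?\<tau> b \<otimes>\<^bsub>tot R\<^esub> ?X = ?\<tau> d" if "b \<in> carrier R" "d \<in> carrier R" "c \<otimes> b = r \<otimes> d" for b d
        unfolding tot_embed_mult_fraction[OF c(1) r that(1)] unfolding tot_embed_def
        using that c rc r by (simp add: fraction_eq_iff regular_elements_closed(1) m_comm[of b c] m_comm[of d r])
      have "\<exists>d \<in> carrier R. c \<otimes> b = r \<otimes> d" if "b \<in> Idl S" for b
        using that S
      proof (induction rule: genideal_induct)
        case zero
        have "c \<otimes> \<zero> = r \<otimes> \<zero>" using c rc by simp
        then show ?case by blast
      next
        case (gen b) then show ?case using cS by blast
      next
        case (add x y)
        then obtain d d' where "d \<in> carrier R" "c \<otimes> x = r \<otimes> d" "d' \<in> carrier R" "c \<otimes> y = r \<otimes> d'" by blast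
        then have "c \<otimes> (x \<oplus> y) = r \<otimes> (d \<oplus> d')" "d \<oplus> d' \<in> carrier R" using add c rc by (simp_all add: r_distr)
        then show ?case by blast
      next
        case (mult x t)
        then obtain d where d: "d \<in> carrier R" "c \<otimes> x = r \<otimes> d" by blast
        have "c \<otimes> (t \<otimes> x) = t \<otimes> (c \<otimes> x)" using mult c by (simp add: m_lcomm)
        also have "\<dots> = r \<otimes> (t \<otimes> d)" unfolding d(2) using mult d rc by (simp add: m_lcomm)
        finally show ?case using mult d by blast
      qed
      then have "?X \<in> J" unfolding J_def using Xd Ic fraction_in_tot[OF c(1) r] by (simp, metis imageI)
      then have "?\<tau> a \<otimes>\<^bsub>tot R\<^esub> ?X \<in> ?P" by (intro ideal_prod.prod) (use a SI in auto)
      then show ?case using Xd[OF ac e c(2)] by simp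
    next
      case (add x y) then show ?case using ideal_prod.sum[OF add(3,4)] by simp
    next
      case (mult x t) then show ?case using Psmult by simp
    qed
    from Psmult[OF this[OF one]] have "?\<tau> t \<in> ?P" if "t \<in> carrier R" for t
      using that[THEN \<tau>.hom_closed] that by (metis K.r_one \<tau>.hom_one)
    ultimately have "?P = ?\<tau> ` carrier R" by blast
    then show "invertible_ideal (Idl S) R" unfolding invertible_ideal_def using sub by blast
  qed
  show ?thesis
  proof
    assume P: "Prufer_ring R"
    show "regular_fg_invertible R"
      unfolding regular_fg_invertible_def
    proof (intro allI impI, elim conjE)
      fix S r assume S: "finite S" "S \<subseteq> carrier R" "r \<in> Idl S" "r \<in> regular_elements R"
      have "fg_ideal (Idl S) R" unfolding fg_ideal_def using S(1,2) by auto
      moreover have "regular_ideal (Idl S) R"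
        unfolding regular_ideal_def using genideal_ideal[OF S(2)] S(3,4) by auto
      ultimately show "\<one> \<in> Idl (inverse_products R S r)"
        using P main[OF S(2-4)] unfolding Prufer_ring_def by blast
    qed
  next
    assume P: "regular_fg_invertible R"
    show "Prufer_ring R"
      unfolding Prufer_ring_def
    proof (intro allI impI, elim conjE)
      fix I assume "fg_ideal I R" and reg: "regular_ideal I R"
      then obtain S where S: "finite S" "S \<subseteq> carrier R" "I = Idl S" unfolding fg_ideal_def by auto
      obtain r where r: "r \<in> Idl S" "r \<in> regular_elements R"
        using reg S(3) unfolding regular_ideal_def by blast
      then show "invertible_ideal I R"
        using P main[OF S(2) r] S unfolding regular_fg_invertible_def by blast
    qed
  qed
qed

end

section \<open>Homomorphic images\<close>

context ring_hom_cring
begin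

lemma hom_minus: "x \<in> carrier R \<Longrightarrow> y \<in> carrier R \<Longrightarrow> h (x \<ominus> y) = h x \<ominus>\<^bsub>S\<^esub> h y"
  by (simp add: R.minus_eq S.minus_eq)

lemma surj_lift:
  assumes "h ` carrier R = carrier S" "b \<in> carrier S"
  obtains x where "x \<in> carrier R" "h x = b"
proof -
  have "b \<in> h ` carrier R" using assms by simp
  then obtain x where "x \<in> carrier R" "b = h x" by blast
  then show thesis using that[of x] by simp
qed

lemma hom_genideal:
  assumes "x \<in> Idl\<^bsub>R\<^esub> X" "X \<subseteq> carrier R"
  shows "h x \<in> Idl\<^bsub>S\<^esub> (h ` X)"
proof -
  have hX: "h ` X \<subseteq> carrier S" using assms(2) by auto
  note I = S.genideal_ideal[OF hX]
  show ?thesis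
    using assms
  proof (induction rule: R.genideal_induct)
    case zero then show ?case using S.idealD(2)[OF I] by simp
  next
    case (gen s) then show ?case using S.genideal_self[OF hX] by blast
  next
    case (add x y) then show ?case using S.idealD(3)[OF I] by simp
  next
    case (mult x r) then show ?case using S.idealD(5)[OF I] by simp
  qed
qed

lemma hom_genideal_lift:
  assumes "h ` carrier R = carrier S" "X \<subseteq> carrier R" "y \<in> Idl\<^bsub>S\<^esub> (h ` X)"
  shows "\<exists>x \<in> Idl\<^bsub>R\<^esub> X. h x = y"
proof -
  note I = R.genideal_ideal[OF assms(2)]
  have c: "x \<in> carrier R" if "x \<in> Idl\<^bsub>R\<^esub> X" for x using that R.idealD(1)[OF I] by blast
  have hX: "h ` X \<subseteq> carrier S" using assms(2) by auto
  show ?thesis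
    using assms(3) hX
  proof (induction rule: S.genideal_induct)
    case zero
    show ?case using R.idealD(2)[OF I] hom_zero by blast
  next
    case (gen s)
    then show ?case using R.genideal_self[OF assms(2)] by blast
  next
    case (add y z)
    then obtain x w where x: "x \<in> Idl\<^bsub>R\<^esub> X" "h x = y" "w \<in> Idl\<^bsub>R\<^esub> X" "h w = z" by metis
    then have "h (x \<oplus> w) = y \<oplus>\<^bsub>S\<^esub> z" using c by simp
    then show ?case by (rule bexI[OF _ R.idealD(3)[OF I x(1,3)]])
  next
    case (mult y t)
    then obtain x where x: "x \<in> Idl\<^bsub>R\<^esub> X" "h x = y" by blast
    obtain t' where t': "t' \<in> carrier R" "h t' = t" by (rule surj_lift[OF assms(1) mult(2)])
    have "h (t' \<otimes> x) = t \<otimes>\<^bsub>S\<^esub> y" using c x t' by simp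
    then show ?case by (rule bexI[OF _ R.idealD(5)[OF I x(1) t'(1)]])
  qed
qed

lemma comaximal_quotients_image:
  assumes surj: "h ` carrier R = carrier S" and cq: "comaximal_quotients R"
  shows "comaximal_quotients S"
proof (rule S.comaximal_quotientsI)
  fix a b assume ab: "a \<in> carrier S" "b \<in> carrier S"
  obtain x where x: "x \<in> carrier R" "h x = a" by (rule surj_lift[OF surj ab(1)])
  obtain y where y: "y \<in> carrier R" "h y = b" by (rule surj_lift[OF surj ab(2)])
  obtain u v w where u: "u \<in> carrier R" "v \<in> carrier R" "w \<in> carrier R"
    and eq: "u \<otimes> x = v \<otimes> y" "(\<one> \<ominus> u) \<otimes> y = w \<otimes> x"
    by (rule R.comaximal_quotientsD[OF cq x(1) y(1)])
  have "h (u \<otimes> x) = h (v \<otimes> y)" "h ((\<one> \<ominus> u) \<otimes> y) = h (w \<otimes> x)" by (simp_all only: eq)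
  then have "h u \<otimes>\<^bsub>S\<^esub> a = h v \<otimes>\<^bsub>S\<^esub> b" "(\<one>\<^bsub>S\<^esub> \<ominus>\<^bsub>S\<^esub> h u) \<otimes>\<^bsub>S\<^esub> b = h w \<otimes>\<^bsub>S\<^esub> a"
    using u x y by (simp_all add: hom_minus)
  then show "\<exists>u \<in> carrier S. \<exists>v \<in> carrier S. \<exists>w \<in> carrier S.
      u \<otimes>\<^bsub>S\<^esub> a = v \<otimes>\<^bsub>S\<^esub> b \<and> (\<one>\<^bsub>S\<^esub> \<ominus>\<^bsub>S\<^esub> u) \<otimes>\<^bsub>S\<^esub> b = w \<otimes>\<^bsub>S\<^esub> a"
    using hom_closed u by blast
qed

lemma Gaussian_image:
  assumes surj: "h ` carrier R = carrier S" and G: "Gaussian_ring R"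
  shows "Gaussian_ring S"
  unfolding S.Gaussian_ring_iff
proof (intro ballI allI)
  fix f g :: "nat \<Rightarrow> 'c" and i j :: nat
  assume f: "f \<in> up S" and g: "g \<in> up S"
  have lift: "\<exists>f' \<in> up R. \<forall>k. h (f' k) = f k" if f: "f \<in> up S" for f :: "nat \<Rightarrow> 'c"
  proof -
    have fc: "f k \<in> carrier S" for k using f by (auto simp: S.mem_up_iff)
    obtain n where n: "\<forall>m>n. f m = \<zero>\<^bsub>S\<^esub>" using f by (auto simp: S.mem_up_iff)
    have "\<exists>x. x \<in> carrier R \<and> h x = f k" for k by (rule surj_lift[OF surj fc[of k]]) blast
    then obtain p where p: "\<And>k. p k \<in> carrier R" "\<And>k. h (p k) = f k" by metis
    let ?p = "\<lambda>k. if k \<le> n then p k else \<zero>"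
    have "?p \<in> up R" using p by (auto simp: R.mem_up_iff intro!: exI[of _ n])
    moreover have "h (?p k) = f k" for k using p n by simp
    ultimately show ?thesis by (intro bexI[of _ ?p] allI)
  qed
  obtain f' where f': "f' \<in> up R" "\<And>k. h (f' k) = f k" using lift[OF f] by blast
  obtain g' where g': "g' \<in> up R" "\<And>k. h (g' k) = g k" using lift[OF g] by blast
  have fc: "f' k \<in> carrier R" and gc: "g' k \<in> carrier R" for k using f'(1) g'(1) by (auto simp: R.mem_up_iff)
  have "h (convolution R f' g' n) = convolution S f g n" for n
  proof -
    have "h (convolution R f' g' n) = (\<Oplus>\<^bsub>S\<^esub>k \<in> {..n}. (h \<circ> (\<lambda>k. f' k \<otimes> g' (n - k))) k)"
      unfolding convolution_def by (rule hom_finsum) (use fc gc in auto)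
    then show ?thesis using fc gc f'(2) g'(2) by (simp add: convolution_def)
  qed
  then have im: "h ` range (convolution R f' g') = range (convolution S f g)" by (auto simp: image_iff)
  have "f' i \<otimes> g' j \<in> Idl\<^bsub>R\<^esub> (range (convolution R f' g'))"
    using G f'(1) g'(1) unfolding R.Gaussian_ring_iff by blast
  moreover have "range (convolution R f' g') \<subseteq> carrier R"
    using R.range_convolution_subset[of f' g'] fc gc by auto
  ultimately have "h (f' i \<otimes> g' j) \<in> Idl\<^bsub>S\<^esub> (h ` range (convolution R f' g'))" by (rule hom_genideal)
  then show "f i \<otimes>\<^bsub>S\<^esub> g j \<in> Idl\<^bsub>S\<^esub> (range (convolution S f g))"
    using fc gc f'(2) g'(2) unfolding im by simp
qed

end

section \<open>Regular pullbacks\<close>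

text \<open>
  Here \<open>K\<close> stands for the total ring of fractions of \<open>R\<close> with embedding \<open>\<tau>\<close>, the image of \<open>\<pi>\<close> is an
  overring of \<open>R\<close>, and \<open>s\<close> is a regular element of the kernel of \<open>\<pi>\<close>.
\<close>

locale regular_pullback = B?: cring B + R: cring R + K: cring K for B (structure) and R and K +
  fixes \<pi> \<tau> s
  assumes \<pi>_hom: "\<pi> \<in> ring_hom B K" and \<tau>_hom: "\<tau> \<in> ring_hom R K"
    and \<tau>_inj: "inj_on \<tau> (carrier R)" and \<tau>_image: "\<tau> ` carrier R \<subseteq> \<pi> ` carrier B"
    and \<tau>_denominator: "\<And>x. x \<in> carrier B \<Longrightarrow>
      \<exists>r \<in> regular_elements R. \<exists>a \<in> carrier R. \<tau> r \<otimes>\<^bsub>K\<^esub> \<pi> x = \<tau> a"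
    and \<tau>_regular: "\<And>r X. r \<in> regular_elements R \<Longrightarrow> X \<in> carrier K \<Longrightarrow> \<tau> r \<otimes>\<^bsub>K\<^esub> X = \<zero>\<^bsub>K\<^esub> \<Longrightarrow> X = \<zero>\<^bsub>K\<^esub>"
    and s_regular: "s \<in> regular_elements B" and \<pi>_s: "\<pi> s = \<zero>\<^bsub>K\<^esub>"

sublocale regular_pullback \<subseteq> \<pi>: ring_hom_cring B K \<pi>
  by unfold_locales (rule \<pi>_hom)

sublocale regular_pullback \<subseteq> \<tau>: ring_hom_cring R K \<tau>
  by unfold_locales (rule \<tau>_hom)

context regular_pullback
begin

definition pullback :: "'a set" where
  "pullback = {x \<in> carrier B. \<pi> x \<in> \<tau> ` carrier R}"

abbreviation A :: "('a, 'b) ring_scheme" where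
  "A \<equiv> B\<lparr>carrier := pullback\<rparr>"

lemma pullbackI: "x \<in> carrier B \<Longrightarrow> c \<in> carrier R \<Longrightarrow> \<pi> x = \<tau> c \<Longrightarrow> x \<in> pullback"
  by (auto simp: pullback_def)

lemma pullback_carrier: "x \<in> pullback \<Longrightarrow> x \<in> carrier B"
  by (auto simp: pullback_def)

lemma subring_pullback: "subring pullback B"
proof (rule B.subringI)
  show "pullback \<subseteq> carrier B" by (auto simp: pullback_def)
  show "\<one> \<in> pullback" by (rule pullbackI[of _ "\<one>\<^bsub>R\<^esub>"]) auto
  fix x assume "x \<in> pullback"
  then obtain c where x: "x \<in> carrier B" "c \<in> carrier R" "\<pi> x = \<tau> c" by (auto simp: pullback_def)
  then show "\<ominus> x \<in> pullback" by (intro pullbackI[of _ "\<ominus>\<^bsub>R\<^esub> c"]) auto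
  fix y assume "y \<in> pullback"
  then obtain d where y: "y \<in> carrier B" "d \<in> carrier R" "\<pi> y = \<tau> d" by (auto simp: pullback_def)
  show "x \<otimes> y \<in> pullback" using x y by (intro pullbackI[of _ "c \<otimes>\<^bsub>R\<^esub> d"]) auto
  show "x \<oplus> y \<in> pullback" using x y by (intro pullbackI[of _ "c \<oplus>\<^bsub>R\<^esub> d"]) auto
qed

lemma kernel_pullback: "x \<in> carrier B \<Longrightarrow> \<pi> x = \<zero>\<^bsub>K\<^esub> \<Longrightarrow> x \<in> pullback"
  by (rule pullbackI[of _ "\<zero>\<^bsub>R\<^esub>"]) auto

lemma s_carrier: "s \<in> carrier B"
  by (rule B.regular_elementsD(1)[OF s_regular])

lemma s_mult: "x \<in> carrier B \<Longrightarrow> s \<otimes> x \<in> pullback"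
  by (rule kernel_pullback) (simp_all add: s_carrier \<pi>_s)

lemma s_pullback: "s \<in> pullback"
  by (rule kernel_pullback[OF s_carrier \<pi>_s])

lemma s_cancel: "x \<in> carrier B \<Longrightarrow> y \<in> carrier B \<Longrightarrow> s \<otimes> x = s \<otimes> y \<Longrightarrow> x = y"
  by (rule B.regular_elementsD(3)[OF s_regular])

lemma cring_A: "cring A"
  by (rule B.subring_cring[OF subring_pullback])

lemma regular_pullback_iff:
  assumes "x \<in> pullback"
  shows "x \<in> regular_elements A \<longleftrightarrow> x \<in> regular_elements B"
proof
  assume x: "x \<in> regular_elements A"
  have xc: "x \<in> carrier B" using assms pullback_carrier by blast
  show "x \<in> regular_elements B"
  proof (rule B.regular_elementsI[OF xc])
    fix y assume y: "y \<in> carrier B" "x \<otimes> y = \<zero>"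
    have "x \<otimes> (s \<otimes> y) = s \<otimes> (x \<otimes> y)" using xc y(1) s_carrier by (simp add: m_lcomm)
    then have "x \<otimes> (s \<otimes> y) = \<zero>" using y s_carrier by simp
    then have "s \<otimes> y = \<zero>" using x s_mult[OF y(1)] by (auto simp: regular_elements_def)
    then show "y = \<zero>" using B.regular_elementsD(2)[OF s_regular y(1)] by blast
  qed
next
  assume "x \<in> regular_elements B"
  then show "x \<in> regular_elements A" using assms pullback_carrier by (auto simp: regular_elements_def)
qed

definition \<rho> :: "'a \<Rightarrow> 'c" where
  "\<rho> x = inv_into (carrier R) \<tau> (\<pi> x)"

lemma \<rho>:
  assumes "x \<in> pullback" shows "\<rho> x \<in> carrier R" "\<tau> (\<rho> x) = \<pi> x"
  using assms inv_into_into[of "\<pi> x" \<tau> "carrier R"] f_inv_into_f[of "\<pi> x" \<tau> "carrier R"]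
  unfolding \<rho>_def pullback_def by auto

lemma \<rho>_eqI:
  assumes "x \<in> pullback" "c \<in> carrier R" "\<pi> x = \<tau> c" shows "\<rho> x = c"
  using inj_onD[OF \<tau>_inj, of "\<rho> x" c] \<rho>[OF assms(1)] assms(2,3) by simp

lemma \<rho>_hom_cring: "ring_hom_cring A R \<rho>"
proof -
  interpret A: cring A by (rule cring_A)
  note sub = subringE[OF subring_pullback]
  show ?thesis
  proof unfold_locales
    show "\<rho> \<in> ring_hom A R"
    proof (rule ring_hom_memI)
      fix x y assume "x \<in> carrier A" "y \<in> carrier A"
      then have xy: "x \<in> pullback" "y \<in> pullback" by auto
      show "\<rho> x \<in> carrier R" by (rule \<rho>(1)[OF xy(1)])
      show "\<rho> (x \<otimes>\<^bsub>A\<^esub> y) = \<rho> x \<otimes>\<^bsub>R\<^esub> \<rho> y"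
        using \<rho> xy sub(6) pullback_carrier by (simp add: \<rho>_eqI)
      show "\<rho> (x \<oplus>\<^bsub>A\<^esub> y) = \<rho> x \<oplus>\<^bsub>R\<^esub> \<rho> y"
        using \<rho> xy sub(7) pullback_carrier by (simp add: \<rho>_eqI)
    next
      show "\<rho> \<one>\<^bsub>A\<^esub> = \<one>\<^bsub>R\<^esub>" using sub(3) by (simp add: \<rho>_eqI)
    qed
  qed
qed

lemma lift_pullback:
  assumes "c \<in> carrier R" shows "\<exists>x \<in> pullback. \<pi> x = \<tau> c"
proof -
  obtain x where "x \<in> carrier B" "\<tau> c = \<pi> x" using \<tau>_image assms by blast
  then show ?thesis using pullbackI[of x c] assms by auto
qed

lemma \<rho>_surj: "\<rho> ` carrier A = carrier R"
proof
  show "\<rho> ` carrier A \<subseteq> carrier R" using \<rho>(1) by auto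
  show "carrier R \<subseteq> \<rho> ` carrier A"
  proof
    fix c assume c: "c \<in> carrier R"
    then obtain x where "x \<in> pullback" "\<pi> x = \<tau> c" using lift_pullback by blast
    then show "c \<in> \<rho> ` carrier A" using \<rho>_eqI[of x c] c by force
  qed
qed

lemma common_\<tau>_denominator:
  assumes "finite F" "F \<subseteq> carrier B"
  shows "\<exists>r \<in> regular_elements R. \<forall>x \<in> F. \<exists>a \<in> carrier R. \<tau> r \<otimes>\<^bsub>K\<^esub> \<pi> x = \<tau> a"
  using assms
proof (induction F)
  case empty
  then show ?case using R.regular_elements_closed(1) by blast
next
  case (insert x F)
  then obtain r where r: "r \<in> regular_elements R" "\<forall>y \<in> F. \<exists>a \<in> carrier R. \<tau> r \<otimes>\<^bsub>K\<^esub> \<pi> y = \<tau> a" by auto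
  obtain t a where t: "t \<in> regular_elements R" "a \<in> carrier R" "\<tau> t \<otimes>\<^bsub>K\<^esub> \<pi> x = \<tau> a"
    using \<tau>_denominator[of x] insert by auto
  have c: "r \<in> carrier R" "t \<in> carrier R" using r t R.regular_elementsD(1) by auto
  have "\<exists>b \<in> carrier R. \<tau> (r \<otimes>\<^bsub>R\<^esub> t) \<otimes>\<^bsub>K\<^esub> \<pi> y = \<tau> b" if y: "y \<in> insert x F" for y
  proof (cases "y = x")
    case True
    have "\<tau> (r \<otimes>\<^bsub>R\<^esub> t) \<otimes>\<^bsub>K\<^esub> \<pi> x = \<tau> (r \<otimes>\<^bsub>R\<^esub> a)"
      using c t insert by (simp add: K.m_assoc)
    then show ?thesis using True c t by blast
  next
    case False
    then obtain b where b: "b \<in> carrier R" "\<tau> r \<otimes>\<^bsub>K\<^esub> \<pi> y = \<tau> b" using r y by blast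
    have yc: "\<pi> y \<in> carrier K" using y insert by auto
    have "\<tau> (r \<otimes>\<^bsub>R\<^esub> t) \<otimes>\<^bsub>K\<^esub> \<pi> y = \<tau> t \<otimes>\<^bsub>K\<^esub> (\<tau> r \<otimes>\<^bsub>K\<^esub> \<pi> y)"
      using c yc by (simp add: K.m_ac)
    also have "\<dots> = \<tau> (t \<otimes>\<^bsub>R\<^esub> b)" using b c by simp
    finally show ?thesis using b c by blast
  qed
  then show ?case using R.regular_elements_closed(2)[OF r(1) t(1)] by blast
qed

text \<open>
  Elements \<open>x \<in> F\<close> have images \<open>a\<^sub>x / r\<close> in \<open>K\<close>.  The numerators generate a regular ideal of \<open>R\<close>,
  since \<open>1 \<in> F\<close>; its inverse consists of multipliers that lift to elements \<open>w\<close> of \<open>A\<close> with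
  \<open>w F \<subseteq> A\<close>, and invertibility says that the products \<open>w l\<close> generate \<open>A\<close> modulo the kernel of \<open>\<pi>\<close>.
  The kernel itself consists of such products, with \<open>l = 1\<close>.
\<close>

theorem Prufer_extension_pullback:
  assumes rf: "regular_fg_invertible R"
  shows "Prufer_extension B pullback"
proof (rule Prufer_extension.intro, rule B.is_cring, rule Prufer_extension_axioms.intro)
  show "subring pullback B" by (rule subring_pullback)
  fix m F
  assume m: "ideal m A" and m1: "\<one> \<notin> m" and F: "finite F" "F \<subseteq> carrier B" "\<one> \<in> F"
  interpret A: cring A by (rule cring_A)
  note md = A.idealD[OF m]
  note sub = subringE[OF subring_pullback]
  show "\<exists>w \<in> pullback. \<exists>l \<in> F. (\<forall>x \<in> F. w \<otimes> x \<in> pullback) \<and> w \<otimes> l \<notin> m"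
  proof (rule ccontr)
    assume "\<not> ?thesis"
    then have neg: "w \<otimes> l \<in> m" if "w \<in> pullback" "l \<in> F" "\<And>x. x \<in> F \<Longrightarrow> w \<otimes> x \<in> pullback" for w l
      using that by blast
    have ker: "w \<in> m" if w: "w \<in> carrier B" "\<pi> w = \<zero>\<^bsub>K\<^esub>" for w
    proof -
      have "w \<otimes> x \<in> pullback" if "x \<in> F" for x
        by (rule kernel_pullback) (use w F that in auto)
      then have "w \<otimes> \<one> \<in> m" by (rule neg[OF kernel_pullback[OF w] F(3)])
      then show ?thesis using w by simp
    qed
    obtain r where r: "r \<in> regular_elements R"
      and "\<forall>x \<in> F. \<exists>a. a \<in> carrier R \<and> \<tau> r \<otimes>\<^bsub>K\<^esub> \<pi> x = \<tau> a"
      using common_\<tau>_denominator[OF F(1,2)] by blast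
    from bchoice[OF this(2)] obtain a where a: "\<And>x. x \<in> F \<Longrightarrow> a x \<in> carrier R"
      and ra: "\<And>x. x \<in> F \<Longrightarrow> \<tau> r \<otimes>\<^bsub>K\<^esub> \<pi> x = \<tau> (a x)" by blast
    have rc: "r \<in> carrier R" by (rule R.regular_elementsD(1)[OF r])
    have \<tau>_cancel: "X = Y" if "X \<in> carrier K" "Y \<in> carrier K" "\<tau> r \<otimes>\<^bsub>K\<^esub> X = \<tau> r \<otimes>\<^bsub>K\<^esub> Y" for X Y
    proof -
      have "\<tau> r \<in> carrier K" using rc by simp
      then have "\<tau> r \<otimes>\<^bsub>K\<^esub> (X \<ominus>\<^bsub>K\<^esub> Y) = \<tau> r \<otimes>\<^bsub>K\<^esub> X \<ominus>\<^bsub>K\<^esub> \<tau> r \<otimes>\<^bsub>K\<^esub> Y"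
        using that(1,2) by (simp add: K.minus_eq K.r_distr K.r_minus)
      then have "\<tau> r \<otimes>\<^bsub>K\<^esub> (X \<ominus>\<^bsub>K\<^esub> Y) = \<zero>\<^bsub>K\<^esub>" using that rc by simp
      then have "X \<ominus>\<^bsub>K\<^esub> Y = \<zero>\<^bsub>K\<^esub>" using \<tau>_regular[OF r] that by simp
      then show ?thesis using that by simp
    qed
    have "\<tau> (a \<one>) = \<tau> r" using ra[OF F(3)] rc by simp
    then have "a \<one> = r" using inj_onD[OF \<tau>_inj] a[OF F(3)] rc by blast
    then have rF: "r \<in> a ` F" using F(3) by blast
    have aF: "finite (a ` F)" "a ` F \<subseteq> carrier R" using F a by auto
    have "r \<in> Idl\<^bsub>R\<^esub> (a ` F)" using R.genideal_self[OF aF(2)] rF by blast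
    then have one: "\<one>\<^bsub>R\<^esub> \<in> Idl\<^bsub>R\<^esub> (inverse_products R (a ` F) r)"
      using rf aF r unfolding regular_fg_invertible_def by blast
    have mc: "x \<in> carrier B" if "x \<in> m" for x using that md(1) pullback_carrier by auto
    have "\<exists>x \<in> m. \<pi> x = \<tau> e" if "e \<in> Idl\<^bsub>R\<^esub> (inverse_products R (a ` F) r)" for e
      using that R.inverse_products_carrier
    proof (induction rule: R.genideal_induct)
      case zero
      have "\<zero> \<in> m" using md(2) by simp
      then show ?case by (intro bexI[of _ \<zero>]) auto
    next
      case (gen e)
      then obtain l c where e: "e \<in> carrier R" and l: "l \<in> F" and c: "c \<in> carrier R" "c \<otimes>\<^bsub>R\<^esub> a l = r \<otimes>\<^bsub>R\<^esub> e"
        and cF: "\<forall>x \<in> F. \<exists>d \<in> carrier R. c \<otimes>\<^bsub>R\<^esub> a x = r \<otimes>\<^bsub>R\<^esub> d" unfolding inverse_products_def by auto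
      obtain w where w: "w \<in> pullback" "\<pi> w = \<tau> c" using lift_pullback[OF c(1)] by blast
      have wc: "w \<in> carrier B" using pullback_carrier[OF w(1)] .
      have wx: "\<pi> (w \<otimes> x) = \<tau> d" if x: "x \<in> F" and d: "d \<in> carrier R" "c \<otimes>\<^bsub>R\<^esub> a x = r \<otimes>\<^bsub>R\<^esub> d" for x d
      proof (rule \<tau>_cancel)
        have xc: "x \<in> carrier B" using x F by blast
        have "\<tau> r \<otimes>\<^bsub>K\<^esub> \<pi> (w \<otimes> x) = \<tau> c \<otimes>\<^bsub>K\<^esub> (\<tau> r \<otimes>\<^bsub>K\<^esub> \<pi> x)"
          using wc xc w c rc by (simp add: K.m_lcomm)
        also have "\<dots> = \<tau> (c \<otimes>\<^bsub>R\<^esub> a x)" using ra[OF x] a[OF x] c by simp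
        also have "\<dots> = \<tau> r \<otimes>\<^bsub>K\<^esub> \<tau> d" unfolding d(2) using rc d by simp
        finally show "\<tau> r \<otimes>\<^bsub>K\<^esub> \<pi> (w \<otimes> x) = \<tau> r \<otimes>\<^bsub>K\<^esub> \<tau> d" .
        show "\<pi> (w \<otimes> x) \<in> carrier K" "\<tau> d \<in> carrier K" using wc xc d by simp_all
      qed
      have "w \<otimes> x \<in> pullback" if x: "x \<in> F" for x
      proof -
        obtain d where d: "d \<in> carrier R" "c \<otimes>\<^bsub>R\<^esub> a x = r \<otimes>\<^bsub>R\<^esub> d" using cF x by blast
        show ?thesis by (rule pullbackI[OF _ d(1) wx[OF x d]]) (use wc x F in auto)
      qed
      then have "w \<otimes> l \<in> m" by (rule neg[OF w(1) l])
      then show ?case using wx[OF l e c(2)] by blast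
    next
      case (add e e')
      then obtain x y where x: "x \<in> m" "\<pi> x = \<tau> e" "y \<in> m" "\<pi> y = \<tau> e'" by blast
      have "\<pi> (x \<oplus> y) = \<tau> (e \<oplus>\<^bsub>R\<^esub> e')" using x mc add by simp
      moreover have "x \<oplus> y \<in> m" using md(3)[OF x(1,3)] by simp
      ultimately show ?case by blast
    next
      case (mult e t)
      then obtain x where x: "x \<in> m" "\<pi> x = \<tau> e" by blast
      obtain t' where t': "t' \<in> pullback" "\<pi> t' = \<tau> t" using lift_pullback mult(2) by blast
      have "\<pi> (t' \<otimes> x) = \<tau> (t \<otimes>\<^bsub>R\<^esub> e)" using x mc mult t' pullback_carrier by simp
      moreover have "t' \<otimes> x \<in> m" using md(5)[OF x(1), of t'] t' by simp
      ultimately show ?case by blast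
    qed
    from this[OF one] obtain x where x: "x \<in> m" "\<pi> x = \<one>\<^bsub>K\<^esub>" by auto
    have xc: "x \<in> carrier B" using mc[OF x(1)] .
    have "\<pi> (\<one> \<ominus> x) = \<zero>\<^bsub>K\<^esub>" using x xc by (simp add: \<pi>.hom_minus)
    then have "\<one> \<ominus> x \<in> m" using ker xc by simp
    then have "(\<one> \<ominus> x) \<oplus> x \<in> m" using md(3)[of "\<one> \<ominus> x" x] x(1) by simp
    moreover have "(\<one> \<ominus> x) \<oplus> x = \<one>" using xc by algebra
    ultimately show False using m1 by simp
  qed
qed

text \<open>Properties of \<open>A\<close> pass to \<open>B\<close> because multiplication by \<open>s\<close> embeds \<open>B\<close> into \<open>A\<close>.\<close>

lemma comaximal_quotients_from_pullback:
  assumes cq: "comaximal_quotients A"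
  shows "comaximal_quotients B" "comaximal_quotients R"
proof -
  interpret A: cring A by (rule cring_A)
  interpret \<rho>: ring_hom_cring A R \<rho> by (rule \<rho>_hom_cring)
  show "comaximal_quotients R" by (rule \<rho>.comaximal_quotients_image[OF \<rho>_surj cq])
  show "comaximal_quotients B"
  proof (rule B.comaximal_quotientsI)
    fix a b assume ab: "a \<in> carrier B" "b \<in> carrier B"
    have "s \<otimes> a \<in> carrier A" "s \<otimes> b \<in> carrier A" using s_mult ab by auto
    then obtain u v w where u: "u \<in> pullback" "v \<in> pullback" "w \<in> pullback"
      and eq: "u \<otimes> (s \<otimes> a) = v \<otimes> (s \<otimes> b)" "(\<one> \<ominus>\<^bsub>A\<^esub> u) \<otimes> (s \<otimes> b) = w \<otimes> (s \<otimes> a)"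
      using A.comaximal_quotientsD[OF cq, of "s \<otimes> a" "s \<otimes> b"] by auto
    have c: "u \<in> carrier B" "v \<in> carrier B" "w \<in> carrier B" using u pullback_carrier by auto
    have "\<one> \<ominus>\<^bsub>A\<^esub> u = \<one> \<ominus> u"
      by (rule B.subring_minus[OF subring_pullback _ u(1)]) (rule subringE(3)[OF subring_pullback])
    then have eq2: "(\<one> \<ominus> u) \<otimes> (s \<otimes> b) = w \<otimes> (s \<otimes> a)" using eq(2) by simp
    have "s \<otimes> (u \<otimes> a) = s \<otimes> (v \<otimes> b)" using eq(1) c ab s_carrier by (simp add: m_lcomm)
    then have 1: "u \<otimes> a = v \<otimes> b" using s_cancel c ab by simp
    have "s \<otimes> ((\<one> \<ominus> u) \<otimes> b) = (\<one> \<ominus> u) \<otimes> (s \<otimes> b)" using c ab s_carrier by (simp add: m_lcomm)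
    also have "\<dots> = s \<otimes> (w \<otimes> a)" unfolding eq2 using c ab s_carrier by (simp add: m_lcomm)
    finally have "(\<one> \<ominus> u) \<otimes> b = w \<otimes> a" using s_cancel c ab by simp
    then show "\<exists>u \<in> carrier B. \<exists>v \<in> carrier B. \<exists>w \<in> carrier B. u \<otimes> a = v \<otimes> b \<and> (\<one> \<ominus> u) \<otimes> b = w \<otimes> a"
      using 1 c by blast
  qed
qed

lemma Gaussian_from_pullback:
  assumes G: "Gaussian_ring A"
  shows "Gaussian_ring B" "Gaussian_ring R"
proof -
  interpret A: cring A by (rule cring_A)
  interpret \<rho>: ring_hom_cring A R \<rho> by (rule \<rho>_hom_cring)
  show "Gaussian_ring R" by (rule \<rho>.Gaussian_image[OF \<rho>_surj G])
  show "Gaussian_ring B"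
    unfolding B.Gaussian_ring_iff
  proof (intro ballI allI)
    fix f g :: "nat \<Rightarrow> 'a" and i j :: nat
    assume f: "f \<in> up B" and g: "g \<in> up B"
    have fc: "f k \<in> carrier B" and gc: "g k \<in> carrier B" for k using f g by (auto simp: B.mem_up_iff)
    let ?f = "\<lambda>k. s \<otimes> f k" and ?g = "\<lambda>k. s \<otimes> g k"
    have scale: "(\<lambda>k. s \<otimes> p k) \<in> up A" if p: "p \<in> up B" for p :: "nat \<Rightarrow> 'a"
    proof -
      obtain n where "\<forall>m>n. p m = \<zero>" using p by (auto simp: B.mem_up_iff)
      then have "\<forall>m>n. s \<otimes> p m = \<zero>" using s_carrier by simp
      moreover have "s \<otimes> p k \<in> pullback" for k using p s_mult by (auto simp: B.mem_up_iff)
      ultimately show ?thesis unfolding A.mem_up_iff by auto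
    qed
    note up = scale[OF f] scale[OF g]
    have ss: "(s \<otimes> f k) \<otimes> (s \<otimes> g h) = (s \<otimes> s) \<otimes> (f k \<otimes> g h)" for k h
      using fc[of k] gc[of h] s_carrier by (simp add: m_ac)
    have conv: "convolution A ?f ?g n = (s \<otimes> s) \<otimes> convolution B f g n" for n
    proof -
      have "convolution A ?f ?g n = (\<Oplus>k \<in> {..n}. (s \<otimes> f k) \<otimes> (s \<otimes> g (n - k)))"
        unfolding convolution_def using B.subring_finsum[OF subring_pullback, of "\<lambda>k. (s \<otimes> f k) \<otimes> (s \<otimes> g (n - k))" "{..n}"]
          s_mult fc gc subringE(6)[OF subring_pullback] by simp
      also have "\<dots> = (\<Oplus>k \<in> {..n}. (s \<otimes> s) \<otimes> (f k \<otimes> g (n - k)))" by (simp only: ss)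
      also have "\<dots> = (s \<otimes> s) \<otimes> convolution B f g n"
        unfolding convolution_def by (rule B.finsum_rdistr[symmetric]) (use fc gc s_carrier in auto)
      finally show ?thesis .
    qed
    let ?C = "Idl\<^bsub>B\<^esub> (range (convolution B f g))"
    have rB: "range (convolution B f g) \<subseteq> carrier B" using B.range_convolution_subset fc gc by auto
    have C: "ideal ?C B" by (rule B.genideal_ideal[OF rB])
    have Cc: "y \<in> carrier B" if "y \<in> ?C" for y using that B.idealD(1)[OF C] by blast
    have rA: "range (convolution A ?f ?g) \<subseteq> carrier A"
      using A.range_convolution_subset up unfolding A.mem_up_iff by blast
    have "\<exists>y \<in> ?C. x = (s \<otimes> s) \<otimes> y" if "x \<in> Idl\<^bsub>A\<^esub> (range (convolution A ?f ?g))" for x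
      using that rA
    proof (induction rule: A.genideal_induct)
      case zero
      have "\<zero> = (s \<otimes> s) \<otimes> \<zero>" using s_carrier by simp
      then show ?case using B.idealD(2)[OF C] by auto
    next
      case (gen x)
      then obtain n where "x = (s \<otimes> s) \<otimes> convolution B f g n" using conv by auto
      then show ?case using B.genideal_self[OF rB] by blast
    next
      case (add x y)
      then obtain p q where p: "p \<in> ?C" "x = (s \<otimes> s) \<otimes> p" "q \<in> ?C" "y = (s \<otimes> s) \<otimes> q" by blast
      have "x \<oplus> y = (s \<otimes> s) \<otimes> (p \<oplus> q)" using p Cc s_carrier by (simp add: r_distr)
      then show ?case using B.idealD(3)[OF C p(1,3)] by auto
    next
      case (mult x t)
      then obtain p where p: "p \<in> ?C" "x = (s \<otimes> s) \<otimes> p" by blast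
      have t: "t \<in> carrier B" using mult pullback_carrier by simp
      have "t \<otimes> x = (s \<otimes> s) \<otimes> (t \<otimes> p)" unfolding p(2) using Cc[OF p(1)] t s_carrier by (simp add: m_ac)
      then show ?case using B.idealD(5)[OF C p(1) t] by auto
    qed
    moreover have "?f i \<otimes> ?g j \<in> Idl\<^bsub>A\<^esub> (range (convolution A ?f ?g))"
      using G[unfolded A.Gaussian_ring_iff, rule_format, OF up, of i j] by simp
    ultimately obtain y where y: "y \<in> ?C" "?f i \<otimes> ?g j = (s \<otimes> s) \<otimes> y" by blast
    have "s \<otimes> (s \<otimes> (f i \<otimes> g j)) = s \<otimes> (s \<otimes> y)"
      using y(2) ss[of i j] fc[of i] gc[of j] Cc[OF y(1)] s_carrier by (simp add: m_assoc)
    then have "f i \<otimes> g j = y"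
      using s_cancel[of "s \<otimes> (f i \<otimes> g j)" "s \<otimes> y"] s_cancel[of "f i \<otimes> g j" y]
        fc[of i] gc[of j] Cc[OF y(1)] s_carrier by simp
    then show "f i \<otimes> g j \<in> ?C" using y(1) by simp
  qed
qed

end

context regular_pullback
begin

text \<open>
  Lift the generators of a regular ideal of \<open>R\<close> to \<open>A\<close>; together with \<open>s\<close> they generate a regular ideal.
  If \<open>a\<close> is a lift of the regular element \<open>r\<close>, a multiplier \<open>c / s\<close> for this ideal takes \<open>a\<close> to some
  \<open>q \<in> A\<close>, and \<open>\<rho>(q) / r\<close> is a multiplier over \<open>R\<close> with the same products modulo the kernel.  The product
  of \<open>c / s\<close> with \<open>s\<close> lies in the kernel, because \<open>c a = s q\<close> implies \<open>\<rho>(c) r = 0\<close>.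
\<close>

lemma regular_fg_invertible_from_pullback_base:
  assumes rf: "regular_fg_invertible A"
  shows "regular_fg_invertible R"
  unfolding regular_fg_invertible_def
proof (intro allI impI, elim conjE)
  interpret A: cring A by (rule cring_A)
  interpret \<rho>: ring_hom_cring A R \<rho> by (rule \<rho>_hom_cring)
  fix S r
  assume S: "finite S" "S \<subseteq> carrier R" and rS: "r \<in> Idl\<^bsub>R\<^esub> S" and r: "r \<in> regular_elements R"
  have rc: "r \<in> carrier R" by (rule R.regular_elementsD(1)[OF r])
  obtain S' where S': "finite S'" "S' \<subseteq> carrier A" "S = \<rho> ` S'"
    using finite_subset_image[OF S(1), of \<rho> "carrier A"] S(2) \<rho>_surj by auto
  obtain a where a: "a \<in> Idl\<^bsub>A\<^esub> S'" "\<rho> a = r"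
    using \<rho>.hom_genideal_lift[OF \<rho>_surj S'(2)] rS unfolding S'(3) by blast
  note IS' = A.genideal_ideal[OF S'(2)]
  have aA: "a \<in> pullback" using a(1) A.idealD(1)[OF IS'] by auto
  let ?S = "insert s S'"
  have SA: "?S \<subseteq> carrier A" using S' s_pullback by auto
  have "s \<in> Idl\<^bsub>A\<^esub> ?S" using A.genideal_self[OF SA] by blast
  moreover have sr: "s \<in> regular_elements A" using regular_pullback_iff[OF s_pullback] s_regular by blast
  ultimately have one: "\<one>\<^bsub>A\<^esub> \<in> Idl\<^bsub>A\<^esub> (inverse_products A ?S s)"
    using rf S'(1) SA unfolding regular_fg_invertible_def by blast
  have \<rho>s: "\<rho> s = \<zero>\<^bsub>R\<^esub>" by (rule \<rho>_eqI[OF s_pullback]) (simp_all add: \<pi>_s)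
  let ?E = "inverse_products R S r"
  note IE = R.genideal_ideal[OF R.inverse_products_carrier, of S r]
  have "\<rho> e \<in> Idl\<^bsub>R\<^esub> ?E" if e: "e \<in> Idl\<^bsub>A\<^esub> (inverse_products A ?S s)" for e
    using e A.inverse_products_carrier
  proof (induction rule: A.genideal_induct)
    case zero
    have "\<rho> \<zero> = \<zero>\<^bsub>R\<^esub>" using \<rho>.hom_zero by simp
    then show ?case using R.idealD(2)[OF IE] by simp
  next
    case (add x y)
    then show ?case using R.idealD(3)[OF IE add(3,4)] \<rho>.hom_add[OF add(1,2)] by simp
  next
    case (mult x t)
    then show ?case using R.idealD(5)[OF IE mult(3)] \<rho>.hom_mult[OF mult(2,1)] \<rho>(1) by simp
  next
    case (gen e)
    then obtain b c where e: "e \<in> pullback" and b: "b \<in> ?S" and c: "c \<in> pullback" "c \<otimes> b = s \<otimes> e"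
      and cS: "\<forall>x \<in> ?S. \<exists>d \<in> pullback. c \<otimes> x = s \<otimes> d" unfolding inverse_products_def by auto
    have cB: "c \<in> carrier B" "e \<in> carrier B" "a \<in> carrier B" using c e aA pullback_carrier by auto
    have "\<exists>d \<in> pullback. c \<otimes> x = s \<otimes> d" if "x \<in> Idl\<^bsub>A\<^esub> S'" for x
      using that S'(2)
    proof (induction rule: A.genideal_induct)
      case zero
      have "c \<otimes> \<zero> = s \<otimes> \<zero>" using cB s_carrier by simp
      moreover have "\<zero> \<in> pullback" by (rule kernel_pullback) simp_all
      ultimately show ?case by auto
    next
      case (gen x) then show ?case using cS by blast
    next
      case (add x y)
      then obtain d d' where d: "d \<in> pullback" "c \<otimes> x = s \<otimes> d" "d' \<in> pullback" "c \<otimes> y = s \<otimes> d'" by blast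
      have "c \<otimes> (x \<oplus> y) = s \<otimes> (d \<oplus> d')"
        using d add pullback_carrier cB s_carrier by (simp add: r_distr)
      then show ?case using subringE(7)[OF subring_pullback d(1,3)] by auto
    next
      case (mult x t)
      then obtain d where d: "d \<in> pullback" "c \<otimes> x = s \<otimes> d" by blast
      have tc: "t \<in> carrier B" "x \<in> carrier B" "d \<in> carrier B" using mult d pullback_carrier by auto
      have "c \<otimes> (t \<otimes> x) = t \<otimes> (c \<otimes> x)" using tc cB by (simp add: m_lcomm)
      also have "\<dots> = s \<otimes> (t \<otimes> d)" unfolding d(2) using tc s_carrier by (simp add: m_lcomm)
      finally show ?case using subringE(6)[OF subring_pullback _ d(1), of t] mult by auto
    qed
    from this[OF a(1)] obtain q where q: "q \<in> pullback" "c \<otimes> a = s \<otimes> q" by blast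
    have qB: "q \<in> carrier B" using pullback_carrier[OF q(1)] .
    have \<rho>q: "\<rho> q \<otimes>\<^bsub>R\<^esub> \<rho> x = r \<otimes>\<^bsub>R\<^esub> \<rho> d"
      if x: "x \<in> pullback" and d: "d \<in> pullback" "c \<otimes> x = s \<otimes> d" for x d
    proof -
      have xB: "x \<in> carrier B" "d \<in> carrier B" using x d pullback_carrier by auto
      have "s \<otimes> (q \<otimes> x) = (c \<otimes> a) \<otimes> x" unfolding q(2) using s_carrier qB xB by (simp add: m_assoc)
      also have "\<dots> = a \<otimes> (c \<otimes> x)" using cB xB by (simp add: m_ac)
      also have "\<dots> = s \<otimes> (a \<otimes> d)" unfolding d(2) using s_carrier cB xB by (simp add: m_lcomm)
      finally have "q \<otimes> x = a \<otimes> d" using s_cancel qB xB cB by simp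
      then have "\<rho> (q \<otimes> x) = \<rho> (a \<otimes> d)" by simp
      then show ?thesis using \<rho>.hom_mult[of q x] \<rho>.hom_mult[of a d] q(1) x aA d(1) a(2) by simp
    qed
    show ?case
    proof (cases "b = s")
      case True
      have "e = c" using s_cancel[of e c] c(2) True cB s_carrier by (simp add: m_comm)
      have "\<rho> (c \<otimes> a) = \<rho> (s \<otimes> q)" by (simp only: q(2))
      then have "\<rho> c \<otimes>\<^bsub>R\<^esub> r = \<zero>\<^bsub>R\<^esub> \<otimes>\<^bsub>R\<^esub> \<rho> q"
        using \<rho>.hom_mult[of c a] \<rho>.hom_mult[of s q] q(1) aA c(1) s_pullback a(2) \<rho>s by simp
      then have "r \<otimes>\<^bsub>R\<^esub> \<rho> c = \<zero>\<^bsub>R\<^esub>" using \<rho>(1) c(1) q(1) rc by (simp add: R.m_comm)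
      then have "\<rho> c = \<zero>\<^bsub>R\<^esub>" using R.regular_elementsD(2)[OF r] \<rho>(1)[OF c(1)] by blast
      then show ?thesis using \<open>e = c\<close> R.idealD(2)[OF IE] by simp
    next
      case False
      then have bS: "b \<in> S'" using b by blast
      have "\<forall>y \<in> S. \<exists>d \<in> carrier R. \<rho> q \<otimes>\<^bsub>R\<^esub> y = r \<otimes>\<^bsub>R\<^esub> d"
      proof
        fix y assume "y \<in> S"
        then obtain x where x: "x \<in> S'" "y = \<rho> x" using S'(3) by blast
        obtain d where d: "d \<in> pullback" "c \<otimes> x = s \<otimes> d" using cS x by blast
        show "\<exists>d \<in> carrier R. \<rho> q \<otimes>\<^bsub>R\<^esub> y = r \<otimes>\<^bsub>R\<^esub> d"
          using \<rho>q[OF _ d] x S'(2) \<rho>(1)[OF d(1)] by auto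
      qed
      moreover have "\<rho> q \<otimes>\<^bsub>R\<^esub> \<rho> b = r \<otimes>\<^bsub>R\<^esub> \<rho> e" using \<rho>q[OF _ e c(2)] bS S'(2) by auto
      moreover have "\<rho> b \<in> S" using bS S'(3) by blast
      ultimately have "\<rho> e \<in> ?E"
        unfolding inverse_products_def using \<rho>(1)[OF e] \<rho>(1)[OF q(1)] by blast
      then show ?thesis using R.genideal_self[OF R.inverse_products_carrier] by blast
    qed
  qed
  from this[OF one] show "\<one>\<^bsub>R\<^esub> \<in> Idl\<^bsub>R\<^esub> ?E" using \<rho>.hom_one by simp
qed

text \<open>
  A multiplier over \<open>A\<close> for generators and regular element scaled by \<open>s\<close> is one over \<open>B\<close> for the
  original data, since \<open>s\<close> cancels.
\<close>

lemma regular_fg_invertible_from_pullback_top: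
  assumes rf: "regular_fg_invertible A"
  shows "regular_fg_invertible B"
  unfolding regular_fg_invertible_def
proof (intro allI impI, elim conjE)
  interpret A: cring A by (rule cring_A)
  fix S b
  assume S: "finite S" "S \<subseteq> carrier B" and bS: "b \<in> Idl\<^bsub>B\<^esub> S" and b: "b \<in> regular_elements B"
  have bc: "b \<in> carrier B" by (rule B.regular_elementsD(1)[OF b])
  \<comment> \<open>The \<open>A\<close>-ideal generated by \<open>s S\<close> need not contain a regular element, so \<open>s b\<close> is adjoined;
    this does not change the \<open>B\<close>-ideal.\<close>
  let ?S = "(\<lambda>x. s \<otimes> x) ` insert b S"
  have SA: "?S \<subseteq> carrier A" using S bc s_mult by auto
  have "s \<otimes> b \<in> regular_elements A"
    using regular_pullback_iff[OF s_mult[OF bc]] B.regular_elements_closed(2)[OF s_regular b] by blast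
  moreover have "s \<otimes> b \<in> Idl\<^bsub>A\<^esub> ?S" using A.genideal_self[OF SA] by blast
  ultimately have one: "\<one>\<^bsub>A\<^esub> \<in> Idl\<^bsub>A\<^esub> (inverse_products A ?S (s \<otimes> b))"
    using rf[unfolded regular_fg_invertible_def, rule_format, of ?S "s \<otimes> b"] S(1) SA by simp
  let ?E = "inverse_products B S b"
  note IE = B.genideal_ideal[OF B.inverse_products_carrier, of S b]
  have "e \<in> Idl\<^bsub>B\<^esub> ?E" if e: "e \<in> Idl\<^bsub>A\<^esub> (inverse_products A ?S (s \<otimes> b))" for e
    using e A.inverse_products_carrier
  proof (induction rule: A.genideal_induct)
    case zero then show ?case using B.idealD(2)[OF IE] by simp
  next
    case (add x y) then show ?case using B.idealD(3)[OF IE] by simp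
  next
    case (mult x t) then show ?case using B.idealD(5)[OF IE] pullback_carrier by simp
  next
    case (gen e)
    then obtain x c where e: "e \<in> pullback" and x: "x \<in> insert b S" and c: "c \<in> pullback"
      and cx: "c \<otimes> (s \<otimes> x) = (s \<otimes> b) \<otimes> e"
      and cS: "\<forall>y \<in> S. \<exists>d \<in> pullback. c \<otimes> (s \<otimes> y) = (s \<otimes> b) \<otimes> d" unfolding inverse_products_def by auto
    have cB: "c \<in> carrier B" "e \<in> carrier B" using c e pullback_carrier by auto
    have div: "c \<otimes> y = b \<otimes> d"
      if y: "y \<in> carrier B" and d: "d \<in> carrier B" "c \<otimes> (s \<otimes> y) = (s \<otimes> b) \<otimes> d" for y d
    proof (rule s_cancel)
      show "s \<otimes> (c \<otimes> y) = s \<otimes> (b \<otimes> d)" using d cB y bc s_carrier by (simp add: m_lcomm m_assoc)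
    qed (use cB y d bc in auto)
    have div': "\<exists>d \<in> carrier B. c \<otimes> y = b \<otimes> d" if y: "y \<in> S" for y
      using cS y div[of y] S(2) pullback_carrier by blast
    have E: "d \<in> ?E" if "y \<in> S" "d \<in> carrier B" "c \<otimes> y = b \<otimes> d" for y d
      unfolding inverse_products_def using that div' cB by blast
    show ?case
    proof (cases "x \<in> S")
      case True
      then have "e \<in> ?E" using E[OF True cB(2) div[OF _ cB(2) cx]] S(2) by blast
      then show ?thesis using B.genideal_self[OF B.inverse_products_carrier] by blast
    next
      case False
      then have "c \<otimes> b = b \<otimes> e" using x div[OF _ cB(2) cx] bc by blast
      then have "b \<otimes> c = b \<otimes> e" using bc cB by (simp add: m_comm)
      then have "c = e" using B.regular_elementsD(3)[OF b] cB by blast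
      moreover have "c \<in> Idl\<^bsub>B\<^esub> ?E"
      proof (rule B.multiplier_mem[OF S(2) bS b cB(1) IE])
        fix y assume y: "y \<in> S"
        obtain d where d: "d \<in> carrier B" "c \<otimes> y = b \<otimes> d" using div'[OF y] by blast
        then have "d \<in> Idl\<^bsub>B\<^esub> ?E" using E[OF y d] B.genideal_self[OF B.inverse_products_carrier] by blast
        then show "\<exists>d \<in> Idl\<^bsub>B\<^esub> ?E. c \<otimes> y = b \<otimes> d" using d by blast
      qed
      ultimately show ?thesis by simp
    qed
  qed
  from this[OF one] show "\<one> \<in> Idl\<^bsub>B\<^esub> ?E" by simp
qed

end
theorem theorem3p1:
  fixes B :: "('b, 'm) ring_scheme"
    and R :: "('a, 'k) ring_scheme"
    and T :: "('a \<times> 'a) set set"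
    and \<pi> :: "'b \<Rightarrow> ('a \<times> 'a) set"
    and A :: "('b, 'm) ring_scheme"
  assumes "cring B" and "cring R"
    and "overring T R"
    and "\<pi> \<in> ring_hom B ((tot R)\<lparr>carrier := T\<rparr>)"
    and "\<pi> ` carrier B = T"
    and "regular_ideal (a_kernel B ((tot R)\<lparr>carrier := T\<rparr>) \<pi>) B"
    and "A = B\<lparr>carrier := {x \<in> carrier B. \<pi> x \<in> in_tot R}\<rparr>"
  shows "(Prufer_ring A \<longleftrightarrow> Prufer_ring B \<and> Prufer_ring R)
    \<and> (Gaussian_ring A \<longleftrightarrow> Gaussian_ring B \<and> Gaussian_ring R)
    \<and> (arithmetical_ring A \<longleftrightarrow> arithmetical_ring B \<and> arithmetical_ring R)
    \<and> (weak_gldim_le_1 TYPE('b list) B \<and> weak_gldim_le_1 TYPE('a list) R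
         \<longrightarrow> weak_gldim_le_1 TYPE('n) A)
    \<and> (semihereditary_ring TYPE('b list) B \<and> semihereditary_ring TYPE('a list) R
         \<longrightarrow> semihereditary_ring TYPE('n) A)"
proof -
  interpret B: cring B by fact
  interpret R: cring R by fact
  interpret K: cring "tot R" by (rule R.cring_tot)
  have T: "T \<subseteq> carrier (tot R)" "in_tot R \<subseteq> T"
    using assms(3) subcringE(1) unfolding overring_def by auto
  have \<pi>: "\<pi> \<in> ring_hom B (tot R)"
    using assms(4) T(1) unfolding ring_hom_def by auto
  obtain s where s: "s \<in> regular_elements B" "\<pi> s = \<zero>\<^bsub>tot R\<^esub>"
    using assms(6) unfolding regular_ideal_def a_kernel_def' by auto
  interpret P: regular_pullback B R "tot R" \<pi> "tot_embed R" s
  proof (rule regular_pullback.intro, rule B.is_cring, rule R.is_cring, rule K.is_cring,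
      rule regular_pullback_axioms.intro)
    show "\<exists>r \<in> regular_elements R. \<exists>a \<in> carrier R. tot_embed R r \<otimes>\<^bsub>tot R\<^esub> \<pi> x = tot_embed R a"
      if "x \<in> carrier B" for x
      by (rule R.tot_embed_denominator) (use that assms(5) T(1) in blast)
    show "in_tot R \<subseteq> \<pi> ` carrier B" using assms(5) T(2) by simp
  qed (rule \<pi> s R.tot_embed_hom R.tot_embed_inj R.tot_embed_regular; assumption)+
  have A: "A = P.A" unfolding assms(7) P.pullback_def ..
  interpret A: cring A unfolding A by (rule P.cring_A)
  have ext: "Prufer_extension B P.pullback" if "regular_fg_invertible R"
    by (rule P.Prufer_extension_pullback[OF that])
  have sd: "regular_fg_invertible R" if "\<And>P. primeideal P R \<Longrightarrow> square_dominated R P"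
    by (rule R.square_dominated_imp_regular_fg_invertible[OF that])
  have cq: "Prufer_extension B P.pullback" if "comaximal_quotients R"
    by (intro ext sd R.comaximal_quotients_imp_square_dominated that)
  have "Prufer_ring A \<longleftrightarrow> Prufer_ring B \<and> Prufer_ring R"
    unfolding A.Prufer_ring_iff B.Prufer_ring_iff R.Prufer_ring_iff
  proof (intro iffI conjI)
    assume "regular_fg_invertible A"
    then show "regular_fg_invertible B" "regular_fg_invertible R"
      unfolding A by (rule P.regular_fg_invertible_from_pullback_top
          P.regular_fg_invertible_from_pullback_base)+
  next
    assume "regular_fg_invertible B \<and> regular_fg_invertible R"
    then have rf: "regular_fg_invertible B" and ex: "Prufer_extension B P.pullback" using ext by auto
    have "regular_elements P.A \<subseteq> regular_elements B"
    proof
      fix x assume x: "x \<in> regular_elements P.A"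
      then have "x \<in> P.pullback" by (simp add: regular_elements_def)
      then show "x \<in> regular_elements B" using P.regular_pullback_iff x by blast
    qed
    then show "regular_fg_invertible A"
      unfolding A by (rule Prufer_extension.regular_fg_invertible_restrict[OF ex rf])
  qed
  moreover have "Gaussian_ring A \<longleftrightarrow> Gaussian_ring B \<and> Gaussian_ring R"
  proof (intro iffI conjI)
    assume "Gaussian_ring A"
    then show "Gaussian_ring B" "Gaussian_ring R"
      unfolding A by (rule P.Gaussian_from_pullback)+
  next
    assume G: "Gaussian_ring B \<and> Gaussian_ring R"
    then have "Prufer_extension B P.pullback"
      by (intro ext sd R.Gaussian_imp_square_dominated) auto
    then show "Gaussian_ring A"
      unfolding A using G
      by (intro Prufer_extension.Gaussian_restrict B.Gaussian_imp_square_dominated) auto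
  qed
  moreover have "arithmetical_ring A \<longleftrightarrow> arithmetical_ring B \<and> arithmetical_ring R"
    unfolding A.arithmetical_iff_comaximal_quotients B.arithmetical_iff_comaximal_quotients
      R.arithmetical_iff_comaximal_quotients
  proof (intro iffI conjI)
    assume "comaximal_quotients A"
    then show "comaximal_quotients B" "comaximal_quotients R"
      unfolding A by (rule P.comaximal_quotients_from_pullback)+
  next
    assume "comaximal_quotients B \<and> comaximal_quotients R"
    then show "comaximal_quotients A"
      unfolding A by (intro Prufer_extension.comaximal_quotients_restrict cq) auto
  qed
  moreover have "weak_gldim_le_1 TYPE('n) A"
    if wg: "weak_gldim_le_1 TYPE('b list) B" "weak_gldim_le_1 TYPE('a list) R"
  proof (rule A.weak_gldimI)
    note ex = cq[OF R.flat_imp_comaximal_quotients[OF wg(2)]]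
    show "comaximal_quotients A"
      unfolding A by (rule Prufer_extension.comaximal_quotients_restrict
          [OF ex B.flat_imp_comaximal_quotients[OF wg(1)]])
    show "pure_annihilators A"
      unfolding A by (rule Prufer_extension.pure_annihilators_restrict
          [OF ex B.flat_imp_pure_annihilators[OF wg(1)]])
  qed
  moreover have "semihereditary_ring TYPE('n) A"
    if sh: "semihereditary_ring TYPE('b list) B" "semihereditary_ring TYPE('a list) R"
  proof (rule A.semihereditaryI)
    note ex = cq[OF R.semihereditary_imp_comaximal_quotients[OF sh(2)]]
    show "comaximal_quotients A"
      unfolding A by (rule Prufer_extension.comaximal_quotients_restrict
          [OF ex B.semihereditary_imp_comaximal_quotients[OF sh(1)]])
    show "idempotent_annihilators A"
      unfolding A by (rule Prufer_extension.idempotent_annihilators_restrict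
          [OF ex B.semihereditary_imp_idempotent_annihilators[OF sh(1)]])
  qed
  ultimately show ?thesis by blast
qed

end
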